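(* Let $V$ be a complex vector space of dimension $n+1$, let $d\ge1$ and $1\le k\le n$, and let $f\in\mathrm{SOS}_k\subset\mathrm{Sym}^{2d}V$ be general. Then there is a positive integer $p$ such that $\mathrm{SOS}_k(f)$ is isomorphic to a disjoint union of $p$ copies of $\mathrm{O}(k)$. In particular $\deg\mathrm{SOS}_k(f)\ge\deg\mathrm{O}(k)$; in fact $\deg\mathrm{SOS}_k(f)\equiv 0 \pmod{\deg\mathrm{O}(k)}$.
   Context: $\mathrm{Sym}^mV$ denotes the space of homogeneous polynomials of degree $m$ in $x_0,\dots,x_n$ over $\mathbb{C}$, where $x_0,\dots,x_n$ is a basis of $V$. For $k\ge1$, $\mathrm{SOS}_k\subset \mathrm{Sym}^{2d}V$ is the Zariski closure of $\{f_1^2+\dots+f_k^2 : f_i\in \mathrm{Sym}^dV\}$; it is an irreducible affine variety. For $f\in\mathrm{SOS}_k$, $\mathrm{SOS}_k(f)=\{(f_1,\dots,f_k)\in \prod_{i=1}^k\mathrm{Sym}^dV : \sum_{i=1}^k f_i^2=f\}$, viewed as an affine algebraic variety in the affine space $\prod_{i=1}^k\mathrm{Sym}^dV$. "General $f\in\mathrm{SOS}_k$" means: for all $f$ in some dense Zariski-open subset of $\mathrm{SOS}_k$. $\mathrm{O}(k)=\{O\in\mathbb{C}^{k\times k}:O^tO=I\}$ is the complex orthogonal group, viewed as an affine variety in $\mathbb{C}^{k\times k}$. The degree of an equidimensional affine variety is the degree of its Zariski closure in projective space. *)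

theory Defs
  imports
    "HOL-Analysis.Analysis"
    "HOL-Library.Poly_Mapping"
    "HOL-Computational_Algebra.Polynomial"
    "HOL-Number_Theory.Cong"
    "Jordan_Normal_Form.Matrix"
begin

section \<open>Complex polynomials in variables indexed by an arbitrary type\<close>

text \<open>A monomial is a finitely supported exponent vector, and the product of
  \<^typ>\<open>('i \<Rightarrow>\<^sub>0 nat) \<Rightarrow>\<^sub>0 complex\<close> is the convolution product, so this type is the polynomial ring
  with variables indexed by \<^typ>\<open>'i\<close>.\<close>

type_synonym 'i cpoly = "('i \<Rightarrow>\<^sub>0 nat) \<Rightarrow>\<^sub>0 complex"

definition mon_eval :: "('i \<Rightarrow> complex) \<Rightarrow> ('i \<Rightarrow>\<^sub>0 nat) \<Rightarrow> complex" where
  "mon_eval x a = (\<Prod>i\<in>Poly_Mapping.keys a. x i ^ Poly_Mapping.lookup a i)"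

definition cpoly_eval :: "('i \<Rightarrow> complex) \<Rightarrow> 'i cpoly \<Rightarrow> complex" where
  "cpoly_eval x f = (\<Sum>a\<in>Poly_Mapping.keys f. Poly_Mapping.lookup f a * mon_eval x a)"

definition cpolys :: "'i set \<Rightarrow> 'i cpoly set" where
  "cpolys I = {f. \<forall>a\<in>Poly_Mapping.keys f. Poly_Mapping.keys a \<subseteq> I}"

definition monomials :: "'i set \<Rightarrow> nat \<Rightarrow> ('i \<Rightarrow>\<^sub>0 nat) set" where
  "monomials I m =
     {a. Poly_Mapping.keys a \<subseteq> I \<and> (\<Sum>i\<in>Poly_Mapping.keys a. Poly_Mapping.lookup a i) = m}"

text \<open>The zero polynomial is a form of every degree.\<close>

definition forms :: "'i set \<Rightarrow> nat \<Rightarrow> 'i cpoly set" where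
  "forms I m = {f. Poly_Mapping.keys f \<subseteq> monomials I m}"

definition cpoly_scale :: "complex \<Rightarrow> 'i cpoly \<Rightarrow> 'i cpoly" where
  "cpoly_scale c f = Poly_Mapping.map ((*) c) f"

lemma cpoly_scale_eq: "cpoly_scale c f = Poly_Mapping.single 0 c * f"
  by (simp add: cpoly_scale_def mult_map_scale_conv_mult)

global_interpretation cpoly: vector_space cpoly_scale
  by standard
    (simp_all add: cpoly_scale_eq distrib_left distrib_right single_add mult_single
       flip: mult.assoc)

lemma mon_eval_superset:
  assumes "finite A" "Poly_Mapping.keys a \<subseteq> A"
  shows "mon_eval x a = (\<Prod>i\<in>A. x i ^ Poly_Mapping.lookup a i)"
  unfolding mon_eval_def
  by (rule prod.mono_neutral_left) (use assms in \<open>auto simp: in_keys_iff\<close>)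

lemma mon_eval_add: "mon_eval x (a + b) = mon_eval x a * mon_eval x b"
proof -
  let ?A = "Poly_Mapping.keys a \<union> Poly_Mapping.keys b"
  have "Poly_Mapping.keys (a + b) \<subseteq> ?A" by (rule keys_add)
  then show ?thesis
    by (simp add: mon_eval_superset[of ?A] lookup_add power_add prod.distrib)
qed

lemma cpoly_eval_superset:
  assumes "finite A" "Poly_Mapping.keys f \<subseteq> A"
  shows "cpoly_eval x f = (\<Sum>a\<in>A. Poly_Mapping.lookup f a * mon_eval x a)"
  unfolding cpoly_eval_def
  by (rule sum.mono_neutral_left) (use assms in \<open>auto simp: in_keys_iff\<close>)

lemma cpoly_eval_zero [simp]: "cpoly_eval x 0 = 0"
  by (simp add: cpoly_eval_def)

lemma cpoly_eval_one [simp]: "cpoly_eval x 1 = 1"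
  by (simp add: cpoly_eval_def mon_eval_def)

lemma cpoly_eval_single: "cpoly_eval x (Poly_Mapping.single a c) = c * mon_eval x a"
  by (simp add: cpoly_eval_def)

lemma cpoly_eval_add: "cpoly_eval x (f + g) = cpoly_eval x f + cpoly_eval x g"
proof -
  let ?A = "Poly_Mapping.keys f \<union> Poly_Mapping.keys g"
  have "Poly_Mapping.keys (f + g) \<subseteq> ?A" by (rule keys_add)
  then show ?thesis
    by (simp add: cpoly_eval_superset[of ?A] lookup_add distrib_right sum.distrib)
qed

lemma cpoly_eval_sum: "cpoly_eval x (\<Sum>i\<in>A. f i) = (\<Sum>i\<in>A. cpoly_eval x (f i))"
  by (induction A rule: infinite_finite_induct) (simp_all add: cpoly_eval_add)

lemma cpoly_eq_sum_single:
  "f = (\<Sum>a\<in>Poly_Mapping.keys f. Poly_Mapping.single a (Poly_Mapping.lookup f a))"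
  by (rule poly_mapping_eqI)
    (auto simp: lookup_sum lookup_single when_def in_keys_iff)

lemma cpoly_eval_mult: "cpoly_eval x (f * g) = cpoly_eval x f * cpoly_eval x g"
proof -
  let ?s = "\<lambda>f a. Poly_Mapping.single a (Poly_Mapping.lookup f a)"
  have "f * g = (\<Sum>a\<in>Poly_Mapping.keys f. ?s f a) * (\<Sum>b\<in>Poly_Mapping.keys g. ?s g b)"
    by (simp flip: cpoly_eq_sum_single)
  also have "cpoly_eval x \<dots> = (\<Sum>a\<in>Poly_Mapping.keys f. \<Sum>b\<in>Poly_Mapping.keys g.
      cpoly_eval x (?s f a) * cpoly_eval x (?s g b))"
    by (simp add: sum_product cpoly_eval_sum mult_single cpoly_eval_single mon_eval_add
        mult.assoc mult.left_commute)
  also have "\<dots> = cpoly_eval x f * cpoly_eval x g"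
    by (simp add: sum_product cpoly_eval_single) (simp add: cpoly_eval_def sum_product)
  finally show ?thesis .
qed

lemma cpolys_mult: "f \<in> cpolys I \<Longrightarrow> g \<in> cpolys I \<Longrightarrow> f * g \<in> cpolys I"
proof -
  assume f: "f \<in> cpolys I" and g: "g \<in> cpolys I"
  have "Poly_Mapping.keys c \<subseteq> I" if "c \<in> Poly_Mapping.keys (f * g)" for c
  proof -
    obtain a b where "c = a + b" "a \<in> Poly_Mapping.keys f" "b \<in> Poly_Mapping.keys g"
      using keys_mult[of f g] \<open>c \<in> Poly_Mapping.keys (f * g)\<close> by auto
    moreover have "Poly_Mapping.keys (a + b) \<subseteq> Poly_Mapping.keys a \<union> Poly_Mapping.keys b"
      by (rule keys_add)
    ultimately show ?thesis using f g unfolding cpolys_def by blast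
  qed
  then show ?thesis unfolding cpolys_def by blast
qed

section \<open>Affine space and its Zariski topology\<close>

text \<open>Affine space with coordinates indexed by \<open>I\<close>; off \<open>I\<close> the coordinates are set to \<open>0\<close>.\<close>

definition affine_space :: "'i set \<Rightarrow> ('i \<Rightarrow> complex) set" where
  "affine_space I = {x. \<forall>i. i \<notin> I \<longrightarrow> x i = 0}"

definition zero_locus :: "'i set \<Rightarrow> 'i cpoly set \<Rightarrow> ('i \<Rightarrow> complex) set" where
  "zero_locus I P = {x \<in> affine_space I. \<forall>f\<in>P. cpoly_eval x f = 0}"

definition zariski :: "'i set \<Rightarrow> ('i \<Rightarrow> complex) topology" where
  "zariski I = topology (\<lambda>U. \<exists>P\<subseteq>cpolys I. U = affine_space I - zero_locus I P)"

lemma istopology_zariski: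
  "istopology (\<lambda>U. \<exists>P\<subseteq>cpolys I. U = affine_space I - zero_locus I P)"
  unfolding istopology_def
proof (intro conjI allI impI)
  fix S T
  assume "\<exists>P\<subseteq>cpolys I. S = affine_space I - zero_locus I P"
    and "\<exists>P\<subseteq>cpolys I. T = affine_space I - zero_locus I P"
  then obtain P Q where P: "P \<subseteq> cpolys I" "S = affine_space I - zero_locus I P"
    and Q: "Q \<subseteq> cpolys I" "T = affine_space I - zero_locus I Q" by blast
  let ?R = "{f * g | f g. f \<in> P \<and> g \<in> Q}"
  have "?R \<subseteq> cpolys I" using P(1) Q(1) cpolys_mult by blast
  moreover have "S \<inter> T = affine_space I - zero_locus I ?R"
  proof (intro equalityI subsetI)
    fix x assume "x \<in> S \<inter> T"
    then obtain f g where fg: "x \<in> affine_space I" "f \<in> P" "g \<in> Q"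
      "cpoly_eval x f \<noteq> 0" "cpoly_eval x g \<noteq> 0"
      unfolding P(2) Q(2) zero_locus_def by blast
    then have "cpoly_eval x (f * g) \<noteq> 0" by (simp add: cpoly_eval_mult)
    then show "x \<in> affine_space I - zero_locus I ?R"
      using fg unfolding zero_locus_def by blast
  next
    fix x assume "x \<in> affine_space I - zero_locus I ?R"
    then obtain f g where fg: "x \<in> affine_space I" "f \<in> P" "g \<in> Q"
      "cpoly_eval x (f * g) \<noteq> 0"
      unfolding zero_locus_def by blast
    then have "cpoly_eval x f \<noteq> 0" "cpoly_eval x g \<noteq> 0"
      by (auto simp: cpoly_eval_mult)
    then show "x \<in> S \<inter> T"
      using fg unfolding P(2) Q(2) zero_locus_def by blast
  qed
  ultimately show "\<exists>P\<subseteq>cpolys I. S \<inter> T = affine_space I - zero_locus I P" by blast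
next
  fix K
  assume "\<forall>S\<in>K. \<exists>P\<subseteq>cpolys I. S = affine_space I - zero_locus I P"
  then obtain P where P: "\<And>S. S \<in> K \<Longrightarrow> P S \<subseteq> cpolys I"
    "\<And>S. S \<in> K \<Longrightarrow> S = affine_space I - zero_locus I (P S)" by metis
  have "\<Union>K = (\<Union>S\<in>K. affine_space I - zero_locus I (P S))" using P(2) by auto
  also have "\<dots> = affine_space I - zero_locus I (\<Union>S\<in>K. P S)"
    unfolding zero_locus_def by auto
  finally show "\<exists>P\<subseteq>cpolys I. \<Union>K = affine_space I - zero_locus I P"
    using P(1) by (intro exI[of _ "\<Union>S\<in>K. P S"]) blast
qed

lemma openin_zariski:
  "openin (zariski I) U \<longleftrightarrow> (\<exists>P\<subseteq>cpolys I. U = affine_space I - zero_locus I P)"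
  unfolding zariski_def topology_inverse'[OF istopology_zariski] ..

lemma topspace_zariski [simp]: "topspace (zariski I) = affine_space I"
proof
  show "topspace (zariski I) \<subseteq> affine_space I"
    using openin_topspace[of "zariski I"] unfolding openin_zariski by blast
  have "{1} \<subseteq> cpolys I" by (simp add: cpolys_def)
  moreover have "affine_space I = affine_space I - zero_locus I {1}"
    by (simp add: zero_locus_def)
  ultimately have "openin (zariski I) (affine_space I)" unfolding openin_zariski by blast
  then show "affine_space I \<subseteq> topspace (zariski I)" by (rule openin_subset)
qed

lemma closedin_zariski: "closedin (zariski I) Z \<longleftrightarrow> (\<exists>P\<subseteq>cpolys I. Z = zero_locus I P)"
proof -
  have "Z \<subseteq> affine_space I \<and> affine_space I - Z = affine_space I - zero_locus I P \<longleftrightarrow>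
      Z = zero_locus I P" for P
    unfolding zero_locus_def by blast
  then show ?thesis
    unfolding closedin_def openin_zariski topspace_zariski by blast
qed

text \<open>A property holds for a general point of \<open>X\<close>.\<close>

definition for_general :: "'a topology \<Rightarrow> ('a \<Rightarrow> bool) \<Rightarrow> bool" where
  "for_general X P \<longleftrightarrow>
     (\<exists>U. openin X U \<and> Abstract_Topology.closure_of X U = topspace X \<and> (\<forall>x\<in>U. P x))"

section \<open>Morphisms of affine varieties, disjoint unions\<close>

definition regular_map ::
  "'i set \<Rightarrow> ('i \<Rightarrow> complex) set \<Rightarrow> 'j set \<Rightarrow> ('j \<Rightarrow> complex) set \<Rightarrow>
    (('i \<Rightarrow> complex) \<Rightarrow> ('j \<Rightarrow> complex)) \<Rightarrow> bool" where
  "regular_map I X J Y \<phi> \<longleftrightarrow>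
     \<phi> \<in> X \<rightarrow> Y \<and> (\<forall>j\<in>J. \<exists>g\<in>cpolys I. \<forall>x\<in>X. \<phi> x j = cpoly_eval x g)"

definition isomorphic_varieties ::
  "'i set \<Rightarrow> ('i \<Rightarrow> complex) set \<Rightarrow> 'j set \<Rightarrow> ('j \<Rightarrow> complex) set \<Rightarrow> bool" where
  "isomorphic_varieties I X J Y \<longleftrightarrow>
     closedin (zariski I) X \<and> closedin (zariski J) Y \<and>
     (\<exists>\<phi> \<psi>. regular_map I X J Y \<phi> \<and> regular_map J Y I X \<psi> \<and>
        (\<forall>x\<in>X. \<psi> (\<phi> x) = x) \<and> (\<forall>y\<in>Y. \<phi> (\<psi> y) = y))"

text \<open>Adding one coordinate, indexed by \<^term>\<open>None\<close>, to an affine space.\<close>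

definition add_index :: "'i set \<Rightarrow> 'i option set" where
  "add_index I = insert None (Some ` I)"

definition add_coord :: "complex \<Rightarrow> ('i \<Rightarrow> complex) \<Rightarrow> ('i option \<Rightarrow> complex)" where
  "add_coord c x = case_option c x"

text \<open>The disjoint union of \<open>p\<close> copies of \<open>X \<subseteq> \<complex>\<^sup>I\<close>, realised as \<open>{0, \<dots>, p - 1} \<times> X\<close> in
  \<open>\<complex> \<times> \<complex>\<^sup>I\<close>, a closed set whose \<open>p\<close> slices are closed and open and are copies of \<open>X\<close>.\<close>

definition disjoint_copies :: "nat \<Rightarrow> ('i \<Rightarrow> complex) set \<Rightarrow> ('i option \<Rightarrow> complex) set" where
  "disjoint_copies p X = {add_coord (of_nat c) x | c x. c < p \<and> x \<in> X}"

section \<open>Degree\<close>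

text \<open>A subset of projective space with homogeneous coordinates indexed by \<open>J\<close> is represented
  by the set of all its nonzero coordinate vectors. The affine space with coordinates \<open>I\<close> is
  embedded in the projective space with coordinates \<^term>\<open>add_index I\<close> by \<open>x \<mapsto> [1 : x]\<close>; a form
  vanishes at a projective point iff it vanishes at one of its coordinate vectors.\<close>

definition projective_closure ::
  "'i set \<Rightarrow> ('i \<Rightarrow> complex) set \<Rightarrow> ('i option \<Rightarrow> complex) set" where
  "projective_closure I X =
     {y \<in> affine_space (add_index I). y \<noteq> (\<lambda>_. 0) \<and>
        (\<forall>m. \<forall>F\<in>forms (add_index I) m.
           (\<forall>x\<in>X. cpoly_eval (add_coord 1 x) F = 0) \<longrightarrow> cpoly_eval y F = 0)}"

definition vanishing_forms :: "'j set \<Rightarrow> ('j \<Rightarrow> complex) set \<Rightarrow> nat \<Rightarrow> 'j cpoly set" where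
  "vanishing_forms J Y m = {F \<in> forms J m. \<forall>y\<in>Y. cpoly_eval y F = 0}"

text \<open>For finite \<open>J\<close> this is the dimension of the degree \<open>m\<close> part of the homogeneous coordinate
  ring of \<open>Y\<close>.\<close>

definition hilbert_function :: "'j set \<Rightarrow> ('j \<Rightarrow> complex) set \<Rightarrow> nat \<Rightarrow> nat" where
  "hilbert_function J Y m = cpoly.dim (forms J m) - cpoly.dim (vanishing_forms J Y m)"

definition hilbert_polynomial :: "'j set \<Rightarrow> ('j \<Rightarrow> complex) set \<Rightarrow> rat poly" where
  "hilbert_polynomial J Y =
     (THE P. \<forall>\<^sub>F m in sequentially. poly P (of_nat m) = of_nat (hilbert_function J Y m))"

text \<open>The degree of a projective variety of dimension \<open>r\<close> is \<open>r!\<close> times the leading coefficient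
  of its Hilbert polynomial, which has degree \<open>r\<close>; this is a natural number.\<close>

definition projective_degree :: "'j set \<Rightarrow> ('j \<Rightarrow> complex) set \<Rightarrow> nat" where
  "projective_degree J Y =
     (THE e. of_nat e =
        fact (degree (hilbert_polynomial J Y)) * lead_coeff (hilbert_polynomial J Y))"

definition affine_degree :: "'i set \<Rightarrow> ('i \<Rightarrow> complex) set \<Rightarrow> nat" where
  "affine_degree I X = projective_degree (add_index I) (projective_closure I X)"

section \<open>Sums of squares and the orthogonal group\<close>

text \<open>\<open>Sym\<^sup>m V\<close> for \<open>V\<close> with basis \<open>x\<^sub>0, \<dots>, x\<^sub>n\<close>.\<close>

definition Sym :: "nat \<Rightarrow> nat \<Rightarrow> nat cpoly set" where
  "Sym n m = forms {..n} m"

text \<open>The coefficients are the affine coordinates on \<open>Sym\<^sup>m V\<close>.\<close>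

definition Sym_zariski :: "nat \<Rightarrow> nat \<Rightarrow> nat cpoly topology" where
  "Sym_zariski n m =
     pullback_topology (Sym n m) Poly_Mapping.lookup (zariski (monomials {..n} m))"

definition SOS :: "nat \<Rightarrow> nat \<Rightarrow> nat \<Rightarrow> nat cpoly set" where
  "SOS n d k =
     Abstract_Topology.closure_of (Sym_zariski n (2 * d))
       {\<Sum>i<k. f i ^ 2 | f. \<forall>i<k. f i \<in> Sym n d}"

definition SOS_topology :: "nat \<Rightarrow> nat \<Rightarrow> nat \<Rightarrow> nat cpoly topology" where
  "SOS_topology n d k = subtopology (Sym_zariski n (2 * d)) (SOS n d k)"

definition SOS_tuples :: "nat \<Rightarrow> nat \<Rightarrow> nat \<Rightarrow> nat cpoly \<Rightarrow> (nat \<Rightarrow> nat cpoly) set" where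
  "SOS_tuples n d k f = {F \<in> {..<k} \<rightarrow>\<^sub>E Sym n d. (\<Sum>i<k. F i ^ 2) = f}"

text \<open>A tuple is identified with the family of the coefficients of its members.\<close>

definition tuple_index :: "nat \<Rightarrow> nat \<Rightarrow> nat \<Rightarrow> (nat \<times> (nat \<Rightarrow>\<^sub>0 nat)) set" where
  "tuple_index n d k = {..<k} \<times> monomials {..n} d"

definition tuple_coords ::
  "nat \<Rightarrow> (nat \<Rightarrow> nat cpoly) \<Rightarrow> (nat \<times> (nat \<Rightarrow>\<^sub>0 nat) \<Rightarrow> complex)" where
  "tuple_coords k F = (\<lambda>(i, a). if i < k then Poly_Mapping.lookup (F i) a else 0)"

definition SOS_fiber ::
  "nat \<Rightarrow> nat \<Rightarrow> nat \<Rightarrow> nat cpoly \<Rightarrow> (nat \<times> (nat \<Rightarrow>\<^sub>0 nat) \<Rightarrow> complex) set" where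
  "SOS_fiber n d k f = tuple_coords k ` SOS_tuples n d k f"

definition orthogonal_matrices :: "nat \<Rightarrow> complex mat set" where
  "orthogonal_matrices k = {A \<in> carrier_mat k k. transpose_mat A * A = 1\<^sub>m k}"

definition matrix_index :: "nat \<Rightarrow> (nat \<times> nat) set" where
  "matrix_index k = {..<k} \<times> {..<k}"

definition matrix_coords :: "nat \<Rightarrow> complex mat \<Rightarrow> (nat \<times> nat \<Rightarrow> complex)" where
  "matrix_coords k A = (\<lambda>(i, j). if i < k \<and> j < k then A $$ (i, j) else 0)"

definition O_group :: "nat \<Rightarrow> (nat \<times> nat \<Rightarrow> complex) set" where
  "O_group k = matrix_coords k ` orthogonal_matrices k"

end

theory Submission
  imports Defs
    "HOL-Library.Function_Algebras"
    "HOL-Computational_Algebra.Fundamental_Theorem_Algebra"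
    "Jordan_Normal_Form.Determinant"
begin

text \<open>Both \<open>f\<^sub>1\<^sup>2 + \<dots> + f\<^sub>k\<^sup>2\<close> and the Gram tensor \<open>\<Sum> f\<^sub>i \<otimes> f\<^sub>i\<close> are \<open>O(k)\<close>-invariant, and two linearly
  independent tuples lie in one orbit iff their Gram tensors agree. Over a general \<open>f\<close> all tuples
  are independent and only finitely many Gram tensors occur, so the fibre is a finite union of
  orbits. Each orbit is the image of \<open>O(k)\<close> under an injective linear map, and the orbits are separated
  by polynomials in the Gram coordinates; this gives the isomorphism. Restricting polynomials to the
  orbits, where the separating polynomials cost only a bounded degree shift, compares the Hilbert
  functions and hence the degrees.

  Generality is obtained on a slice for the action, where the coefficients of
  \<open>x\<^sub>0\<^sup>d, \<dots>, x\<^sub>k\<^sub>-\<^sub>1\<^sup>d\<close> form an upper triangular matrix. At the point \<open>(x\<^sub>0\<^sup>d, \<dots>, x\<^sub>k\<^sub>-\<^sub>1\<^sup>d)\<close> the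
  squaring map is immersive on the slice, so as many coefficients of \<open>\<Sum> f\<^sub>i\<^sup>2\<close> as the slice has
  dimensions are algebraically independent, and by counting monomials every polynomial on the slice
  is algebraic over them. Applied to the Gram coordinates this bounds the number of their values over
  a general \<open>f\<close>; applied to the determinant of a \<open>k \<times> k\<close> block of the Gram matrix it gives independence;
  applied to the coordinates it shows that the general fibre is not empty.\<close>

section \<open>Polynomial functions\<close>

text \<open>Counting takes the place of dimension theory and of constructibility of images. The
  slice makes the counts match exactly: coefficients of the square sum are picked at the monomials
  \<open>xd i + a\<close> for \<open>(i, a)\<close> in the slice, these are pairwise distinct, and
  at the base point the chosen coefficients have derivative twice the identity. A relation found on
  the slice has coefficients that are functions of the square sum, so as a whole it is invariant and
  extends to all tuples. This matters because a tuple with isotropic columns need not be movable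
  into the slice: only polynomial identities are transported, never single points. Each required
  property of the fibre then fails at most on the zero set of one polynomial in the coefficients of
  \<open>f\<close>, and irreducibility of the space of tuples lets these polynomials be multiplied.
  Degrees are read off Hilbert polynomials, whose existence is proved by counting standard
  monomials; the maps between O(k) and an orbit are linear in both directions, so that degree bounds
  survive the change of coordinates.\<close>

inductive poly_fun_deg :: "'i set \<Rightarrow> nat \<Rightarrow> (('i \<Rightarrow> complex) \<Rightarrow> complex) \<Rightarrow> bool" for I where
  const: "poly_fun_deg I 0 (\<lambda>_. c)"
| var: "i \<in> I \<Longrightarrow> poly_fun_deg I 1 (\<lambda>x. x i)"
| add: "poly_fun_deg I m P \<Longrightarrow> poly_fun_deg I m Q \<Longrightarrow> poly_fun_deg I m (\<lambda>x. P x + Q x)"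
| mult: "poly_fun_deg I m P \<Longrightarrow> poly_fun_deg I n Q \<Longrightarrow> poly_fun_deg I (m + n) (\<lambda>x. P x * Q x)"
| raise: "poly_fun_deg I m P \<Longrightarrow> m \<le> n \<Longrightarrow> poly_fun_deg I n P"

text \<open>Working with functions instead of elements of \<open>cpoly\<close> makes composition and
  restriction immediate. \<open>poly_fun_deg\<close> is only an upper bound for the degree, by
  \<open>raise\<close>; the bound matters for counting and for Hilbert functions.\<close>

definition poly_fun :: "'i set \<Rightarrow> (('i \<Rightarrow> complex) \<Rightarrow> complex) \<Rightarrow> bool" where
  "poly_fun I P \<longleftrightarrow> (\<exists>m. poly_fun_deg I m P)"

lemma poly_fun_deg_const [simp]: "poly_fun_deg I m (\<lambda>_. c)"
  by (rule raise[OF const]) simp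

lemma poly_fun_deg_var: "i \<in> I \<Longrightarrow> 1 \<le> m \<Longrightarrow> poly_fun_deg I m (\<lambda>x. x i)"
  by (rule raise[OF var])

lemma poly_fun_deg_cmult: "poly_fun_deg I m P \<Longrightarrow> poly_fun_deg I m (\<lambda>x. c * P x)"
  using mult[OF const[of I c], of m P] by simp

lemma poly_fun_deg_sum:
  "(\<And>a. a \<in> A \<Longrightarrow> poly_fun_deg I m (P a)) \<Longrightarrow> poly_fun_deg I m (\<lambda>x. \<Sum>a\<in>A. P a x)"
  by (induction A rule: infinite_finite_induct) (simp_all add: add)

lemma poly_funI: "poly_fun_deg I m P \<Longrightarrow> poly_fun I P"
  unfolding poly_fun_def by (rule exI)

lemma poly_fun_const [simp]: "poly_fun I (\<lambda>_. c)"
  by (rule poly_funI[OF const])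

lemma poly_fun_var: "i \<in> I \<Longrightarrow> poly_fun I (\<lambda>x. x i)"
  by (rule poly_funI[OF var])

lemma poly_fun_add: "poly_fun I P \<Longrightarrow> poly_fun I Q \<Longrightarrow> poly_fun I (\<lambda>x. P x + Q x)"
proof -
  assume "poly_fun I P" "poly_fun I Q"
  then obtain m n where "poly_fun_deg I m P" "poly_fun_deg I n Q" unfolding poly_fun_def by blast
  then have "poly_fun_deg I (max m n) P" "poly_fun_deg I (max m n) Q"
    by (auto intro: raise)
  then show ?thesis by (rule poly_funI[OF add])
qed

lemma poly_fun_mult: "poly_fun I P \<Longrightarrow> poly_fun I Q \<Longrightarrow> poly_fun I (\<lambda>x. P x * Q x)"
  unfolding poly_fun_def[of I P] poly_fun_def[of I Q] by (elim exE) (rule poly_funI[OF mult])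

lemma poly_fun_induct [consumes 1, case_names const var add mult]:
  assumes "poly_fun I P"
    and "\<And>c. R (\<lambda>_. c)" and "\<And>i. i \<in> I \<Longrightarrow> R (\<lambda>x. x i)"
    and "\<And>P Q. poly_fun I P \<Longrightarrow> poly_fun I Q \<Longrightarrow> R P \<Longrightarrow> R Q \<Longrightarrow> R (\<lambda>x. P x + Q x)"
    and "\<And>P Q. poly_fun I P \<Longrightarrow> poly_fun I Q \<Longrightarrow> R P \<Longrightarrow> R Q \<Longrightarrow> R (\<lambda>x. P x * Q x)"
  shows "R P"
proof -
  obtain m where "poly_fun_deg I m P" using assms(1) unfolding poly_fun_def by blast
  then show ?thesis
  proof induction
    case (add m P Q)
    then show ?case by (intro assms(4)) (auto simp: poly_fun_def)
  next
    case (mult m P n Q)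
    then show ?case by (intro assms(5)) (auto simp: poly_fun_def)
  qed (use assms(2,3) in simp_all)
qed

lemma poly_fun_uminus: "poly_fun I P \<Longrightarrow> poly_fun I (\<lambda>x. - P x)"
  using poly_fun_mult[OF poly_fun_const[of I "-1"]] by simp

lemma poly_fun_diff: "poly_fun I P \<Longrightarrow> poly_fun I Q \<Longrightarrow> poly_fun I (\<lambda>x. P x - Q x)"
  using poly_fun_add[OF _ poly_fun_uminus] by simp

lemma poly_fun_sum:
  "(\<And>a. a \<in> A \<Longrightarrow> poly_fun I (P a)) \<Longrightarrow> poly_fun I (\<lambda>x. \<Sum>a\<in>A. P a x)"
  by (induction A rule: infinite_finite_induct) (simp_all add: poly_fun_add)

lemma poly_fun_prod:
  "(\<And>a. a \<in> A \<Longrightarrow> poly_fun I (P a)) \<Longrightarrow> poly_fun I (\<lambda>x. \<Prod>a\<in>A. P a x)"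
  by (induction A rule: infinite_finite_induct) (simp_all add: poly_fun_mult)

lemma poly_fun_power: "poly_fun I P \<Longrightarrow> poly_fun I (\<lambda>x. P x ^ n)"
  by (induction n) (simp_all add: poly_fun_mult)

lemmas poly_fun_intros = poly_fun_const poly_fun_var poly_fun_add poly_fun_mult poly_fun_uminus
  poly_fun_diff poly_fun_sum poly_fun_prod poly_fun_power

lemma poly_fun_compose:
  assumes "poly_fun I P" "\<And>i. i \<in> I \<Longrightarrow> poly_fun J (\<lambda>y. s y i)"
  shows "poly_fun J (\<lambda>y. P (s y))"
  using assms(1)
  by (induction rule: poly_fun_induct) (simp_all add: poly_fun_add poly_fun_mult assms(2))

lemma poly_fun_deg_compose_linear:
  assumes "poly_fun_deg I m P" "\<And>i. i \<in> I \<Longrightarrow> poly_fun_deg J 1 (\<lambda>y. s y i)"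
  shows "poly_fun_deg J m (\<lambda>y. P (s y))"
  using assms(1)
proof induction
  case (raise m P n)
  then show ?case by (blast intro: poly_fun_deg.raise)
qed (simp_all add: add mult assms(2)[unfolded One_nat_def])

lemma poly_fun_mono: "poly_fun I P \<Longrightarrow> I \<subseteq> J \<Longrightarrow> poly_fun J P"
  by (rule poly_fun_compose[of I P J "\<lambda>y. y"]) (simp_all add: poly_fun_var subsetD)

lemma poly_fun_cong:
  assumes "poly_fun I P" "\<And>i. i \<in> I \<Longrightarrow> x i = y i"
  shows "P x = P y"
  using assms(1) by (induction rule: poly_fun_induct) (auto simp: assms(2))

text \<open>The device that reduces questions in several, possibly infinitely many, variables to
  univariate polynomials, where finiteness of roots is available.\<close>

lemma poly_fun_curve:
  assumes "poly_fun I P" "\<And>i. i \<in> I \<Longrightarrow> \<exists>p. \<forall>t. s t i = poly p t"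
  shows "\<exists>q. \<forall>t. P (s t) = poly q t"
  using assms(1)
proof (induction rule: poly_fun_induct)
  case (const c)
  show ?case by (rule exI[of _ "[:c:]"]) simp
next
  case (var i)
  then show ?case using assms(2) by blast
next
  case (add P Q)
  then obtain p q where "\<forall>t. P (s t) = poly p t" "\<forall>t. Q (s t) = poly q t" by blast
  then show ?case by (intro exI[of _ "p + q"]) simp
next
  case (mult P Q)
  then obtain p q where "\<forall>t. P (s t) = poly p t" "\<forall>t. Q (s t) = poly q t" by blast
  then show ?case by (intro exI[of _ "p * q"]) simp
qed

text \<open>Irreducibility of affine space. On the line through \<open>x\<close> and
  \<open>y\<close> both functions become nonzero univariate polynomials, whose product has only
  finitely many roots.\<close>

lemma poly_fun_no_zero_divisors:
  assumes P: "poly_fun I P" and Q: "poly_fun I Q" and "P x \<noteq> 0" "Q y \<noteq> 0"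
  shows "\<exists>z. P z \<noteq> 0 \<and> Q z \<noteq> 0"
proof -
  define s where "s t i = x i + t * (y i - x i)" for t :: complex and i
  have s: "\<exists>p. \<forall>t. s t i = poly p t" for i
    by (rule exI[of _ "[:x i, y i - x i:]"]) (simp add: s_def)
  obtain p where p: "\<And>t. P (s t) = poly p t" using poly_fun_curve[of I P s, OF P s] by auto
  obtain q where q: "\<And>t. Q (s t) = poly q t" using poly_fun_curve[of I Q s, OF Q s] by auto
  have "s 0 = x" "s 1 = y" by (auto simp: s_def)
  then have "poly p 0 \<noteq> 0" "poly q 1 \<noteq> 0" using p q assms(3,4) by metis+
  then have "p * q \<noteq> 0" by auto
  then have "finite {t. poly (p * q) t = 0}" by (rule poly_roots_finite)
  then obtain t where "poly (p * q) t \<noteq> 0"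
    using infinite_UNIV_char_0[where 'a = complex] ex_new_if_finite by blast
  then have "P (s t) \<noteq> 0 \<and> Q (s t) \<noteq> 0" by (simp add: p q)
  then show ?thesis by (rule exI[of _ "s t"])
qed

lemma poly_fun_prod_nonzero:
  assumes "finite A" "\<And>a. a \<in> A \<Longrightarrow> poly_fun I (P a)" "\<And>a. a \<in> A \<Longrightarrow> \<exists>x. P a x \<noteq> 0"
  shows "\<exists>x. (\<Prod>a\<in>A. P a x) \<noteq> 0"
  using assms
proof (induction A)
  case (insert a A)
  then obtain x y where "P a x \<noteq> 0" "(\<Prod>a\<in>A. P a y) \<noteq> 0" by (metis insertCI)
  then show ?case
    using poly_fun_no_zero_divisors[of I "P a" "\<lambda>x. \<Prod>a\<in>A. P a x" x y] insert
    by (simp add: poly_fun_prod)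
qed simp

text \<open>The parts are functions with a scaling law instead of formal components. The clause for
  \<open>j\<close> beyond \<open>D\<close> allows two decompositions to be padded to a common
  range.\<close>

lemma poly_fun_homogeneous_parts:
  assumes "poly_fun I P"
  shows "\<exists>D H. (\<forall>j. poly_fun I (H j)) \<and> (\<forall>j t x. H j (\<lambda>i. t * x i) = t ^ j * H j x) \<and>
    (\<forall>j>D. \<forall>x. H j x = 0) \<and> (\<forall>x. P x = (\<Sum>j\<le>D. H j x))"
  using assms
proof (induction rule: poly_fun_induct)
  case (const c)
  show ?case by (intro exI[of _ "0::nat"] exI[of _ "\<lambda>j _. if j = 0 then c else 0"]) auto
next
  case (var i)
  then have "poly_fun I (\<lambda>x. if j = 1 then x i else 0)" for j :: nat
    by (cases "j = 1") (simp_all add: poly_fun_var)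
  then show ?case
    by (intro exI[of _ "1::nat"] exI[of _ "\<lambda>j x. if j = 1 then x i else 0"]) auto
next
  case (add P Q)
  obtain D H where H: "\<forall>j. poly_fun I (H j)" "\<forall>j t x. H j (\<lambda>i. t * x i) = t ^ j * H j x"
      "\<forall>j>D. \<forall>x. H j x = 0" "\<forall>x. P x = (\<Sum>j\<le>D. H j x)"
    using add.IH(1) by (elim exE conjE) (rule that)
  obtain E G where G: "\<forall>j. poly_fun I (G j)" "\<forall>j t x. G j (\<lambda>i. t * x i) = t ^ j * G j x"
      "\<forall>j>E. \<forall>x. G j x = 0" "\<forall>x. Q x = (\<Sum>j\<le>E. G j x)"
    using add.IH(2) by (elim exE conjE) (rule that)
  note H = H[rule_format] and G = G[rule_format]
  have "P x = (\<Sum>j\<le>max D E. H j x)" for x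
    unfolding H(4) by (rule sum.mono_neutral_left) (auto simp: H(3))
  moreover have "Q x = (\<Sum>j\<le>max D E. G j x)" for x
    unfolding G(4) by (rule sum.mono_neutral_left) (auto simp: G(3))
  ultimately show ?case
    by (intro exI[of _ "max D E"] exI[of _ "\<lambda>j x. H j x + G j x"])
      (simp add: H(2,3) G(2,3) distrib_left sum.distrib poly_fun_add H(1) G(1))
next
  case (mult P Q)
  obtain D H where H: "\<forall>j. poly_fun I (H j)" "\<forall>j t x. H j (\<lambda>i. t * x i) = t ^ j * H j x"
      "\<forall>j>D. \<forall>x. H j x = 0" "\<forall>x. P x = (\<Sum>j\<le>D. H j x)"
    using mult.IH(1) by (elim exE conjE) (rule that)
  obtain E G where G: "\<forall>j. poly_fun I (G j)" "\<forall>j t x. G j (\<lambda>i. t * x i) = t ^ j * G j x"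
      "\<forall>j>E. \<forall>x. G j x = 0" "\<forall>x. Q x = (\<Sum>j\<le>E. G j x)"
    using mult.IH(2) by (elim exE conjE) (rule that)
  note H = H[rule_format] and G = G[rule_format]
  define F where "F l x = (\<Sum>(i, j)\<in>{(i, j). i \<le> D \<and> j \<le> E \<and> i + j = l}. H i x * G j x)" for l x
  have "poly_fun I (F l)" for l
    unfolding F_def split_beta by (intro poly_fun_sum poly_fun_mult H(1) G(1))
  moreover have "F l (\<lambda>i. t * x i) = t ^ l * F l x" for l t x
    unfolding F_def sum_distrib_left
    by (rule sum.cong) (auto simp: H(2) G(2) power_add)
  moreover have "F l x = 0" if "l > D + E" for l x
    unfolding F_def by (rule sum.neutral) (use that in auto)
  moreover have "P x * Q x = (\<Sum>l\<le>D + E. F l x)" for x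
  proof -
    have "P x * Q x = (\<Sum>(i, j)\<in>{..D} \<times> {..E}. H i x * G j x)"
      unfolding H(4) G(4) sum_product sum.cartesian_product ..
    also have "\<dots> = (\<Sum>l\<le>D + E. \<Sum>p\<in>{p \<in> {..D} \<times> {..E}. fst p + snd p = l}.
        (\<lambda>(i, j). H i x * G j x) p)"
      by (rule sum.group[symmetric]) auto
    also have "\<dots> = (\<Sum>l\<le>D + E. F l x)"
      unfolding F_def by (intro sum.cong) auto
    finally show ?thesis .
  qed
  ultimately show ?case by (intro exI[of _ "D + E"] exI[of _ F]) simp
qed

text \<open>Collecting powers of \<open>x u\<close>. With \<open>u\<close> outside \<open>I\<close>
  this views a polynomial as univariate over the others, with a degree bound uniform in
  \<open>x\<close>, as pseudo-division requires.\<close>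

lemma poly_fun_insert_coeffs:
  assumes "poly_fun (insert u I) P"
  shows "\<exists>g D. (\<forall>j. poly_fun I (\<lambda>x. coeff (g x) j)) \<and> (\<forall>x. degree (g x) \<le> D) \<and>
    (\<forall>x. P x = poly (g x) (x u))"
  using assms
proof (induction rule: poly_fun_induct)
  case (const c)
  show ?case
    by (intro exI[of _ "\<lambda>_. [:c:]"] exI[of _ "0::nat"]) (auto simp: coeff_pCons split: nat.split)
next
  case (var i)
  show ?case
  proof (cases "i = u")
    case True
    then show ?thesis
      by (intro exI[of _ "\<lambda>_. [:0, 1:]"] exI[of _ "1::nat"]) (auto simp: coeff_pCons split: nat.split)
  next
    case False
    have "poly_fun I (\<lambda>x. coeff [:x i:] j)" for j
      using var False by (cases j) (simp_all add: poly_fun_var)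
    then show ?thesis
      by (intro exI[of _ "\<lambda>x. [:x i:]"] exI[of _ "0::nat"]) auto
  qed
next
  case (add P Q)
  obtain g D where g: "\<forall>j. poly_fun I (\<lambda>x. coeff (g x) j)" "\<forall>x. degree (g x) \<le> D"
    "\<forall>x. P x = poly (g x) (x u)" using add.IH(1) by (elim exE conjE) (rule that)
  obtain h E where h: "\<forall>j. poly_fun I (\<lambda>x. coeff (h x) j)" "\<forall>x. degree (h x) \<le> E"
    "\<forall>x. Q x = poly (h x) (x u)" using add.IH(2) by (elim exE conjE) (rule that)
  have "degree (g x + h x) \<le> max D E" for x
    using g(2) h(2) by (intro degree_add_le) (simp_all add: le_max_iff_disj)
  then show ?case
    using g h by (intro exI[of _ "\<lambda>x. g x + h x"] exI[of _ "max D E"]) (simp add: poly_fun_add)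
next
  case (mult P Q)
  obtain g D where g: "\<forall>j. poly_fun I (\<lambda>x. coeff (g x) j)" "\<forall>x. degree (g x) \<le> D"
    "\<forall>x. P x = poly (g x) (x u)" using mult.IH(1) by (elim exE conjE) (rule that)
  obtain h E where h: "\<forall>j. poly_fun I (\<lambda>x. coeff (h x) j)" "\<forall>x. degree (h x) \<le> E"
    "\<forall>x. Q x = poly (h x) (x u)" using mult.IH(2) by (elim exE conjE) (rule that)
  have "degree (g x * h x) \<le> D + E" for x
    using g(2) h(2) by (intro order.trans[OF degree_mult_le] add_mono) simp_all
  then show ?case
    using g h by (intro exI[of _ "\<lambda>x. g x * h x"] exI[of _ "D + E"])
      (simp add: coeff_mult poly_fun_sum poly_fun_mult)
qed

section \<open>Polynomial functions and formal polynomials\<close>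

lemma monomials_degree_zero: "monomials I 0 = {0}"
  by (auto simp: monomials_def in_keys_iff poly_mapping_eqI)

lemma poly_fun_eval:
  assumes "g \<in> cpolys I" shows "poly_fun I (\<lambda>x. cpoly_eval x g)"
  unfolding cpoly_eval_def mon_eval_def
  using assms by (intro poly_fun_intros) (auto simp: cpolys_def)

lemma poly_fun_iff_cpoly: "poly_fun I P \<longleftrightarrow> (\<exists>g\<in>cpolys I. \<forall>x. P x = cpoly_eval x g)"
proof
  assume "poly_fun I P"
  then show "\<exists>g\<in>cpolys I. \<forall>x. P x = cpoly_eval x g"
  proof (induction rule: poly_fun_induct)
    case (const c)
    show ?case
      by (rule bexI[of _ "Poly_Mapping.single 0 c"])
        (auto simp: cpoly_eval_single mon_eval_def cpolys_def)
  next
    case (var i)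
    then show ?case
      by (intro bexI[of _ "Poly_Mapping.single (Poly_Mapping.single i 1) 1"])
        (auto simp: cpoly_eval_single mon_eval_def cpolys_def)
  next
    case (add P Q)
    then obtain f g where *: "f \<in> cpolys I" "g \<in> cpolys I"
      "\<And>x. P x = cpoly_eval x f" "\<And>x. Q x = cpoly_eval x g" by blast
    then have "f + g \<in> cpolys I" using keys_add[of f g] unfolding cpolys_def by blast
    then show ?case using * by (intro bexI[of _ "f + g"]) (auto simp: cpoly_eval_add)
  next
    case (mult P Q)
    then obtain f g where "f \<in> cpolys I" "g \<in> cpolys I"
      "\<And>x. P x = cpoly_eval x f" "\<And>x. Q x = cpoly_eval x g" by blast
    then show ?case by (intro bexI[of _ "f * g"]) (auto simp: cpoly_eval_mult cpolys_mult)
  qed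
next
  assume "\<exists>g\<in>cpolys I. \<forall>x. P x = cpoly_eval x g"
  then obtain g where "g \<in> cpolys I" "P = (\<lambda>x. cpoly_eval x g)" by blast
  then show "poly_fun I P" using poly_fun_eval by blast
qed

section \<open>Counting monomials: algebraic dependence\<close>

global_interpretation cfun: vector_space "\<lambda>(c::complex) (f :: 'a \<Rightarrow> complex) x. c * f x"
  by standard (auto simp: fun_eq_iff algebra_simps)

text \<open>Stated for a family, not a set: two equal members already form a relation, with
  coefficients 1 and -1, and only an injective family calls for the dimension bound.\<close>

lemma (in vector_space) exists_relation:
  assumes "finite X" "finite S" "\<And>x. x \<in> X \<Longrightarrow> v x \<in> span S" "card S < card X"
  shows "\<exists>c. (\<exists>x\<in>X. c x \<noteq> 0) \<and> (\<Sum>x\<in>X. scale (c x) (v x)) = 0"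
proof (cases "inj_on v X")
  case True
  have "dependent (v ` X)"
  proof (rule ccontr)
    assume "\<not> dependent (v ` X)"
    then have "card (v ` X) \<le> card S"
      using independent_span_bound[OF assms(2), of "v ` X"] assms(3) by blast
    then show False using True assms(4) by (simp add: card_image)
  qed
  then obtain u where u: "\<exists>w\<in>v ` X. u w \<noteq> 0" "(\<Sum>w\<in>v ` X. scale (u w) w) = 0"
    using dependent_finite[of "v ` X"] assms(1) by blast
  show ?thesis
    by (rule exI[of _ "u \<circ> v"]) (use u True in \<open>auto simp: sum.reindex\<close>)
next
  case False
  then obtain x y where xy: "x \<in> X" "y \<in> X" "x \<noteq> y" "v x = v y" unfolding inj_on_def by blast
  define c where "c z = (if z = x then 1 else if z = y then - 1 else (0 :: 'a))" for z
  have "(\<Sum>z\<in>X. scale (c z) (v z)) = (\<Sum>z\<in>{x, y}. scale (c z) (v z))"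
    by (rule sum.mono_neutral_right) (use xy assms(1) in \<open>auto simp: c_def\<close>)
  also have "\<dots> = 0" using xy by (simp add: c_def)
  finally have "(\<Sum>z\<in>X. scale (c z) (v z)) = 0" .
  moreover have "c x \<noteq> 0" by (simp add: c_def)
  ultimately show ?thesis using xy(1) by blast
qed

lemma cfun_span_mult:
  assumes "P \<in> cfun.span A" "Q \<in> cfun.span B"
    and AB: "\<And>a b. a \<in> A \<Longrightarrow> b \<in> B \<Longrightarrow> (\<lambda>x. a x * b x) \<in> cfun.span C"
  shows "(\<lambda>x. P x * Q x) \<in> cfun.span C"
proof -
  have *: "(\<lambda>x. a x * Q x) \<in> cfun.span C" if "a \<in> A" for a
    using assms(2)
  proof (induction rule: cfun.span_induct_alt)
    case base
    show ?case using cfun.span_zero[of C] by (simp add: zero_fun_def)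
  next
    case (step c b R)
    have "(\<lambda>x. c * (a x * b x)) + (\<lambda>x. a x * R x) \<in> cfun.span C"
      by (intro cfun.span_add cfun.span_scale AB that step)
    then show ?case by (simp add: plus_fun_def algebra_simps)
  qed
  show ?thesis using assms(1)
  proof (induction rule: cfun.span_induct_alt)
    case base
    show ?case using cfun.span_zero[of C] by (simp add: zero_fun_def)
  next
    case (step c a R)
    have "(\<lambda>x. c * (a x * Q x)) + (\<lambda>x. R x * Q x) \<in> cfun.span C"
      by (intro cfun.span_add cfun.span_scale * step)
    then show ?case by (simp add: plus_fun_def algebra_simps)
  qed
qed

definition mono_fun :: "'i set \<Rightarrow> ('i \<Rightarrow> nat) \<Rightarrow> ('i \<Rightarrow> complex) \<Rightarrow> complex" where
  "mono_fun J \<alpha> x = (\<Prod>i\<in>J. x i ^ \<alpha> i)"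

lemma poly_fun_mono_fun: "poly_fun J (mono_fun J \<alpha>)"
  unfolding mono_fun_def by (intro poly_fun_prod poly_fun_power poly_fun_var)

text \<open>A box of exponents is larger than the set of monomials of degree at most
  \<open>m\<close>, but its size is the plain power \<open>(m + 1) ^ card J\<close>, and this crude
  bound is enough for the comparison of growth rates.\<close>

lemma poly_fun_deg_box:
  assumes "finite J" "poly_fun_deg J m P"
  shows "P \<in> cfun.span (mono_fun J ` (J \<rightarrow>\<^sub>E {..m}))"
  using assms(2)
proof induction
  case (const c)
  have "mono_fun J (\<lambda>i\<in>J. 0) = (\<lambda>_. 1)" by (simp add: mono_fun_def fun_eq_iff)
  then have "(\<lambda>_. 1) \<in> cfun.span (mono_fun J ` (J \<rightarrow>\<^sub>E {..0}))"
    by (intro cfun.span_base image_eqI[of _ _ "\<lambda>i\<in>J. 0"]) auto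
  from cfun.span_scale[OF this, of c] show ?case by (simp only: mult_1_right)
next
  case (var j)
  have "mono_fun J (\<lambda>i\<in>J. if i = j then 1 else 0) x = x j" for x
  proof -
    have "mono_fun J (\<lambda>i\<in>J. if i = j then 1 else 0) x = (\<Prod>i\<in>J. if i = j then x i else 1)"
      unfolding mono_fun_def by (rule prod.cong) auto
    then show ?thesis using var assms(1) by simp
  qed
  then have "(\<lambda>x. x j) = mono_fun J (\<lambda>i\<in>J. if i = j then 1 else 0)" by auto
  then show ?case by (intro cfun.span_base) (auto intro!: image_eqI)
next
  case (add m P Q)
  then show ?case using cfun.span_add by (force simp: plus_fun_def)
next
  case (mult m P n Q)
  show ?case
  proof (rule cfun_span_mult[OF mult.IH])
    fix a b assume "a \<in> mono_fun J ` (J \<rightarrow>\<^sub>E {..m})" "b \<in> mono_fun J ` (J \<rightarrow>\<^sub>E {..n})"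
    then obtain \<alpha> \<beta> where *: "a = mono_fun J \<alpha>" "b = mono_fun J \<beta>"
      "\<alpha> \<in> J \<rightarrow>\<^sub>E {..m}" "\<beta> \<in> J \<rightarrow>\<^sub>E {..n}" by auto
    have "(\<lambda>x. a x * b x) = mono_fun J (\<lambda>i\<in>J. \<alpha> i + \<beta> i)"
      unfolding * mono_fun_def by (auto simp: power_add prod.distrib fun_eq_iff)
    moreover have "(\<lambda>i\<in>J. \<alpha> i + \<beta> i) \<in> J \<rightarrow>\<^sub>E {..m + n}"
      using *(3,4) by (auto intro!: add_mono dest: PiE_mem)
    ultimately show "(\<lambda>x. a x * b x) \<in> cfun.span (mono_fun J ` (J \<rightarrow>\<^sub>E {..m + n}))"
      by (simp only: cfun.span_base imageI)
  qed
next
  case (raise m P n)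
  then have "J \<rightarrow>\<^sub>E {..m} \<subseteq> J \<rightarrow>\<^sub>E {..n}" by (intro PiE_mono) auto
  then show ?case using raise.IH cfun.span_mono[OF image_mono] by blast
qed

text \<open>With the other variables fixed, the sum is a polynomial in the variable \<open>j\<close>
  that vanishes everywhere, so its coefficients vanish; these are again such sums in fewer
  variables.\<close>

lemma mono_fun_independent:
  assumes "finite J" "\<And>x. (\<Sum>\<alpha>\<in>J \<rightarrow>\<^sub>E {..m}. c \<alpha> * mono_fun J \<alpha> x) = 0" "\<alpha> \<in> J \<rightarrow>\<^sub>E {..m}"
  shows "c \<alpha> = 0"
  using assms
proof (induction J arbitrary: c \<alpha>)
  case empty
  then show ?case by (simp add: mono_fun_def)
next
  case (insert j J)
  let ?B = "J \<rightarrow>\<^sub>E {..m}"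
  have mono: "mono_fun (insert j J) (\<beta>(j := e)) (x(j := t)) = t ^ e * mono_fun J \<beta> x" for \<beta> e x t
  proof -
    have "(\<Prod>i\<in>J. (x(j := t)) i ^ (\<beta>(j := e)) i) = (\<Prod>i\<in>J. x i ^ \<beta> i)"
      using insert.hyps by (intro prod.cong) auto
    then show ?thesis using insert.hyps by (simp add: mono_fun_def)
  qed
  have "(\<Sum>e\<le>m. (\<Sum>\<beta>\<in>?B. c (\<beta>(j := e)) * mono_fun J \<beta> x) * t ^ e) = 0" for x t
  proof -
    have "(\<Sum>e\<le>m. (\<Sum>\<beta>\<in>?B. c (\<beta>(j := e)) * mono_fun J \<beta> x) * t ^ e) =
        (\<Sum>(e, \<beta>)\<in>{..m} \<times> ?B. c (\<beta>(j := e)) * mono_fun (insert j J) (\<beta>(j := e)) (x(j := t)))"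
      by (simp add: sum_distrib_left sum_distrib_right sum.cartesian_product mono mult_ac)
    also have "\<dots> = (\<Sum>\<alpha>\<in>insert j J \<rightarrow>\<^sub>E {..m}. c \<alpha> * mono_fun (insert j J) \<alpha> (x(j := t)))"
      unfolding PiE_insert_eq
      by (subst sum.reindex[OF inj_combinator[OF insert.hyps(2)]]) (simp add: split_beta o_def)
    finally show ?thesis using insert.prems(1) by simp
  qed
  then have "(\<Sum>\<beta>\<in>?B. c (\<beta>(j := e)) * mono_fun J \<beta> x) = 0" if "e \<le> m" for e x
    using polyfun_eq_0[of "\<lambda>e. \<Sum>\<beta>\<in>?B. c (\<beta>(j := e)) * mono_fun J \<beta> x" m] that by blast
  then have *: "c (\<beta>(j := e)) = 0" if "e \<le> m" "\<beta> \<in> ?B" for e \<beta>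
    using insert.IH[of "\<lambda>\<beta>. c (\<beta>(j := e))"] that by blast
  obtain e \<beta> where "\<alpha> = \<beta>(j := e)" "e \<le> m" "\<beta> \<in> ?B"
    using insert.prems(2) unfolding PiE_insert_eq by auto
  then show ?case using *[of e \<beta>] by (simp only:)
qed

lemma poly_fun_deg_power: "poly_fun_deg I m P \<Longrightarrow> poly_fun_deg I (n * m) (\<lambda>x. P x ^ n)"
  by (induction n) (simp_all add: poly_fun_deg.mult)

lemma poly_fun_deg_prod:
  "finite A \<Longrightarrow> (\<And>a. a \<in> A \<Longrightarrow> poly_fun_deg I (m a) (P a)) \<Longrightarrow>
    poly_fun_deg I (\<Sum>a\<in>A. m a) (\<lambda>x. \<Prod>a\<in>A. P a x)"
  by (induction A rule: finite_induct) (simp_all add: poly_fun_deg.mult)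

text \<open>The products of powers of the \<open>h j\<close> and of \<open>c\<close> with exponents
  up to \<open>m\<close> number \<open>(m + 1) ^ (card J + 1)\<close>, while they lie in the span of
  \<open>(N + 1) ^ card J\<close> monomials with \<open>N\<close> linear in \<open>m\<close>; so a
  relation exists for large \<open>m\<close>. Independence of the \<open>h j\<close> keeps some
  coefficient from vanishing identically.\<close>

lemma algebraic_over_independent:
  fixes h :: "'i \<Rightarrow> ('i \<Rightarrow> complex) \<Rightarrow> complex"
  assumes J: "finite J" and h: "\<And>j. j \<in> J \<Longrightarrow> poly_fun J (h j)"
    and c: "poly_fun J c" "c x0 \<noteq> 0"
    and indep: "\<And>P. poly_fun J P \<Longrightarrow> \<forall>x. P (\<lambda>j. h j x) = 0 \<Longrightarrow> \<forall>x. P x = 0"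
  shows "\<exists>D b. (\<forall>l. poly_fun J (b l)) \<and> (\<forall>x. (\<Sum>l\<le>D. b l (\<lambda>j. h j x) * c x ^ l) = 0) \<and>
    (\<exists>x. b (0::nat) (\<lambda>j. h j x) \<noteq> 0)"
proof -
  have "\<forall>j\<in>J. \<exists>m. poly_fun_deg J m (h j)" using h unfolding poly_fun_def by blast
  then obtain dh where dh: "\<And>j. j \<in> J \<Longrightarrow> poly_fun_deg J (dh j) (h j)" by metis
  obtain dc where dc: "poly_fun_deg J dc c" using c unfolding poly_fun_def by blast
  define d where "d = Max (insert dc (dh ` J))"
  have hd: "poly_fun_deg J d (h j)" if "j \<in> J" for j
    by (rule poly_fun_deg.raise[OF dh[OF that]]) (use that J in \<open>simp add: d_def\<close>)
  have cd: "poly_fun_deg J d c"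
    by (rule poly_fun_deg.raise[OF dc]) (use J in \<open>simp add: d_def\<close>)
  define e where "e = card J"
  \<comment> \<open>\<open>q\<close> satisfies \<open>N + 1 \<le> q * (m + 1)\<close>, and
    \<open>m = q ^ e\<close> turns \<open>(q * (m + 1)) ^ e\<close> into
    \<open>m * (m + 1) ^ e\<close>, which is just below \<open>card X\<close>.\<close>
  define q where "q = d * (e + 1) + 1"
  define m where "m = q ^ e"
  define X where "X = (J \<rightarrow>\<^sub>E {..m}) \<times> {..m}"
  define v where "v = (\<lambda>(\<alpha>, l) x. (\<Prod>j\<in>J. h j x ^ \<alpha> j) * c x ^ l)"
  define N where "N = (e + 1) * m * d"
  define S where "S = mono_fun J ` (J \<rightarrow>\<^sub>E {..N})"
  have finX: "finite X" unfolding X_def using J by (simp add: finite_PiE)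
  have finS: "finite S" unfolding S_def using J by (simp add: finite_PiE)
  have "v p \<in> cfun.span S" if "p \<in> X" for p
  proof -
    obtain \<alpha> l where p: "p = (\<alpha>, l)" "\<alpha> \<in> J \<rightarrow>\<^sub>E {..m}" "l \<le> m" using \<open>p \<in> X\<close> X_def by auto
    have "poly_fun_deg J ((\<Sum>j\<in>J. \<alpha> j * d) + l * d) (v p)"
      unfolding v_def p(1) prod.case
      by (intro poly_fun_deg.mult poly_fun_deg_prod poly_fun_deg_power J hd cd)
    moreover have "(\<Sum>j\<in>J. \<alpha> j * d) \<le> (\<Sum>j\<in>J. m * d)"
      by (rule sum_mono) (use p in \<open>auto dest: PiE_mem\<close>)
    then have "(\<Sum>j\<in>J. \<alpha> j * d) + l * d \<le> e * (m * d) + m * d"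
      using mult_right_mono[OF p(3), of d] unfolding e_def sum_constant of_nat_id by linarith
    then have "(\<Sum>j\<in>J. \<alpha> j * d) + l * d \<le> N" by (simp add: N_def algebra_simps)
    ultimately have "poly_fun_deg J N (v p)" by (rule poly_fun_deg.raise)
    then show ?thesis unfolding S_def by (rule poly_fun_deg_box[OF J])
  qed
  moreover have "card S < card X"
  proof -
    have "card S \<le> card (J \<rightarrow>\<^sub>E {..N})"
      unfolding S_def by (rule card_image_le) (use J in \<open>simp add: finite_PiE\<close>)
    also have "\<dots> = (N + 1) ^ e" using J by (simp add: card_PiE e_def)
    also have "\<dots> \<le> (q * (m + 1)) ^ e"
      by (rule power_mono) (simp_all add: N_def q_def algebra_simps)
    also have "\<dots> = m * (m + 1) ^ e" by (simp only: power_mult_distrib m_def)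
    also have "\<dots> < (m + 1) * (m + 1) ^ e" by simp
    also have "\<dots> = card X" using J by (simp add: X_def card_cartesian_product card_PiE e_def)
    finally show ?thesis .
  qed
  ultimately obtain r where r: "\<exists>p\<in>X. r p \<noteq> 0" "(\<Sum>p\<in>X. (\<lambda>x. r p * v p x)) = 0"
    using cfun.exists_relation[OF finX finS, of v] by blast
  define b where "b l x = (\<Sum>\<alpha>\<in>J \<rightarrow>\<^sub>E {..m}. r (\<alpha>, l) * mono_fun J \<alpha> x)" for l x
  have pb: "poly_fun J (b l)" for l
    unfolding b_def by (intro poly_fun_sum poly_fun_mult poly_fun_const poly_fun_mono_fun)
  have rel: "(\<Sum>l\<le>m. b l (\<lambda>j. h j x) * c x ^ l) = 0" for x
  proof -
    have "(\<Sum>l\<le>m. b l (\<lambda>j. h j x) * c x ^ l) =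
        (\<Sum>l\<le>m. \<Sum>\<alpha>\<in>J \<rightarrow>\<^sub>E {..m}. r (\<alpha>, l) * v (\<alpha>, l) x)"
      by (simp add: b_def v_def mono_fun_def sum_distrib_right mult.assoc)
    also have "\<dots> = (\<Sum>p\<in>X. r p * v p x)"
      unfolding X_def by (subst sum.swap) (simp add: sum.cartesian_product split_beta)
    also have "\<dots> = (\<Sum>p\<in>X. (\<lambda>x. r p * v p x)) x" by (induction rule: finite_induct[OF finX]) auto
    finally show ?thesis using r(2) by simp
  qed
  define nz where "nz l \<longleftrightarrow> (\<exists>x. b l (\<lambda>j. h j x) \<noteq> 0)" for l
  have "\<exists>l\<le>m. nz l"
  proof (rule ccontr)
    assume "\<not> (\<exists>l\<le>m. nz l)"
    then have "\<forall>x. b l x = 0" if "l \<le> m" for l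
      using indep[OF pb] that unfolding nz_def by blast
    then have "r (\<alpha>, l) = 0" if "\<alpha> \<in> J \<rightarrow>\<^sub>E {..m}" "l \<le> m" for \<alpha> l
      using mono_fun_independent[OF J _ that(1), of "\<lambda>\<alpha>. r (\<alpha>, l)"] that(2) unfolding b_def by blast
    then show False using r(1) unfolding X_def by auto
  qed
  \<comment> \<open>The lowest coefficient that is not identically zero becomes the constant term:
    the factor \<open>c x ^ l\<close> comes out of the relation and is cancelled, since polynomial
    functions have no zero divisors.\<close>
  define l where "l = (LEAST l. nz l)"
  have l: "nz l" "l \<le> m" and least: "\<And>i. i < l \<Longrightarrow> \<not> nz i"
    unfolding l_def using \<open>\<exists>l\<le>m. nz l\<close> by (auto intro: LeastI Least_le order.trans dest: not_less_Least)
  define R where "R x = (\<Sum>i\<le>m - l. b (i + l) (\<lambda>j. h j x) * c x ^ i)" for x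
  have "c x ^ l * R x = 0" for x
  proof -
    have "(\<Sum>i\<le>m. b i (\<lambda>j. h j x) * c x ^ i) = (\<Sum>i\<in>{l..m}. b i (\<lambda>j. h j x) * c x ^ i)"
      by (rule sum.mono_neutral_right) (use least in \<open>auto simp: nz_def\<close>)
    also have "\<dots> = (\<Sum>i\<in>{0 + l..(m - l) + l}. b i (\<lambda>j. h j x) * c x ^ i)" using l by simp
    also have "\<dots> = (\<Sum>i\<le>m - l. b (i + l) (\<lambda>j. h j x) * c x ^ (i + l))"
      unfolding sum.shift_bounds_cl_nat_ivl atLeast0AtMost ..
    also have "\<dots> = c x ^ l * R x" by (simp add: R_def sum_distrib_left power_add mult_ac)
    finally show ?thesis using rel by simp
  qed
  moreover have "poly_fun J R"
    unfolding R_def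
    by (intro poly_fun_sum poly_fun_mult poly_fun_power c poly_fun_compose[OF pb] h)
  ultimately have "R x = 0" for x
    using poly_fun_no_zero_divisors[of J "\<lambda>x. c x ^ l" R x0 x] c
    by (metis mult_eq_0_iff poly_fun_power power_not_zero)
  then show ?thesis
    using l(1) pb unfolding nz_def R_def
    by (intro exI[of _ "m - l"] exI[of _ "\<lambda>i. b (i + l)"]) auto
qed

text \<open>Along \<open>t \<mapsto> t v\<close> the argument is \<open>t (s v + t q(v))\<close>, so the lowest homogeneous part of \<open>P\<close>
  vanishes at \<open>s v\<close>.\<close>

lemma quadratic_perturbation_independent:
  fixes q :: "'i \<Rightarrow> ('i \<Rightarrow> complex) \<Rightarrow> complex" and x :: "'i \<Rightarrow> complex"
  assumes P: "poly_fun J P" and s: "s \<noteq> (0::complex)"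
    and q: "\<And>i t v. q i (\<lambda>j. t * v j) = t\<^sup>2 * q i v"
    and zero: "\<And>v. P (\<lambda>i. s * v i + q i v) = 0"
  shows "P x = 0"
proof -
  obtain D H where H: "\<forall>j. poly_fun J (H j)" "\<forall>j t x. H j (\<lambda>i. t * x i) = t ^ j * H j x"
    "\<forall>j>D. \<forall>x. H j x = 0" "\<forall>x. P x = (\<Sum>j\<le>D. H j x)"
    using poly_fun_homogeneous_parts[OF P] by (elim exE conjE) (rule that; (assumption | erule exI))
  note H = H[rule_format]
  have "\<forall>x. H m x = 0" for m
  proof (induction m rule: less_induct)
    case (less m)
    show ?case
    proof (cases "m \<le> D")
      case True
      show ?thesis
      proof
        fix x :: "'i \<Rightarrow> complex"
        \<comment> \<open>\<open>v\<close> is chosen so that the curve \<open>w\<close> starts at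
          the given point \<open>x\<close>.\<close>
        define v where "v i = x i / s" for i
        define w where "w t i = s * v i + t * q i v" for t i
        have "\<exists>p. \<forall>t. w t i = poly p t" for i
          by (rule exI[of _ "[:s * v i, q i v:]"]) (simp add: w_def)
        then have "\<exists>p. \<forall>t. H j (w t) = poly p t" for j by (rule poly_fun_curve[OF H(1)])
        then obtain p where p: "\<And>j t. H j (w t) = poly (p j) t" by metis
        have "(\<Sum>j\<le>D. t ^ j * poly (p j) t) = 0" for t
        proof -
          have "(\<lambda>i. s * (t * v i) + q i (\<lambda>j. t * v j)) = (\<lambda>i. t * w t i)"
            by (simp add: w_def q fun_eq_iff algebra_simps power2_eq_square)
          then have "P (\<lambda>i. t * w t i) = 0" using zero[of "\<lambda>i. t * v i"] by simp
          then show ?thesis by (simp add: H(2,4) p)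
        qed
        moreover have "(\<Sum>j\<le>D. t ^ j * poly (p j) t) =
            (\<Sum>j\<in>{m..D}. t ^ j * poly (p j) t)" for t
          by (rule sum.mono_neutral_right) (use less True in \<open>auto simp flip: p\<close>)
        moreover have "t ^ j * poly (p j) t = t ^ m * (t ^ (j - m) * poly (p j) t)"
          if "j \<in> {m..D}" for j t
          using that by (simp flip: mult.assoc power_add)
        ultimately have "t ^ m * (\<Sum>j\<in>{m..D}. t ^ (j - m) * poly (p j) t) = 0" for t
          by (simp add: sum_distrib_left)
        \<comment> \<open>The power of \<open>t\<close> is cancelled between polynomials and not
          between values, which makes \<open>t = 0\<close> available.\<close>
        then have "poly (monom 1 m * (\<Sum>j\<in>{m..D}. monom 1 (j - m) * p j)) t = 0" for t
          by (simp add: poly_monom poly_sum)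
        then have "monom 1 m * (\<Sum>j\<in>{m..D}. monom 1 (j - m) * p j) = 0"
          using poly_all_0_iff_0 by blast
        then have "poly (\<Sum>j\<in>{m..D}. monom 1 (j - m) * p j) 0 = 0" by simp
        moreover have "poly (\<Sum>j\<in>{m..D}. monom 1 (j - m) * p j) 0 =
            (\<Sum>j\<in>{m..D}. if j = m then poly (p j) 0 else 0)"
          unfolding poly_sum by (rule sum.cong) (auto simp: poly_monom)
        ultimately have "poly (p m) 0 = 0" using True by simp
        then have "H m (w 0) = 0" using p by simp
        moreover have "w 0 = x" using s by (auto simp: w_def v_def)
        ultimately show "H m x = 0" by simp
      qed
    qed (use H(3) in simp)
  qed
  then show ?thesis by (simp add: H(4))
qed

section \<open>Extending points of the closure of an image\<close>

text \<open>A Chevalley-type theorem: for algebraic extensions, the lifting of points over a dense open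
  set goes one coordinate at a time, by solving the minimal polynomial of that coordinate.\<close>

locale algebraic_image =
  fixes J :: "'v set" and H :: "('v \<Rightarrow> complex) \<Rightarrow> 'a \<Rightarrow> complex" and I0 :: "'a set"
  assumes poly_H: "\<And>a. poly_fun J (\<lambda>x. H x a)"
    and algebraic: "\<And>c x0. poly_fun J c \<Longrightarrow> c x0 \<noteq> 0 \<Longrightarrow> \<exists>D b. (\<forall>l. poly_fun I0 (b l)) \<and>
      (\<forall>x. (\<Sum>l\<le>D. b l (H x) * c x ^ l) = 0) \<and> (\<exists>x. b (0::nat) (H x) \<noteq> 0)"
begin

text \<open>The Zariski closure of the projection of the image of \<open>H\<close> to the
  coordinates in \<open>I\<close>; the remaining coordinates of its points are unrestricted.\<close>

definition image_closure :: "'a set \<Rightarrow> ('a \<Rightarrow> complex) set" where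
  "image_closure I = {z. \<forall>P. poly_fun I P \<longrightarrow> (\<forall>x. P (H x) = 0) \<longrightarrow> P z = 0}"

lemma image_closureD:
  "z \<in> image_closure I \<Longrightarrow> poly_fun I P \<Longrightarrow> (\<And>x. P (H x) = 0) \<Longrightarrow> P z = 0"
  unfolding image_closure_def by auto

text \<open>Clears a denominator: \<open>a\<close> satisfies an algebraic equation over the
  coordinates in \<open>I0\<close> that persists on the closure, so \<open>a z = 0\<close> forces
  its constant term to vanish at \<open>z\<close>.\<close>

lemma image_closure_denominator:
  assumes "poly_fun I a" "I0 \<subseteq> I" "a (H x0) \<noteq> 0"
  shows "\<exists>b. poly_fun I0 b \<and> (\<exists>x. b (H x) \<noteq> 0) \<and> (\<forall>z\<in>image_closure I. b z \<noteq> 0 \<longrightarrow> a z \<noteq> 0)"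
proof -
  have "poly_fun J (\<lambda>x. a (H x))" by (rule poly_fun_compose[OF assms(1) poly_H])
  from algebraic[OF this assms(3)] obtain D b where b: "\<forall>l. poly_fun I0 (b l)"
    "\<forall>x. (\<Sum>l\<le>D. b l (H x) * a (H x) ^ l) = 0" "\<exists>x. b (0::nat) (H x) \<noteq> 0"
    by (elim exE conjE) (rule that; (assumption | erule exI))
  have "a z \<noteq> 0" if "z \<in> image_closure I" "b 0 z \<noteq> 0" for z
  proof
    assume "a z = 0"
    have "poly_fun I (b l)" for l by (rule poly_fun_mono[OF b(1)[rule_format] assms(2)])
    then have "poly_fun I (\<lambda>z. \<Sum>l\<le>D. b l z * a z ^ l)"
      by (intro poly_fun_sum poly_fun_mult poly_fun_power assms(1))
    from image_closureD[OF that(1) this] b(2) have "(\<Sum>l\<le>D. b l z * a z ^ l) = 0" by simp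
    moreover have "(\<Sum>l\<le>D. b l z * a z ^ l) = (\<Sum>l\<le>D. if l = 0 then b l z else 0)"
      by (rule sum.cong) (use \<open>a z = 0\<close> in \<open>auto simp: power_0_left\<close>)
    ultimately show False using that(2) by simp
  qed
  then show ?thesis using b(1,3) by blast
qed

text \<open>Polynomials over the coordinates \<open>I\<close> that have the coordinate
  \<open>u\<close> as a root at every point of the image. \<open>D\<close> is only a bound on the
  degree; the coefficient at \<open>D\<close> may vanish.\<close>

definition root_family :: "'a set \<Rightarrow> 'a \<Rightarrow> nat \<Rightarrow> (('a \<Rightarrow> complex) \<Rightarrow> complex poly) \<Rightarrow> bool" where
  "root_family I u D g \<longleftrightarrow> (\<forall>j. poly_fun I (\<lambda>z. coeff (g z) j)) \<and> (\<forall>z. degree (g z) \<le> D) \<and>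
     (\<forall>x. poly (g (H x)) (H x u) = 0)"

text \<open>Cutting off at the highest coefficient that is not identically zero on the image. The
  dropped coefficients may be nonzero elsewhere, hence the truncation by
  \<open>poly_cutoff\<close>.\<close>

lemma root_family_leading:
  assumes "root_family I u D g" "coeff (g (H x)) j \<noteq> 0"
  shows "\<exists>E\<le>D. \<exists>p. root_family I u E p \<and> (\<exists>x. coeff (p (H x)) E \<noteq> 0)"
proof -
  define nz where "nz j \<longleftrightarrow> (\<exists>x. coeff (g (H x)) j \<noteq> 0)" for j
  have nzD: "j \<le> D" if "nz j" for j
    using that assms(1) unfolding nz_def root_family_def by (meson le_degree order.trans)
  define E where "E = (GREATEST j. nz j)"
  have "nz j" using assms(2) nz_def by blast
  then have E: "nz E" unfolding E_def using nzD by (blast intro: GreatestI_nat)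
  have top: "\<not> nz j" if "j > E" for j
    using that Greatest_le_nat[of nz j D] nzD unfolding E_def by fastforce
  define p where "p z = poly_cutoff (Suc E) (g z)" for z
  have p: "coeff (p z) j = (if j \<le> E then coeff (g z) j else 0)" for z j
    by (simp add: p_def coeff_poly_cutoff)
  have "p (H x) = g (H x)" for x
    using top unfolding nz_def by (intro poly_eqI) (auto simp: p)
  moreover have "poly_fun I (\<lambda>z. coeff (p z) j)" for j
    using assms(1) by (cases "j \<le> E") (simp_all add: p root_family_def)
  moreover have "degree (p z) \<le> E" for z by (rule degree_le) (simp add: p)
  ultimately have "root_family I u E p" using assms(1) by (simp add: root_family_def)
  moreover have "\<exists>x. coeff (p (H x)) E \<noteq> 0" using E by (simp add: nz_def p)
  ultimately show ?thesis using nzD[OF E] by blast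
qed

lemma exists_root_family:
  assumes "I0 \<subseteq> I"
  shows "\<exists>D g. root_family I u D g \<and> (\<exists>x j. coeff (g (H x)) j \<noteq> 0)"
proof (cases "\<exists>x. H x u \<noteq> 0")
  case True
  then obtain x0 where "H x0 u \<noteq> 0" by blast
  from algebraic[OF poly_H this] obtain D b where b: "\<forall>l. poly_fun I0 (b l)"
    "\<forall>x. (\<Sum>l\<le>D. b l (H x) * H x u ^ l) = 0" "\<exists>x. b (0::nat) (H x) \<noteq> 0"
    by (elim exE conjE) (rule that; (assumption | erule exI))
  define g where "g z = (\<Sum>l\<le>D. monom (b l z) l)" for z
  have g: "coeff (g z) j = (if j \<le> D then b j z else 0)" for z j
    by (simp add: g_def coeff_sum)
  have "poly_fun I (\<lambda>z. coeff (g z) j)" for j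
    using poly_fun_mono[OF b(1)[rule_format] assms] by (cases "j \<le> D") (simp_all add: g)
  moreover have "degree (g z) \<le> D" for z by (rule degree_le) (simp add: g)
  moreover have "poly (g (H x)) (H x u) = 0" for x
    using b(2) by (simp add: g_def poly_sum poly_monom)
  moreover have "\<exists>x. coeff (g (H x)) 0 \<noteq> 0" using b(3) by (simp add: g)
  ultimately show ?thesis unfolding root_family_def by blast
next
  case False
  \<comment> \<open>A coordinate that vanishes on the whole image is outside the reach of
    \<open>algebraic\<close>; the indeterminate itself annihilates it.\<close>
  have "poly_fun I (\<lambda>z. coeff [:0, 1:] j)" for j by simp
  then have "root_family I u 1 (\<lambda>_. [:0, 1:])" using False by (simp add: root_family_def)
  moreover have "coeff [:0, 1::complex:] 1 \<noteq> 0" by simp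
  ultimately show ?thesis by blast
qed

text \<open>Pseudo-division by a family \<open>p\<close> of least degree. Each step multiplies by
  the leading coefficient of \<open>p\<close>, nonzero at \<open>z\<close>, so a root of the
  remainder at \<open>z\<close> is a root of the dividend; once the degree bound is below
  \<open>D\<close>, all coefficients vanish on the image by minimality and hence at
  \<open>z\<close>.\<close>

lemma minimal_root_family:
  assumes minimal: "\<And>E p x. root_family I u E p \<Longrightarrow> coeff (p (H x)) E \<noteq> 0 \<Longrightarrow> D \<le> E"
    and p: "root_family I u D p" and "1 \<le> D"
    and z: "z \<in> image_closure I" "coeff (p z) D \<noteq> 0" "poly (p z) t = 0"
    and g: "root_family I u E g"
  shows "poly (g z) t = 0"
  using g
proof (induction E arbitrary: g rule: less_induct)
  case (less E g)
  show ?case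
  proof (cases "E < D")
    case True
    have "coeff (g (H x)) j = 0" for x j
      using root_family_leading[OF less.prems, of x j] minimal True by fastforce
    then have "coeff (g z) j = 0" for j
      using image_closureD[OF z(1), of "\<lambda>z. coeff (g z) j"] less.prems
      by (simp add: root_family_def)
    then have "g z = 0" by (intro poly_eqI) simp
    then show ?thesis by simp
  next
    case False
    define g' where
      "g' z = Polynomial.smult (coeff (p z) D) (g z) - monom (coeff (g z) E) (E - D) * p z" for z
    have c: "coeff (g' z) j = coeff (p z) D * coeff (g z) j -
        (if j < E - D then 0 else coeff (g z) E * coeff (p z) (j - (E - D)))" for z j
      by (simp add: g'_def coeff_monom_mult)
    have "poly_fun I (\<lambda>z. coeff (g' z) j)" for j
    proof (cases "j < E - D")
      case True
      then show ?thesis using p less.prems unfolding c root_family_def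
        by (simp add: poly_fun_mult)
    next
      case False
      then show ?thesis using p less.prems unfolding c root_family_def
        by (simp add: poly_fun_mult poly_fun_diff)
    qed
    moreover have "degree (g' z) \<le> E - 1" for z
    proof (rule degree_le, intro allI impI)
      fix j assume "E - 1 < j"
      then consider "j = E" | "j > E" by linarith
      then show "coeff (g' z) j = 0"
      proof cases
        case 1
        then show ?thesis using False by (simp add: c)
      next
        case 2
        then have "coeff (g z) j = 0" "coeff (p z) (j - (E - D)) = 0"
          using p less.prems False unfolding root_family_def
          by (auto intro!: coeff_eq_0 intro: le_less_trans)
        then show ?thesis by (simp add: c)
      qed
    qed
    moreover have "poly (g' (H x)) (H x u) = 0" for x
      using p less.prems by (simp add: g'_def root_family_def)
    ultimately have "root_family I u (E - 1) g'" by (simp add: root_family_def)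
    moreover have "E - 1 < E" using False \<open>1 \<le> D\<close> by simp
    ultimately have "poly (g' z) t = 0" by (intro less.IH)
    then show ?thesis using z(2,3) by (simp add: g'_def)
  qed
qed

text \<open>A root of the minimal family at \<open>z\<close> is a legitimate value for the new
  coordinate: every polynomial vanishing on the image is, after collecting powers of that
  coordinate, a root family, so it vanishes at that root.\<close>

lemma extend_coordinate:
  assumes "I0 \<subseteq> I"
  shows "\<exists>b. poly_fun I0 b \<and> (\<exists>x. b (H x) \<noteq> 0) \<and>
    (\<forall>z\<in>image_closure I. b z \<noteq> 0 \<longrightarrow> (\<exists>z'\<in>image_closure (insert u I). \<forall>i\<in>I. z' i = z i))"
proof (cases "u \<in> I")
  case True
  then have "insert u I = I" by blast
  then show ?thesis by (intro exI[of _ "\<lambda>_. 1"]) auto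
next
  case False
  define good where "good D \<longleftrightarrow> (\<exists>p. root_family I u D p \<and> (\<exists>x. coeff (p (H x)) D \<noteq> 0))" for D
  have "\<exists>D. good D"
    using exists_root_family[OF assms, of u] root_family_leading unfolding good_def by blast
  define D where "D = (LEAST D. good D)"
  have "good D" unfolding D_def using \<open>\<exists>D. good D\<close> by (rule LeastI_ex)
  then obtain p x0 where p: "root_family I u D p" "coeff (p (H x0)) D \<noteq> 0"
    unfolding good_def by blast
  have minimal: "D \<le> E" if "root_family I u E g" "coeff (g (H x)) E \<noteq> 0" for E g x
    unfolding D_def by (rule Least_le) (use that good_def in blast)
  \<comment> \<open>A nonzero constant has no root, so the minimal family is not of degree
    0.\<close>
  have "1 \<le> D"
  proof (rule ccontr)
    assume "\<not> 1 \<le> D"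
    then have "D = 0" by simp
    moreover have "degree (p (H x0)) \<le> D" "poly (p (H x0)) (H x0 u) = 0"
      using p(1) by (auto simp: root_family_def)
    ultimately show False using p(2) by (auto elim!: degree_eq_zeroE)
  qed
  have "poly_fun I (\<lambda>z. coeff (p z) D)" using p(1) by (simp add: root_family_def)
  from image_closure_denominator[OF this assms p(2)] obtain b where
    b: "poly_fun I0 b" "\<exists>x. b (H x) \<noteq> 0"
      "\<forall>z\<in>image_closure I. b z \<noteq> 0 \<longrightarrow> coeff (p z) D \<noteq> 0" by (elim exE conjE) (rule that; (assumption | erule exI))
  have "\<exists>z'\<in>image_closure (insert u I). \<forall>i\<in>I. z' i = z i"
    if z: "z \<in> image_closure I" "b z \<noteq> 0" for z
  proof -
    have lead: "coeff (p z) D \<noteq> 0" using b(3) z by blast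
    then have "degree (p z) \<noteq> 0" using \<open>1 \<le> D\<close> le_degree[of "p z" D] by simp
    then obtain t where t: "poly (p z) t = 0"
      using alg_closed_imp_poly_has_root[of "p z"] by blast
    have "z(u := t) \<in> image_closure (insert u I)"
      unfolding image_closure_def
    proof (intro CollectI allI impI)
      fix P assume P: "poly_fun (insert u I) P" "\<forall>x. P (H x) = 0"
      obtain g E where g: "\<forall>j. poly_fun I (\<lambda>x. coeff (g x) j)" "\<forall>x. degree (g x) \<le> E"
        "\<forall>x. P x = poly (g x) (x u)"
        using poly_fun_insert_coeffs[OF P(1)] by (elim exE conjE) (rule that; (assumption | erule exI))
      then have "root_family I u E g" using P(2) by (simp add: root_family_def)
      then have "poly (g z) t = 0"
        by (rule minimal_root_family[where D = D and p = p and I = I and u = u, rotated -1])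
          (fact p(1) \<open>1 \<le> D\<close> z(1) lead t | rule minimal, assumption, assumption)+
      moreover have "coeff (g (z(u := t))) j = coeff (g z) j" for j
        by (rule poly_fun_cong[OF g(1)[rule_format]]) (use False in auto)
      then have "g (z(u := t)) = g z" by (rule poly_eqI)
      ultimately show "P (z(u := t)) = 0" using g(3) by simp
    qed
    moreover have "\<forall>i\<in>I. (z(u := t)) i = z i" using False by auto
    ultimately show ?thesis by blast
  qed
  then show ?thesis using b(1,2) by blast
qed

lemma extend_coordinates:
  assumes "finite W"
  shows "\<exists>b. poly_fun I0 b \<and> (\<exists>x. b (H x) \<noteq> 0) \<and>
    (\<forall>z\<in>image_closure I0. b z \<noteq> 0 \<longrightarrow> (\<exists>z'\<in>image_closure (W \<union> I0). \<forall>i\<in>I0. z' i = z i))"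
  using assms
proof (induction W)
  case empty
  show ?case by (rule exI[of _ "\<lambda>_. 1"]) auto
next
  case (insert u W)
  then obtain b where b: "poly_fun I0 b" "\<exists>x. b (H x) \<noteq> 0"
    "\<forall>z\<in>image_closure I0. b z \<noteq> 0 \<longrightarrow> (\<exists>z'\<in>image_closure (W \<union> I0). \<forall>i\<in>I0. z' i = z i)"
    by (elim exE conjE) (rule that; (assumption | erule exI))
  obtain a where a: "poly_fun I0 a" "\<exists>x. a (H x) \<noteq> 0"
    "\<forall>z\<in>image_closure (W \<union> I0). a z \<noteq> 0 \<longrightarrow>
      (\<exists>z'\<in>image_closure (insert u (W \<union> I0)). \<forall>i\<in>W \<union> I0. z' i = z i)"
    using extend_coordinate[of "W \<union> I0" u, OF Un_upper2]
    by (elim exE conjE) (rule that; (assumption | erule exI))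
  have "\<exists>z'\<in>image_closure (insert u W \<union> I0). \<forall>i\<in>I0. z' i = z i"
    if z: "z \<in> image_closure I0" "a z * b z \<noteq> 0" for z
  proof -
    obtain z1 where z1: "z1 \<in> image_closure (W \<union> I0)" "\<forall>i\<in>I0. z1 i = z i" using b(3) z by auto
    \<comment> \<open>Both conditions depend only on the coordinates in \<open>I0\<close>, which an
      extension does not change; this is why the bad set is described by one polynomial in those
      coordinates.\<close>
    have "a z1 = a z" by (rule poly_fun_cong[OF a(1)]) (use z1 in auto)
    then obtain z2 where "z2 \<in> image_closure (insert u (W \<union> I0))" "\<forall>i\<in>W \<union> I0. z2 i = z1 i"
      using a(3) z1 z(2) by auto
    then show ?thesis using z1 by (intro bexI[of _ z2]) auto
  qed
  moreover have "\<exists>x. a (H x) * b (H x) \<noteq> 0"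
  proof -
    obtain x y where "a (H x) \<noteq> 0" "b (H y) \<noteq> 0" using a b by blast
    then show ?thesis
      using poly_fun_no_zero_divisors[OF poly_fun_compose[OF a(1) poly_H]
          poly_fun_compose[OF b(1) poly_H]] by simp
  qed
  ultimately show ?case
    using poly_fun_mult[OF a(1) b(1)] by (intro exI[of _ "\<lambda>z. a z * b z"]) blast
qed

end

section \<open>Eventually polynomial sequences\<close>

definition eventually_poly :: "(nat \<Rightarrow> nat) \<Rightarrow> bool" where
  "eventually_poly f \<longleftrightarrow> (\<exists>P :: rat poly. \<forall>\<^sub>F m in sequentially. poly P (of_nat m) = of_nat (f m))"

definition poly_delta :: "rat poly \<Rightarrow> rat poly" where
  "poly_delta P = pcompose P [:1, 1:] - P"

lemma poly_delta_eval: "poly (poly_delta P) x = poly P (x + 1) - poly P x"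
  by (simp add: poly_delta_def poly_pcompose add.commute)

lemma coeff_pcompose_shift:
  fixes P :: "'a::{comm_ring_1,ring_char_0} poly"
  assumes "degree P \<le> N"
  shows "coeff (pcompose P [:1, 1:]) i = (\<Sum>k\<le>N. coeff P k * of_nat (k choose i))"
proof -
  have pow: "pcompose ([:0, 1:] ^ k) [:1, 1:] = ([:1, 1:] ^ k :: 'a poly)" for k
    by (induction k) (simp_all only: power_0 power_Suc pcompose_1 pcompose_mult, simp add: pcompose_pCons)
  have "P = (\<Sum>k\<le>N. monom (coeff P k) k)"
    by (rule poly_eqI) (use assms in \<open>auto simp: coeff_sum intro: coeff_eq_0\<close>)
  from arg_cong[OF this, of "\<lambda>p. pcompose p [:1, 1:]"]
  have "pcompose P [:1, 1:] = (\<Sum>k\<le>N. pcompose (monom (coeff P k) k) [:1, 1:])"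
    by (simp only: pcompose_sum)
  also have "\<dots> = (\<Sum>k\<le>N. Polynomial.smult (coeff P k) ([:1, 1:] ^ k))"
    by (intro sum.cong refl) (simp add: monom_altdef pcompose_smult pow)
  finally have "coeff (pcompose P [:1, 1:]) i = (\<Sum>k\<le>N. coeff P k * coeff ([:1, 1:] ^ k) i)"
    by (simp add: coeff_sum)
  moreover have "coeff ([:1, 1::'a:] ^ k) i = of_nat (k choose i)" for k
  proof (cases "i \<le> k")
    case True
    then show ?thesis by (simp add: coeff_linear_poly_power)
  next
    case False
    then have "degree ([:1, 1::'a:] ^ k) < i"
      using degree_power_le[of "[:1, 1::'a:]" k] by simp
    then show ?thesis using False by (simp add: coeff_eq_0 binomial_eq_0)
  qed
  ultimately show ?thesis by simp
qed

lemma poly_delta_degree: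
  assumes "degree P \<le> Suc N"
  shows "degree (poly_delta P) \<le> N" "coeff (poly_delta P) N = of_nat (Suc N) * coeff P (Suc N)"
proof -
  have c: "coeff (poly_delta P) i =
      (\<Sum>k\<le>Suc N. coeff P k * of_nat (k choose i)) - coeff P i" for i
    by (simp add: poly_delta_def coeff_pcompose_shift[OF assms])
  have z: "(\<Sum>k\<le>M. coeff P k * of_nat (k choose i)) = 0" if "i > M" for i M
    by (rule sum.neutral) (use that in \<open>auto simp: binomial_eq_0\<close>)
  show "degree (poly_delta P) \<le> N"
  proof (rule degree_le, intro allI impI)
    fix i assume "N < i"
    then consider "i = Suc N" | "i > Suc N" by linarith
    then show "coeff (poly_delta P) i = 0"
    proof cases
      case 1
      then show ?thesis using z[of N "Suc N"] by (simp add: c)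
    next
      case 2
      then show ?thesis using z[of "Suc N" i] assms by (simp add: c coeff_eq_0)
    qed
  qed
  have "(\<Sum>k\<le>N. coeff P k * of_nat (k choose N)) = (\<Sum>k\<le>N. if k = N then coeff P k else 0)"
    by (rule sum.cong) (auto simp: binomial_eq_0)
  then have "(\<Sum>k\<le>N. coeff P k * of_nat (k choose N)) = coeff P N" by simp
  then show "coeff (poly_delta P) N = of_nat (Suc N) * coeff P (Suc N)"
    by (simp add: c)
qed

lemma exists_antidifference: "\<exists>Q. poly_delta Q = P"
proof -
  have delta_add: "poly_delta (A + B) = poly_delta A + poly_delta B" for A B
    by (simp add: poly_delta_def pcompose_add)
  have "\<exists>Q. poly_delta Q = P" if "degree P \<le> n" for P n
    using that
  proof (induction n arbitrary: P)
    case 0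
    then obtain c where "P = [:c:]" by (auto elim: degree_eq_zeroE)
    then have "poly_delta [:0, c:] = P"
      by (simp add: poly_delta_def pcompose_pCons)
    then show ?case by blast
  next
    case (Suc n)
    \<comment> \<open>Differencing multiplies the leading coefficient by the exponent, here
      \<open>n + 2\<close>; dividing by it makes the difference of \<open>A\<close> cancel the top
      term of \<open>P\<close>.\<close>
    define A where "A = monom (coeff P (Suc n) / of_nat (Suc (Suc n))) (Suc (Suc n))"
    have "degree A \<le> Suc (Suc n)" by (simp add: A_def degree_monom_le)
    note A = poly_delta_degree[OF this]
    have "coeff (poly_delta A) (Suc n) = coeff P (Suc n)"
      unfolding A(2) by (simp add: A_def)
    then have top: "coeff (P - poly_delta A) (Suc n) = 0" by simp
    have "degree (P - poly_delta A) \<le> n"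
    proof (rule degree_le, intro allI impI)
      fix i assume "n < i"
      then consider "i = Suc n" | "i > Suc n" by linarith
      then show "coeff (P - poly_delta A) i = 0"
      proof cases
        case 2
        then show ?thesis using Suc.prems A(1) by (simp add: coeff_eq_0)
      qed (use top in simp)
    qed
    then obtain B where "poly_delta B = P - poly_delta A" using Suc.IH by blast
    then have "poly_delta (A + B) = P" by (simp add: delta_add)
    then show ?case by blast
  qed
  then show ?thesis by blast
qed

lemma eventually_poly_cong:
  assumes "eventually_poly f" "\<forall>\<^sub>F m in sequentially. f m = g m"
  shows "eventually_poly g"
proof -
  obtain P :: "rat poly" where "\<forall>\<^sub>F m in sequentially. poly P (of_nat m) = of_nat (f m)"
    using assms(1) unfolding eventually_poly_def by blast
  with assms(2) have "\<forall>\<^sub>F m in sequentially. poly P (of_nat m) = of_nat (g m)"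
    by eventually_elim simp
  then show ?thesis unfolding eventually_poly_def by blast
qed

lemma eventually_poly_const: "eventually_poly (\<lambda>_. c)"
  unfolding eventually_poly_def by (rule exI[of _ "[:of_nat c:]"]) simp

lemma eventually_poly_add:
  assumes "eventually_poly f" "eventually_poly g"
  shows "eventually_poly (\<lambda>m. f m + g m)"
proof -
  obtain P Q :: "rat poly" where "\<forall>\<^sub>F m in sequentially. poly P (of_nat m) = of_nat (f m)"
    "\<forall>\<^sub>F m in sequentially. poly Q (of_nat m) = of_nat (g m)"
    using assms unfolding eventually_poly_def by blast
  then have "\<forall>\<^sub>F m in sequentially. poly (P + Q) (of_nat m) = of_nat (f m + g m)"
    by eventually_elim simp
  then show ?thesis unfolding eventually_poly_def by blast
qed

lemma eventually_poly_sum: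
  "(\<And>a. a \<in> A \<Longrightarrow> eventually_poly (f a)) \<Longrightarrow> eventually_poly (\<lambda>m. \<Sum>a\<in>A. f a m)"
  by (induction A rule: infinite_finite_induct)
    (simp_all add: eventually_poly_const eventually_poly_add)

lemma eventually_poly_shift:
  assumes "eventually_poly f"
  shows "eventually_poly (\<lambda>m. f (m - t))"
proof -
  obtain P :: "rat poly" where "\<forall>\<^sub>F m in sequentially. poly P (of_nat m) = of_nat (f m)"
    using assms unfolding eventually_poly_def by blast
  then obtain N where N: "poly P (of_nat m) = of_nat (f m)" if "N \<le> m" for m
    unfolding eventually_sequentially by blast
  have "poly (pcompose P [:- of_nat t, 1:]) (of_nat m) = of_nat (f (m - t))" if "N + t \<le> m" for m
    using N[of "m - t"] that by (simp add: poly_pcompose of_nat_diff)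
  then show ?thesis unfolding eventually_poly_def eventually_sequentially by blast
qed

text \<open>An antidifference describes the sums up to a constant, which absorbs the initial terms
  where \<open>f\<close> is not yet polynomial.\<close>

lemma eventually_poly_cumulative:
  assumes "eventually_poly f"
  shows "eventually_poly (\<lambda>m. \<Sum>s\<le>m. f s)"
proof -
  obtain P :: "rat poly" where "\<forall>\<^sub>F m in sequentially. poly P (of_nat m) = of_nat (f m)"
    using assms unfolding eventually_poly_def by blast
  then obtain N where N: "poly P (of_nat m) = of_nat (f m)" if "N \<le> m" for m
    unfolding eventually_sequentially by blast
  obtain Q where "poly_delta Q = P" using exists_antidifference by blast
  then have Q: "poly Q (of_nat m + 1) = poly Q (of_nat m) + of_nat (f m)" if "N \<le> m" for m
    using poly_delta_eval[of Q "of_nat m"] N[OF that] by simp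
  define R where "R = Q \<circ>\<^sub>p [:1, 1:] + [:of_nat (\<Sum>s\<le>N. f s) - poly Q (of_nat N + 1):]"
  have "poly R (of_nat m) = of_nat (\<Sum>s\<le>m. f s)" if "N \<le> m" for m
    using that
  proof (induction m rule: dec_induct)
    case base
    show ?case by (simp add: R_def poly_pcompose add.commute)
  next
    case (step m)
    then show ?case using Q[of "Suc m"] by (simp add: R_def poly_pcompose algebra_simps)
  qed
  then show ?thesis unfolding eventually_poly_def eventually_sequentially by blast
qed

section \<open>Counting points of a staircase\<close>

text \<open>A decreasing sequence of naturals is constant from its minimum on, so the monotone
  subsequence can always be taken weakly increasing.\<close>

lemma nat_seq_mono_subseq: "\<exists>r::nat \<Rightarrow> nat. strict_mono r \<and> mono (\<lambda>n. s (r n) :: nat)"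
proof -
  obtain f where f: "strict_mono f" "monoseq (\<lambda>n. s (f n))" using seq_monosub by blast
  from f(2) consider "\<forall>m. \<forall>n\<ge>m. s (f m) \<le> s (f n)" | "\<forall>m. \<forall>n\<ge>m. s (f n) \<le> s (f m)"
    unfolding monoseq_def by blast
  then show ?thesis
  proof cases
    case 1
    then show ?thesis using f(1) by (intro exI[of _ f]) (auto simp: mono_def)
  next
    case 2
    define v where "v = (LEAST v. \<exists>n. v = s (f n))"
    have "\<exists>n. v = s (f n)" unfolding v_def by (rule LeastI_ex) blast
    then obtain N where N: "v = s (f N)" by blast
    have "v \<le> s (f n)" for n unfolding v_def by (rule Least_le) blast
    then have "s (f (n + N)) = v" for n using 2 N by (metis le_add2 le_antisym)
    moreover have "strict_mono (\<lambda>n. f (n + N))" using f(1) by (simp add: strict_mono_def)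
    ultimately show ?thesis by (intro exI[of _ "\<lambda>n. f (n + N)"]) (simp add: mono_def)
  qed
qed

text \<open>Dickson's lemma in the form of sequences: coordinates are made monotone one after
  another by passing to subsequences.\<close>

lemma dickson_subseq:
  assumes "finite J"
  shows "\<exists>r::nat \<Rightarrow> nat. strict_mono r \<and> (\<forall>j\<in>J. mono (\<lambda>n. a (r n) j :: nat))"
  using assms
proof (induction J)
  case empty
  show ?case by (rule exI[of _ "\<lambda>n. n"]) (simp add: strict_mono_def)
next
  case (insert j J)
  then obtain r :: "nat \<Rightarrow> nat" where r: "strict_mono r" "\<forall>j\<in>J. mono (\<lambda>n. a (r n) j)" by blast
  obtain f :: "nat \<Rightarrow> nat" where f: "strict_mono f" "mono (\<lambda>n. a (r (f n)) j)"
    using nat_seq_mono_subseq[of "\<lambda>n. a (r n) j"] by blast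
  have "strict_mono (\<lambda>n. r (f n))" using r(1) f(1) by (simp add: strict_mono_def)
  moreover have "mono (\<lambda>n. a (r (f n)) i)" if "i \<in> J" for i
    using r(2) that strict_mono_mono[OF f(1)] by (simp add: mono_def)
  ultimately show ?case using f(2) by (intro exI[of _ "\<lambda>n. r (f n)"]) auto
qed

text \<open>The exponent vectors outside a monomial ideal in the variables \<open>J\<close>,
  extended by 0.\<close>

definition staircase :: "'i set \<Rightarrow> ('i \<Rightarrow> nat) set \<Rightarrow> bool" where
  "staircase J S \<longleftrightarrow> (\<forall>\<alpha>\<in>S. (\<forall>i. i \<notin> J \<longrightarrow> \<alpha> i = 0) \<and> (\<forall>\<beta>. (\<forall>i. \<beta> i \<le> \<alpha> i) \<longrightarrow> \<beta> \<in> S))"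

text \<open>The ascending chain condition for monomial ideals. An infinite strict descent would
  yield points, each removed before the next is chosen; Dickson's lemma gives two of them with the
  earlier below the later, which contradicts downward closure.\<close>

lemma staircase_chain_stabilises:
  fixes S :: "nat \<Rightarrow> ('i \<Rightarrow> nat) set"
  assumes J: "finite J" and S: "\<And>t. staircase J (S t)" and dec: "\<And>t. S (Suc t) \<subseteq> S t"
  shows "\<exists>T. \<forall>t\<ge>T. S t = S T"
proof (rule ccontr)
  assume "\<not> ?thesis"
  then have ne: "\<exists>t\<ge>T. S t \<noteq> S T" for T by blast
  have anti: "S t \<subseteq> S u" if "u \<le> t" for t u
    using that by (induction rule: dec_induct) (use dec in auto)
  have "\<exists>t. \<exists>\<alpha>. T < t \<and> \<alpha> \<in> S T - S t" for T
  proof -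
    obtain t where "T \<le> t" "S t \<noteq> S T" using ne by blast
    moreover from this have "t \<noteq> T" by blast
    ultimately show ?thesis using anti[of T t] by (intro exI[of _ t]) auto
  qed
  then obtain g b where g: "\<And>T. T < g T" "\<And>T. b T \<in> S T - S (g T)" by metis
  define T where "T n = (g ^^ n) 0" for n
  have T: "T (Suc n) = g (T n)" for n by (simp add: T_def)
  have "T n \<le> T (Suc n)" for n unfolding T using g(1)[of "T n"] by (rule less_imp_le)
  then have "mono T" by (rule monoI[OF lift_Suc_mono_le])
  obtain r :: "nat \<Rightarrow> nat" where r: "strict_mono r" "\<forall>j\<in>J. mono (\<lambda>n. b (T (r n)) j)"
    using dickson_subseq[OF J, of "\<lambda>n. b (T n)"] by blast
  have "r 0 < r 1" using r(1) by (simp add: strict_mono_def)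
  then have "T (Suc (r 0)) \<le> T (r 1)" using \<open>mono T\<close> by (simp add: mono_def)
  then have "b (T (r 1)) \<in> S (g (T (r 0)))" using g(2) anti T by (metis DiffD1 subsetD)
  moreover have "b (T (r 0)) i \<le> b (T (r 1)) i" for i
  proof (cases "i \<in> J")
    case True
    then show ?thesis using r(2) by (simp add: mono_def)
  next
    case False
    then have "b (T (r 0)) i = 0" using S[of "T (r 0)"] g(2)[of "T (r 0)"] unfolding staircase_def by blast
    then show ?thesis by simp
  qed
  ultimately have "b (T (r 0)) \<in> S (g (T (r 0)))" using S unfolding staircase_def by blast
  then show False using g(2) by blast
qed

lemma finite_bounded_sum_funs:
  assumes "finite J"
  shows "finite {\<alpha> :: 'i \<Rightarrow> nat. (\<forall>i. i \<notin> J \<longrightarrow> \<alpha> i = 0) \<and> sum \<alpha> J = m}"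
proof (rule finite_subset)
  show "{\<alpha> :: 'i \<Rightarrow> nat. (\<forall>i. i \<notin> J \<longrightarrow> \<alpha> i = 0) \<and> sum \<alpha> J = m} \<subseteq>
      {\<alpha>. \<forall>i. (i \<in> J \<longrightarrow> \<alpha> i \<in> {..m}) \<and> (i \<notin> J \<longrightarrow> \<alpha> i = 0)}"
    using assms member_le_sum[of _ J] by auto
qed (use assms in \<open>intro finite_set_of_finite_funs, auto\<close>)

text \<open>Sorting by the exponent of \<open>j\<close>. The condition \<open>\<beta> j = 0\<close>
  normalises the slice points, so that the slices are again staircases in \<open>J\<close>.\<close>

lemma staircase_count_insert:
  fixes S :: "('i \<Rightarrow> nat) set"
  assumes J: "finite J" "j \<notin> J" and S: "staircase (insert j J) S"
  shows "card {\<alpha> \<in> S. sum \<alpha> (insert j J) = m} =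
    (\<Sum>t\<le>m. card {\<beta> \<in> {\<beta>. \<beta> j = 0 \<and> \<beta>(j := t) \<in> S}. sum \<beta> J = m - t})"
proof -
  let ?S = "\<lambda>t. {\<beta>. \<beta> j = 0 \<and> \<beta>(j := t) \<in> S}"
  let ?A = "\<lambda>t. (\<lambda>\<beta>. \<beta>(j := t)) ` {\<beta> \<in> ?S t. sum \<beta> J = m - t}"
  have upd: "sum (\<beta>(j := t)) J = sum \<beta> J" for \<beta> :: "'i \<Rightarrow> nat" and t
    by (rule sum.cong) (use J in auto)
  have "{\<alpha> \<in> S. sum \<alpha> (insert j J) = m} = (\<Union>t\<le>m. ?A t)"
  proof (intro equalityI subsetI)
    fix \<alpha> assume "\<alpha> \<in> {\<alpha> \<in> S. sum \<alpha> (insert j J) = m}"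
    then have \<alpha>: "\<alpha> \<in> S" "\<alpha> j + sum \<alpha> J = m" using J by auto
    then have "\<alpha>(j := 0) \<in> {\<beta> \<in> ?S (\<alpha> j). sum \<beta> J = m - \<alpha> j}"
      using upd[of \<alpha> 0] by (simp del: fun_upd_apply add: fun_upd_same)
    then have "\<alpha> \<in> ?A (\<alpha> j)" by (rule rev_image_eqI) simp
    then show "\<alpha> \<in> (\<Union>t\<le>m. ?A t)" using \<alpha>(2) by auto
  next
    fix \<alpha> assume "\<alpha> \<in> (\<Union>t\<le>m. ?A t)"
    then obtain t \<beta> where "t \<le> m" "\<beta>(j := t) \<in> S" "sum \<beta> J = m - t" "\<alpha> = \<beta>(j := t)" by blast
    then show "\<alpha> \<in> {\<alpha> \<in> S. sum \<alpha> (insert j J) = m}"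
      using J upd[of \<beta> t] by (simp del: fun_upd_apply add: fun_upd_same)
  qed
  moreover have fin: "finite {\<beta> \<in> ?S t. sum \<beta> J = m - t}" for t
  proof (rule finite_subset[OF _ finite_bounded_sum_funs[OF J(1), of "m - t"]])
    have "\<beta> i = 0" if "\<beta> \<in> ?S t" "i \<notin> J" for \<beta> i
    proof (cases "i = j")
      case False
      moreover have "(\<beta>(j := t)) i = 0" using that False S unfolding staircase_def by blast
      ultimately show ?thesis by simp
    qed (use that in auto)
    then show "{\<beta> \<in> ?S t. sum \<beta> J = m - t} \<subseteq> {\<alpha>. (\<forall>i. i \<notin> J \<longrightarrow> \<alpha> i = 0) \<and> sum \<alpha> J = m - t}"
      by auto
  qed
  moreover have "?A t \<inter> ?A u = {}" if "t \<noteq> u" for t u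
  proof -
    have j: "\<alpha> j = s" if "\<alpha> \<in> ?A s" for \<alpha> s using that by auto
    show ?thesis
    proof (rule equals0I)
      fix \<alpha> assume *: "\<alpha> \<in> ?A t \<inter> ?A u"
      note \<alpha> = IntD1[OF *] IntD2[OF *]
      have "\<alpha> j = t" "\<alpha> j = u" by (rule j[OF \<alpha>(1)], rule j[OF \<alpha>(2)])
      then have "t = u" by simp
      then show False using that by simp
    qed
  qed
  ultimately have "card {\<alpha> \<in> S. sum \<alpha> (insert j J) = m} = (\<Sum>t\<le>m. card (?A t))"
    by (simp only:) (rule card_UN_disjoint, auto)
  also have "\<dots> = (\<Sum>t\<le>m. card {\<beta> \<in> ?S t. sum \<beta> J = m - t})"
  proof (intro sum.cong refl card_image inj_onI)
    fix t \<beta> \<gamma>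
    assume mem: "\<beta> \<in> {\<beta> \<in> ?S t. sum \<beta> J = m - t}" "\<gamma> \<in> {\<beta> \<in> ?S t. sum \<beta> J = m - t}"
      and eq: "\<beta>(j := t) = \<gamma>(j := t)"
    have "\<beta> j = 0" "\<gamma> j = 0" using mem by simp_all
    then have "(\<beta>(j := t))(j := 0) = \<beta>" "(\<gamma>(j := t))(j := 0) = \<gamma>"
      by (simp_all only: fun_upd_upd fun_upd_idem)
    then show "\<beta> = \<gamma>" unfolding eq by (rule trans[OF sym])
  qed
  finally show ?thesis .
qed

text \<open>Slices with growing exponent of the new variable decrease and stabilise at some
  \<open>T\<close>. Finitely many early slices contribute shifted counts, and the constant tail
  contributes a cumulative sum.\<close>

lemma staircase_count:
  assumes "finite J" "staircase J S"
  shows "eventually_poly (\<lambda>m. card {\<alpha> \<in> S. sum \<alpha> J = m})"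
  using assms
proof (induction J arbitrary: S)
  case empty
  have "\<forall>\<^sub>F m in sequentially. 0 = card {\<alpha> \<in> S. sum \<alpha> {} = m}"
    using eventually_gt_at_top[of 0] by eventually_elim simp
  then show ?case by (rule eventually_poly_cong[OF eventually_poly_const])
next
  case (insert j J)
  define S' where "S' t = {\<beta>. \<beta> j = 0 \<and> \<beta>(j := t) \<in> S}" for t
  have st: "staircase J (S' t)" for t
    unfolding staircase_def
  proof (intro ballI conjI allI impI)
    fix \<beta> i assume "\<beta> \<in> S' t" "i \<notin> J"
    then have "(\<beta>(j := t)) i = 0" if "i \<noteq> j"
      using insert.prems that unfolding staircase_def S'_def by blast
    then show "\<beta> i = 0" using \<open>\<beta> \<in> S' t\<close> by (cases "i = j") (auto simp: S'_def)
  next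
    fix \<beta> \<gamma> assume *: "\<beta> \<in> S' t" "\<forall>i. \<gamma> i \<le> \<beta> i"
    then have "\<forall>i. (\<gamma>(j := t)) i \<le> (\<beta>(j := t)) i" by simp
    then have "\<gamma>(j := t) \<in> S" using * insert.prems unfolding staircase_def S'_def by blast
    moreover have "\<gamma> j = 0" using * by (metis (mono_tags, lifting) S'_def le_zero_eq mem_Collect_eq)
    ultimately show "\<gamma> \<in> S' t" by (simp add: S'_def)
  qed
  have "S' (Suc t) \<subseteq> S' t" for t
  proof
    fix \<beta> assume "\<beta> \<in> S' (Suc t)"
    moreover have "\<forall>i. (\<beta>(j := t)) i \<le> (\<beta>(j := Suc t)) i" by simp
    ultimately show "\<beta> \<in> S' t" using insert.prems unfolding staircase_def S'_def by blast
  qed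
  then obtain T where T: "\<And>t. t \<ge> T \<Longrightarrow> S' t = S' T"
    using staircase_chain_stabilises[of J S'] st insert.hyps by blast
  define c where "c t m = card {\<beta> \<in> S' t. sum \<beta> J = m}" for t m
  have ev: "eventually_poly (c t)" for t unfolding c_def by (rule insert.IH[OF st])
  have "(\<Sum>t<T. c t (m - t)) + (\<Sum>s\<le>m - T. c T s) = card {\<alpha> \<in> S. sum \<alpha> (insert j J) = m}"
    if "T \<le> m" for m
  proof -
    have "card {\<alpha> \<in> S. sum \<alpha> (insert j J) = m} = (\<Sum>t\<le>m. c t (m - t))"
      unfolding staircase_count_insert[OF insert.hyps insert.prems] c_def S'_def ..
    also have "\<dots> = (\<Sum>t<T. c t (m - t)) + (\<Sum>t\<in>{T..m}. c t (m - t))"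
      using that by (subst sum.union_disjoint[symmetric]) (auto intro!: sum.cong)
    also have "(\<Sum>t\<in>{T..m}. c t (m - t)) = (\<Sum>t\<in>{T..m}. c T (m - t))"
    proof (rule sum.cong[OF refl])
      fix t assume "t \<in> {T..m}"
      then have "S' t = S' T" by (intro T) simp
      then show "c t (m - t) = c T (m - t)" by (simp only: c_def)
    qed
    also have "\<dots> = (\<Sum>s\<le>m - T. c T s)"
      by (rule sum.reindex_bij_witness[of _ "\<lambda>s. m - s" "\<lambda>t. m - t"]) (use that in auto)
    finally show ?thesis by simp
  qed
  then have "\<forall>\<^sub>F m in sequentially. (\<Sum>t<T. c t (m - t)) + (\<Sum>s\<le>m - T. c T s) =
      card {\<alpha> \<in> S. sum \<alpha> (insert j J) = m}"
    unfolding eventually_sequentially by blast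
  moreover have "eventually_poly (\<lambda>m. (\<Sum>t<T. c t (m - t)) + (\<Sum>s\<le>m - T. c T s))"
    by (intro eventually_poly_add eventually_poly_sum
        eventually_poly_shift[of "\<lambda>m. \<Sum>s\<le>m. c T s"] eventually_poly_cumulative
        eventually_poly_shift[of "c _"] ev)
  ultimately show ?case by (rule eventually_poly_cong[rotated])
qed

section \<open>Leading coefficients of eventually polynomial sequences\<close>

lemma poly_eventually_pos:
  fixes P :: "rat poly"
  assumes "lead_coeff P > 0"
  shows "\<exists>c>0. \<forall>\<^sub>F m in sequentially. poly P (of_nat m) \<ge> c"
  using assms
proof (induction P)
  case 0
  then show ?case by simp
next
  case (pCons a P)
  show ?case
  proof (cases "P = 0")
    case True
    then show ?thesis using pCons.prems by (intro exI[of _ a]) simp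
  next
    case False
    then obtain c where c: "c > 0" "\<forall>\<^sub>F m in sequentially. poly P (of_nat m) \<ge> c"
      using pCons by auto
    obtain N where N: "(1 - a) / c < of_nat N" using reals_Archimedean2 by blast
    have "\<forall>\<^sub>F m in sequentially. poly (pCons a P) (of_nat m) \<ge> 1"
      using c(2) eventually_ge_at_top[of N]
    proof eventually_elim
      case (elim m)
      have "(1 - a) / c \<le> of_nat m" using N elim(2) by (meson less_imp_le of_nat_mono order.trans)
      then have "1 - a \<le> of_nat m * c" using c(1) by (simp add: field_simps)
      also have "\<dots> \<le> of_nat m * poly P (of_nat m)" using elim(1) by (intro mult_left_mono) auto
      finally show ?case by simp
    qed
    then show ?thesis by (intro exI[of _ 1]) simp
  qed
qed

lemma lead_coeff_nonneg:
  fixes P :: "rat poly"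
  assumes "\<forall>\<^sub>F m in sequentially. poly P (of_nat m) \<ge> 0"
  shows "lead_coeff P \<ge> 0"
proof (rule ccontr)
  assume "\<not> lead_coeff P \<ge> 0"
  then have "lead_coeff (- P) > 0" by simp
  then obtain c where c: "c > 0" "\<forall>\<^sub>F m in sequentially. poly (- P) (of_nat m) \<ge> c"
    using poly_eventually_pos by blast
  from c(2) assms have "\<forall>\<^sub>F m::nat in sequentially. False"
    by eventually_elim (use c(1) in auto)
  then show False by simp
qed

lemma eventually_poly_unique:
  fixes P Q :: "rat poly"
  assumes "\<forall>\<^sub>F m in sequentially. poly P (of_nat m) = poly Q (of_nat m)"
  shows "P = Q"
proof -
  have "\<forall>\<^sub>F m in sequentially. poly (P - Q) (of_nat m) \<ge> 0"
    "\<forall>\<^sub>F m in sequentially. poly (Q - P) (of_nat m) \<ge> 0"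
    using assms by (eventually_elim, simp)+
  then have "lead_coeff (P - Q) \<ge> 0" "lead_coeff (Q - P) \<ge> 0" by (intro lead_coeff_nonneg; simp)+
  moreover have "lead_coeff (Q - P) = - lead_coeff (P - Q)" by (metis lead_coeff_minus minus_diff_eq)
  ultimately have "lead_coeff (P - Q) = 0" by linarith
  then show ?thesis using leading_coeff_0_iff[of "P - Q"] by (simp only: right_minus_eq)
qed

text \<open>\<open>n\<close> differences reduce \<open>P\<close> to the constant
  \<open>fact n * coeff P n\<close> and keep the values integral. With \<open>n\<close> as a bound
  instead of the degree, vanishing coefficients cause no case distinction in the induction.\<close>

lemma fact_lead_coeff_int:
  fixes P :: "rat poly"
  assumes "\<forall>\<^sub>F m in sequentially. poly P (of_nat m) \<in> \<int>" "degree P \<le> n"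
  shows "fact n * coeff P n \<in> \<int>"
  using assms
proof (induction n arbitrary: P)
  case 0
  then obtain c where "P = [:c:]" by (auto elim: degree_eq_zeroE)
  then show ?case using 0 by simp
next
  case (Suc n)
  have "\<forall>\<^sub>F m in sequentially. poly P (of_nat (Suc m)) \<in> \<int>"
    using Suc.prems(1) eventually_sequentially_Suc[of "\<lambda>m. poly P (of_nat m) \<in> \<int>"] by simp
  with Suc.prems(1) have "\<forall>\<^sub>F m in sequentially. poly (poly_delta P) (of_nat m) \<in> \<int>"
    by eventually_elim (auto simp: poly_delta_eval add.commute)
  then have "fact n * coeff (poly_delta P) n \<in> \<int>"
    using poly_delta_degree(1)[OF Suc.prems(2)] by (rule Suc.IH)
  then show ?case
    unfolding poly_delta_degree(2)[OF Suc.prems(2)] by (simp add: algebra_simps)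
qed

lemma fact_lead_coeff_nat:
  fixes P :: "rat poly"
  assumes "\<forall>\<^sub>F m in sequentially. poly P (of_nat m) = of_nat (f m)"
  shows "\<exists>e::nat. of_nat e = fact (degree P) * lead_coeff P"
proof -
  have "\<forall>\<^sub>F m in sequentially. poly P (of_nat m) \<in> \<int>"
    using assms by eventually_elim simp
  then have "fact (degree P) * lead_coeff P \<in> \<int>" by (rule fact_lead_coeff_int) simp
  moreover have "\<forall>\<^sub>F m in sequentially. poly P (of_nat m) \<ge> 0"
    using assms by eventually_elim simp
  then have "fact (degree P) * lead_coeff P \<ge> 0" by (simp add: lead_coeff_nonneg)
  ultimately obtain z where z: "fact (degree P) * lead_coeff P = of_int z" "z \<ge> 0"
    by (auto elim!: Ints_cases)
  then show ?thesis by (intro exI[of _ "nat z"]) simp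
qed

text \<open>A bounded shift of the argument alters \<open>P\<close> only below its leading term.
  Thus \<open>A\<close> is eventually between 0 and a polynomial without terms from
  \<open>degree P\<close> on, and so has no such terms either.\<close>

lemma lead_coeff_sandwich:
  fixes P Q :: "rat poly" and p :: nat
  assumes "P \<noteq> 0" "0 < p"
    and upper: "\<forall>\<^sub>F m in sequentially. poly Q (of_nat m) \<le> of_nat p * poly P (of_nat m)"
    and lower: "\<forall>\<^sub>F m in sequentially. of_nat p * poly P (of_nat m) \<le> poly Q (of_nat (m + D))"
  shows "degree Q = degree P" "lead_coeff Q = of_nat p * lead_coeff P"
proof -
  define R where "R = P - pcompose P [:- of_nat D, 1:]"
  define A where "A = Polynomial.smult (of_nat p) P - Q"
  have "\<forall>\<^sub>F m in sequentially. poly A (of_nat m) \<ge> 0"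
    using upper by eventually_elim (simp add: A_def)
  then have A0: "lead_coeff A \<ge> 0" by (rule lead_coeff_nonneg)
  obtain N where N: "of_nat p * poly P (of_nat m) \<le> poly Q (of_nat (m + D))" if "N \<le> m" for m
    using lower unfolding eventually_sequentially by blast
  have "poly (Polynomial.smult (of_nat p) R - A) (of_nat m) \<ge> 0" if "N + D \<le> m" for m
  proof -
    have "of_nat p * poly P (of_nat m - of_nat D) \<le> poly Q (of_nat m)"
      using N[of "m - D"] that by (simp add: of_nat_diff)
    then show ?thesis by (simp add: R_def A_def poly_pcompose algebra_simps)
  qed
  then have "\<forall>\<^sub>F m in sequentially. poly (Polynomial.smult (of_nat p) R - A) (of_nat m) \<ge> 0"
    unfolding eventually_sequentially by blast
  then have RA0: "lead_coeff (Polynomial.smult (of_nat p) R - A) \<ge> 0" by (rule lead_coeff_nonneg)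
  have deg: "degree (pcompose P [:- of_nat D, 1:]) = degree P" by (simp add: degree_pcompose)
  have "lead_coeff (pcompose P [:- of_nat D, 1:]) = lead_coeff P" by (subst lead_coeff_comp) simp_all
  note comp = deg this[unfolded deg]
  have R: "coeff R i = 0" if "degree P \<le> i" for i
    using that comp by (cases "i = degree P") (auto simp: R_def coeff_eq_0)
  have A: "coeff A i = 0" if "degree P \<le> i" for i
  proof (rule ccontr)
    assume "coeff A i \<noteq> 0"
    then have "degree P \<le> degree A" "A \<noteq> 0" using le_degree[of A i] that by auto
    have "degree (Polynomial.smult (of_nat p) R - A) \<le> degree A"
      by (rule degree_le) (use R \<open>degree P \<le> degree A\<close> in \<open>auto simp: coeff_eq_0\<close>)
    moreover have *: "coeff (Polynomial.smult (of_nat p) R - A) (degree A) = - lead_coeff A"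
      using R \<open>degree P \<le> degree A\<close> by simp
    then have "degree A \<le> degree (Polynomial.smult (of_nat p) R - A)"
      using \<open>A \<noteq> 0\<close> by (intro le_degree) (simp only: *, simp)
    ultimately have "degree (Polynomial.smult (of_nat p) R - A) = degree A" by simp
    then have "lead_coeff A \<le> 0" using RA0 * by (simp only: neg_0_le_iff_le)
    then show False using A0 \<open>A \<noteq> 0\<close> by simp
  qed
  have Q: "coeff Q i = of_nat p * coeff P i" if "degree P \<le> i" for i
    using A[OF that] by (simp add: A_def)
  have "degree Q \<le> degree P" by (rule degree_le) (use Q in \<open>auto simp: coeff_eq_0\<close>)
  moreover have "degree P \<le> degree Q" by (rule le_degree) (use Q assms(1,2) in auto)
  ultimately show "degree Q = degree P" by simp
  then show "lead_coeff Q = of_nat p * lead_coeff P" using Q by simp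
qed

section \<open>Dimensions of function spaces\<close>

context vector_space
begin

lemma dim_mono_finite:
  assumes "A \<subseteq> B" "B \<subseteq> span S" "finite S"
  shows "dim A \<le> dim B"
proof -
  obtain C where C: "C \<subseteq> A" "independent C" "card C = dim A" using basis_exists by metis
  obtain D where D: "D \<subseteq> B" "independent D" "B \<subseteq> span D" "card D = dim B"
    using basis_exists by metis
  have "finite D" using independent_span_bound[OF assms(3) D(2)] D(1) assms(2) by blast
  then have "card C \<le> card D" using independent_span_bound[OF _ C(2)] C(1) D(3) assms(1) by blast
  then show ?thesis using C D by simp
qed

text \<open>The abstract form of standard monomials: elements outside the span of the smaller ones
  form a basis. Inserting in increasing order of \<open>\<rho>\<close> leaves the status of earlier
  elements unchanged.\<close>

lemma dim_span_standard:
  fixes \<rho> :: "'c \<Rightarrow> nat"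
  assumes "finite A" "inj_on \<rho> A"
  shows "dim (span (v ` A)) = card {a \<in> A. v a \<notin> span (v ` {b \<in> A. \<rho> b < \<rho> a})}"
proof -
  let ?St = "\<lambda>A. {a \<in> A. v a \<notin> span (v ` {b \<in> A. \<rho> b < \<rho> a})}"
  have "inj_on v (?St A) \<and> independent (v ` ?St A) \<and> span (v ` ?St A) = span (v ` A)"
    using assms
  proof (induction A rule: finite_ranking_induct[where f = \<rho>])
    case empty
    show ?case by (simp add: independent_empty)
  next
    case (insert x A)
    show ?case
    proof (cases "x \<in> A")
      case True
      then show ?thesis using insert by (simp add: insert_absorb)
    next
      case False
      have lt: "\<rho> y < \<rho> x" if "y \<in> A" for y
        using insert that False by (metis inj_onD insertCI order.not_eq_order_implies_strict)
      have IH: "inj_on v (?St A)" "independent (v ` ?St A)" "span (v ` ?St A) = span (v ` A)"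
        using insert by (auto simp: inj_on_insert)
      have x: "{b \<in> insert x A. \<rho> b < \<rho> x} = A" using lt by auto
      have y: "{b \<in> insert x A. \<rho> b < \<rho> y} = {b \<in> A. \<rho> b < \<rho> y}" if "y \<in> A" for y
        using lt[OF that] by auto
      show ?thesis
      proof (cases "v x \<in> span (v ` A)")
        case True
        have "?St (insert x A) = ?St A" using True x y by auto
        moreover have "span (v ` insert x A) = span (v ` A)" using True by (simp add: span_redundant)
        ultimately show ?thesis using IH by simp
      next
        case False
        have St: "?St (insert x A) = insert x (?St A)" using False x y by auto
        have "v x \<notin> v ` ?St A" by (rule contrapos_nn[OF False[folded IH(3)] span_base])
        moreover have "x \<notin> ?St A" using \<open>x \<notin> A\<close> by simp
        ultimately have "inj_on v (insert x (?St A))" using IH(1) by simp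
        moreover have "independent (insert (v x) (v ` ?St A))"
          by (rule independent_insertI[OF False[folded IH(3)] IH(2)])
        moreover have "span (insert (v x) (v ` ?St A)) = span (insert (v x) (v ` A))"
          unfolding span_insert IH(3) ..
        ultimately show ?thesis unfolding St by simp
      qed
    qed
  qed
  then have St: "inj_on v (?St A)" "independent (v ` ?St A)" "span (v ` ?St A) = span (v ` A)"
    by simp_all
  show ?thesis
    unfolding St(3)[symmetric] dim_span_eq_card_independent[OF St(2)] by (rule card_image[OF St(1)])
qed

end

text \<open>Rank and nullity for a subspace inside a finite span, since the ambient spaces of
  polynomials and of functions can be infinite-dimensional. A basis of the kernel is extended to one
  of \<open>V\<close>; the added vectors map to a basis of the image.\<close>

lemma (in vector_space_pair) dim_kernel_image:
  assumes f: "Vector_Spaces.linear s1 s2 f" and V: "vs1.subspace V" "V \<subseteq> vs1.span S" "finite S"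
  shows "vs1.dim V = vs1.dim {x \<in> V. f x = 0} + vs2.dim (f ` V)"
proof -
  let ?K = "{x \<in> V. f x = 0}"
  obtain B where B: "B \<subseteq> ?K" "vs1.independent B" "?K \<subseteq> vs1.span B" "card B = vs1.dim ?K"
    by (rule vs1.basis_exists)
  obtain C where C: "B \<subseteq> C" "C \<subseteq> V" "vs1.independent C" "V \<subseteq> vs1.span C"
    by (rule vs1.maximal_independent_subset_extend[of B V]) (use B in auto)
  have "finite C" using vs1.independent_span_bound[OF V(3) C(3)] C(2) V(2) by blast
  have indep: "vs1.independent (C - B)" using vs1.dependent_mono[of "C - B" C] C(3) by blast
  have spanV: "vs1.span (C - B) \<subseteq> V" using vs1.span_minimal[OF _ V(1)] C(2) by blast
  have "inj_on f (vs1.span (C - B))"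
  proof (subst linear_inj_on_iff_eq_0[OF f], simp, intro ballI impI)
    fix x assume x: "x \<in> vs1.span (C - B)" "f x = 0"
    then have xB: "x \<in> vs1.span B" using spanV B(3) by blast
    \<comment> \<open>The representations over \<open>B\<close> and over \<open>C - B\<close> have
      disjoint supports, so all coefficients vanish.\<close>
    have "vs1.representation C x = vs1.representation B x"
      "vs1.representation C x = vs1.representation (C - B) x"
      by (rule vs1.representation_extend[OF C(3) xB C(1)],
        rule vs1.representation_extend[OF C(3) x(1) Diff_subset])
    then have "vs1.representation C x b = 0" for b
      using vs1.representation_ne_zero[of B x b] vs1.representation_ne_zero[of "C - B" x b] by auto
    moreover have "x \<in> vs1.span C" using xB vs1.span_mono[OF C(1)] by blast
    ultimately show "x = 0"
      using vs1.sum_nonzero_representation_eq[OF C(3), of x] by simp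
  qed
  then have ind2: "vs2.independent (f ` (C - B))"
    by (rule linear_independent_injective_image[OF f indep])
  have inj: "inj_on f (C - B)"
    by (rule inj_on_subset[OF \<open>inj_on f (vs1.span (C - B))\<close> vs1.span_superset])
  have "f ` V \<subseteq> vs2.span (f ` (C - B))"
  proof -
    have "f ` V \<subseteq> vs2.span (f ` C)" using C(4) linear_span_image[OF f] by blast
    moreover have "f ` C \<subseteq> insert 0 (f ` (C - B))" using B(1) by auto
    then have "vs2.span (f ` C) \<subseteq> vs2.span (f ` (C - B))"
      using vs2.span_mono vs2.span_insert_0 by metis
    ultimately show ?thesis by blast
  qed
  then have "vs2.dim (f ` V) = card (C - B)"
    using vs2.dim_unique[OF _ _ ind2 refl] C(2) inj by (metis Diff_subset card_image image_mono order.trans)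
  moreover have "vs1.dim V = card C" using vs1.dim_unique[OF C(2,4,3) refl] .
  moreover have "card B \<le> card C" by (rule card_mono[OF \<open>finite C\<close> C(1)])
  ultimately show ?thesis
    using B(4) C(1) \<open>finite C\<close> by (simp add: card_Diff_subset finite_subset)
qed

global_interpretation cfun_pair: vector_space_pair
  "\<lambda>(c::complex) (f :: 'a \<Rightarrow> complex) x. c * f x" "\<lambda>(c::complex) (f :: 'b \<Rightarrow> complex) x. c * f x"
  by unfold_locales

global_interpretation cpoly_cfun: vector_space_pair
  cpoly_scale "\<lambda>(c::complex) (f :: 'b \<Rightarrow> complex) x. c * f x"
  by unfold_locales

lemma cfun_dim_linear_image_le:
  assumes "Vector_Spaces.linear (\<lambda>(c::complex) f x. c * f x) (\<lambda>(c::complex) f x. c * f x) T"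
    "cfun.subspace V" "V \<subseteq> cfun.span S" "finite S"
  shows "cfun.dim (T ` V) \<le> cfun.dim V"
  using cfun_pair.dim_kernel_image[OF assms] by simp

section \<open>Hilbert functions\<close>

lemma monomial_degree_superset:
  assumes "finite J" "Poly_Mapping.keys a \<subseteq> J"
  shows "(\<Sum>i\<in>Poly_Mapping.keys a. Poly_Mapping.lookup a i) = (\<Sum>i\<in>J. Poly_Mapping.lookup a i)"
  by (rule sum.mono_neutral_left) (use assms in \<open>auto simp: in_keys_iff\<close>)

lemma finite_monomials:
  assumes "finite J" shows "finite (monomials J m)"
proof (rule finite_imageD)
  have "Poly_Mapping.lookup ` monomials J m \<subseteq> {\<alpha>. (\<forall>i. i \<notin> J \<longrightarrow> \<alpha> i = 0) \<and> sum \<alpha> J = m}"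
    using assms by (auto simp: monomials_def monomial_degree_superset in_keys_iff)
  then show "finite (Poly_Mapping.lookup ` monomials J m)"
    by (rule finite_subset[OF _ finite_bounded_sum_funs[OF assms]])
  show "inj_on Poly_Mapping.lookup (monomials J m)"
    by (auto intro: inj_onI poly_mapping_eqI)
qed

lemma monomials_add:
  assumes "a \<in> monomials J m" "b \<in> monomials J n"
  shows "a + b \<in> monomials J (m + n)"
proof -
  let ?K = "Poly_Mapping.keys a \<union> Poly_Mapping.keys b"
  have "Poly_Mapping.keys (a + b) \<subseteq> ?K" by (rule keys_add)
  then have "(\<Sum>i\<in>Poly_Mapping.keys (a + b). Poly_Mapping.lookup (a + b) i) =
      (\<Sum>i\<in>?K. Poly_Mapping.lookup a i) + (\<Sum>i\<in>?K. Poly_Mapping.lookup b i)"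
    by (subst monomial_degree_superset[of ?K]) (auto simp: lookup_add sum.distrib)
  also have "\<dots> = m + n"
    using assms monomial_degree_superset[of ?K a] monomial_degree_superset[of ?K b]
    by (simp add: monomials_def)
  finally show ?thesis
    using assms \<open>Poly_Mapping.keys (a + b) \<subseteq> ?K\<close> unfolding monomials_def by blast
qed

lemma forms_add: "F \<in> forms J m \<Longrightarrow> G \<in> forms J m \<Longrightarrow> F + G \<in> forms J m"
  using keys_add[of F G] unfolding forms_def by blast

lemma forms_mult: "F \<in> forms J m \<Longrightarrow> G \<in> forms J n \<Longrightarrow> F * G \<in> forms J (m + n)"
  using keys_mult[of F G] monomials_add unfolding forms_def by fastforce

lemma forms_single: "a \<in> monomials J m \<Longrightarrow> Poly_Mapping.single a c \<in> forms J m"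
  by (simp add: forms_def)

lemma forms_iff_lookup: "F \<in> forms J m \<longleftrightarrow> (\<forall>a. a \<notin> monomials J m \<longrightarrow> Poly_Mapping.lookup F a = 0)"
  unfolding forms_def by (auto simp: in_keys_iff)

lemma lookup_cpoly_scale: "Poly_Mapping.lookup (cpoly_scale c F) a = c * Poly_Mapping.lookup F a"
  by (simp add: cpoly_scale_def Poly_Mapping.map.rep_eq when_def)

lemma cpoly_eval_scale: "cpoly_eval x (cpoly_scale c F) = c * cpoly_eval x F"
  by (simp add: cpoly_scale_eq cpoly_eval_mult cpoly_eval_single mon_eval_def)

lemma subspace_forms: "cpoly.subspace (forms J m)"
  by (auto simp: cpoly.subspace_def forms_iff_lookup lookup_add lookup_cpoly_scale)

lemma forms_eq_span:
  "forms J m = cpoly.span ((\<lambda>a. Poly_Mapping.single a 1) ` monomials J m)"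
proof
  show "cpoly.span ((\<lambda>a. Poly_Mapping.single a 1) ` monomials J m) \<subseteq> forms J m"
    by (rule cpoly.span_minimal[OF _ subspace_forms]) (auto intro: forms_single)
  show "forms J m \<subseteq> cpoly.span ((\<lambda>a. Poly_Mapping.single a 1) ` monomials J m)"
  proof
    fix F assume "F \<in> forms J m"
    then have "(\<Sum>a\<in>Poly_Mapping.keys F. cpoly_scale (Poly_Mapping.lookup F a) (Poly_Mapping.single a 1))
        \<in> cpoly.span ((\<lambda>a. Poly_Mapping.single a 1) ` monomials J m)"
      by (intro cpoly.span_sum cpoly.span_scale cpoly.span_base) (auto simp: forms_def)
    moreover have "cpoly_scale c (Poly_Mapping.single a 1) = Poly_Mapping.single a c"
      for c and a :: "'a \<Rightarrow>\<^sub>0 nat" by (simp add: cpoly_scale_eq mult_single)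
    ultimately show "F \<in> cpoly.span ((\<lambda>a. Poly_Mapping.single a 1) ` monomials J m)"
      by (simp flip: cpoly_eq_sum_single)
  qed
qed

lemma linear_restricted_eval:
  "Vector_Spaces.linear cpoly_scale (\<lambda>c f x. c * f x)
    (\<lambda>F x. if x \<in> X then cpoly_eval (g x) F else 0)"
  by (simp add: Vector_Spaces.linear_iff cpoly.vector_space_axioms cfun.vector_space_axioms
      cpoly_eval_add cpoly_eval_scale fun_eq_iff)

text \<open>Forms modulo those that vanish are identified with their functions on test points.
  Setting the functions to 0 off \<open>X\<close> keeps them in one vector space, and
  \<open>g\<close> allows affine points to test a projective set.\<close>

lemma hilbert_function_eq_dim:
  assumes "finite J"
    and "\<And>F. F \<in> forms J m \<Longrightarrow>
      (\<forall>y\<in>Y. cpoly_eval y F = 0) \<longleftrightarrow> (\<forall>x\<in>X. cpoly_eval (g x) F = 0)"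
  shows "hilbert_function J Y m =
    cfun.dim ((\<lambda>F x. if x \<in> X then cpoly_eval (g x) F else 0) ` forms J m)"
proof -
  let ?E = "\<lambda>F x. if x \<in> X then cpoly_eval (g x) F else 0"
  have "{F \<in> forms J m. ?E F = 0} = vanishing_forms J Y m"
    unfolding vanishing_forms_def using assms(2) by (auto simp: fun_eq_iff)
  moreover have "cpoly.dim (forms J m) =
      cpoly.dim {F \<in> forms J m. ?E F = 0} + cfun.dim (?E ` forms J m)"
    by (rule cpoly_cfun.dim_kernel_image[OF linear_restricted_eval subspace_forms
          equalityD1[OF forms_eq_span]])
      (use assms(1) in \<open>simp add: finite_monomials\<close>)
  ultimately show ?thesis by (simp add: hilbert_function_def)
qed

text \<open>Substituting distinct primes for the variables compares monomials as natural numbers.\<close>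

lemma exists_monomial_ranking:
  assumes "finite J"
  shows "\<exists>\<rho> :: ('i \<Rightarrow>\<^sub>0 nat) \<Rightarrow> nat. inj_on \<rho> {a. Poly_Mapping.keys a \<subseteq> J} \<and>
    (\<forall>a b c. \<rho> a < \<rho> b \<longrightarrow> \<rho> (a + c) < \<rho> (b + c))"
proof -
  obtain B :: "nat set" where B: "finite B" "card B = card J" "B \<subseteq> {p. prime p}"
    using infinite_arbitrarily_large[OF primes_infinite] by blast
  obtain q :: "'i \<Rightarrow> nat" where "bij_betw q J B"
    using finite_same_card_bij[OF assms B(1)] B(2) by (metis (no_types))
  then have q: "inj_on q J" "\<And>j. j \<in> J \<Longrightarrow> prime (q j)"
    using B(3) by (auto simp: bij_betw_def)
  define \<rho> where "\<rho> a = (\<Prod>j\<in>J. q j ^ Poly_Mapping.lookup a j)" for a :: "'i \<Rightarrow>\<^sub>0 nat"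
  have add: "\<rho> (a + c) = \<rho> a * \<rho> c" for a c
    by (simp add: \<rho>_def lookup_add power_add prod.distrib)
  have pos: "\<rho> c > 0" for c
    unfolding \<rho>_def by (rule prod_pos) (use q prime_gt_0_nat in auto)
  have mult: "multiplicity (q j) (\<rho> a) = Poly_Mapping.lookup a j" if "j \<in> J" for a j
  proof -
    have "\<rho> a = (\<Prod>p\<in>q ` J. p ^ Poly_Mapping.lookup a (the_inv_into J q p))"
      unfolding \<rho>_def
      by (subst prod.reindex[OF q(1)]) (simp add: the_inv_into_f_f[OF q(1)])
    also have "multiplicity (q j) \<dots> =
        (if q j \<in> q ` J then Poly_Mapping.lookup a (the_inv_into J q (q j)) else 0)"
      by (rule multiplicity_prod_prime_powers) (use that q assms in auto)
    finally show ?thesis using that by (simp add: the_inv_into_f_f[OF q(1)])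
  qed
  have "inj_on \<rho> {a. Poly_Mapping.keys a \<subseteq> J}"
  proof (rule inj_onI)
    fix a b assume ab: "a \<in> {a. Poly_Mapping.keys a \<subseteq> J}" "b \<in> {a. Poly_Mapping.keys a \<subseteq> J}" "\<rho> a = \<rho> b"
    show "a = b"
    proof (rule poly_mapping_eqI)
      fix j show "Poly_Mapping.lookup a j = Poly_Mapping.lookup b j"
      proof (cases "j \<in> J")
        case True
        then show ?thesis using mult ab(3) by metis
      next
        case False
        then have "j \<notin> Poly_Mapping.keys a" "j \<notin> Poly_Mapping.keys b" using ab by auto
        then show ?thesis by (simp add: in_keys_iff)
      qed
    qed
  qed
  moreover have "\<forall>a b c. \<rho> a < \<rho> b \<longrightarrow> \<rho> (a + c) < \<rho> (b + c)" using pos by (simp add: add)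
  ultimately show ?thesis by blast
qed

text \<open>The monomials that are not linear combinations of smaller ones of the same degree form
  a staircase, and they index a basis of the functions induced by forms.\<close>

lemma hilbert_function_eventually_poly:
  assumes J: "finite J"
  shows "eventually_poly (hilbert_function J Y)"
proof -
  obtain \<rho> :: "('a \<Rightarrow>\<^sub>0 nat) \<Rightarrow> nat" where \<rho>: "inj_on \<rho> {a. Poly_Mapping.keys a \<subseteq> J}"
    "\<And>a b c. \<rho> a < \<rho> b \<Longrightarrow> \<rho> (a + c) < \<rho> (b + c)"
    using exists_monomial_ranking[OF J] by auto
  define v where "v a y = (if y \<in> Y then mon_eval y a else 0)" for a y
  define deg where "deg a = (\<Sum>i\<in>Poly_Mapping.keys a. Poly_Mapping.lookup a i)" for a :: "'a \<Rightarrow>\<^sub>0 nat"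
  define A where "A a = {b \<in> monomials J (deg a). \<rho> b < \<rho> a}" for a
  define St where "St = {a. Poly_Mapping.keys a \<subseteq> J \<and> v a \<notin> cfun.span (v ` A a)}"
  define S where "S = Poly_Mapping.lookup ` St"
  have "staircase J S"
    unfolding staircase_def
  proof (intro ballI conjI allI impI)
    fix \<alpha> i assume "\<alpha> \<in> S" "i \<notin> J"
    then show "\<alpha> i = 0" unfolding S_def St_def by (auto simp: in_keys_iff)
  next
    fix \<alpha> \<beta> assume "\<alpha> \<in> S" and le: "\<forall>i. \<beta> i \<le> \<alpha> i"
    then obtain a where a: "a \<in> St" "\<alpha> = Poly_Mapping.lookup a" unfolding S_def by blast
    have "{i. \<beta> i \<noteq> 0} \<subseteq> Poly_Mapping.keys a"
    proof
      fix i assume "i \<in> {i. \<beta> i \<noteq> 0}"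
      then have "\<alpha> i \<noteq> 0" using le[rule_format, of i] by simp
      then show "i \<in> Poly_Mapping.keys a" by (simp add: a(2) in_keys_iff)
    qed
    then have "finite {i. \<beta> i \<noteq> 0}" by (rule finite_subset) simp
    then have b: "Poly_Mapping.lookup (Abs_poly_mapping \<beta>) = \<beta>" by (rule lookup_Abs_poly_mapping)
    define b where "b = Abs_poly_mapping \<beta>"
    define c where "c = a - b"
    have abc: "a = b + c"
      by (rule poly_mapping_eqI) (use le a(2) b in \<open>simp add: b_def c_def lookup_add lookup_minus\<close>)
    have kb: "Poly_Mapping.keys b \<subseteq> J"
      using a \<open>{i. \<beta> i \<noteq> 0} \<subseteq> Poly_Mapping.keys a\<close> b by (auto simp: b_def St_def in_keys_iff)
    have kc: "Poly_Mapping.keys c \<subseteq> J"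
      using a(1) by (auto simp: c_def St_def in_keys_iff lookup_minus)
    have "b \<in> St"
    proof (rule ccontr)
      assume "b \<notin> St"
      then have "v b \<in> cfun.span (v ` A b)" using kb by (simp add: St_def)
      \<comment> \<open>If a divisor \<open>b\<close> of \<open>a\<close> reduces to smaller
        monomials, multiplication by \<open>c = a - b\<close> reduces \<open>a\<close>, as
        \<open>\<rho>\<close> is compatible with addition and degrees add up.\<close>
      then have "(\<lambda>y. v b y * v c y) \<in> cfun.span (v ` A a)"
      proof (rule cfun_span_mult[OF _ cfun.span_base[OF singletonI]])
        fix f g assume "f \<in> v ` A b" "g \<in> {v c}"
        then obtain b' where b': "b' \<in> A b" "f = v b'" "g = v c" by blast
        have "c \<in> monomials J (deg c)" "b \<in> monomials J (deg b)"
          using kb kc by (auto simp: monomials_def deg_def)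
        then have "b' + c \<in> monomials J (deg b + deg c)" "a \<in> monomials J (deg b + deg c)"
          using monomials_add b'(1) abc by (auto simp: A_def)
        moreover from this have "deg a = deg b + deg c" by (simp add: monomials_def deg_def)
        ultimately have "b' + c \<in> A a" using b'(1) \<rho>(2) abc by (simp add: A_def)
        moreover have "(\<lambda>y. f y * g y) = v (b' + c)"
          using b' by (auto simp: v_def mon_eval_add fun_eq_iff)
        ultimately show "(\<lambda>y. f y * g y) \<in> cfun.span (v ` A a)"
          by (simp only: cfun.span_base imageI)
      qed
      moreover have "(\<lambda>y. v b y * v c y) = v a"
        unfolding abc by (auto simp: v_def mon_eval_add fun_eq_iff)
      ultimately show False using a(1) by (simp add: St_def)
    qed
    then show "\<beta> \<in> S" using b unfolding S_def b_def by (metis imageI)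
  qed
  then have ev: "eventually_poly (\<lambda>m. card {\<alpha> \<in> S. sum \<alpha> J = m})" by (rule staircase_count[OF J])
  have "card {\<alpha> \<in> S. sum \<alpha> J = m} = hilbert_function J Y m" for m
  proof -
    let ?M = "monomials J m"
    let ?B = "{a \<in> ?M. v a \<notin> cfun.span (v ` {b \<in> ?M. \<rho> b < \<rho> a})}"
    have "{\<alpha> \<in> S. sum \<alpha> J = m} = Poly_Mapping.lookup ` ?B"
      unfolding S_def St_def A_def
      by (auto simp: monomials_def deg_def monomial_degree_superset[OF J])
    moreover have "inj_on Poly_Mapping.lookup ?B" by (auto intro: inj_onI poly_mapping_eqI)
    ultimately have "card {\<alpha> \<in> S. sum \<alpha> J = m} = card ?B" by (simp add: card_image)
    also have "\<dots> = cfun.dim (cfun.span (v ` ?M))"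
    proof (rule cfun.dim_span_standard[symmetric])
      show "finite ?M" by (rule finite_monomials[OF J])
      show "inj_on \<rho> ?M" by (rule inj_on_subset[OF \<rho>(1)]) (auto simp: monomials_def)
    qed
    also have "cfun.span (v ` ?M) = (\<lambda>F y. if y \<in> Y then cpoly_eval y F else 0) ` forms J m"
    proof -
      have "(\<lambda>F y. if y \<in> Y then cpoly_eval y F else 0) (Poly_Mapping.single a 1) = v a" for a
        by (auto simp: v_def cpoly_eval_single)
      then have "v ` ?M = (\<lambda>F y. if y \<in> Y then cpoly_eval y F else 0) `
          (\<lambda>a. Poly_Mapping.single a 1) ` ?M"
        by (simp add: image_image)
      then show ?thesis
        unfolding forms_eq_span by (simp only: cpoly_cfun.linear_span_image[OF linear_restricted_eval])
    qed
    also have "cfun.dim \<dots> = hilbert_function J Y m"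
      by (rule hilbert_function_eq_dim[OF J, of m Y Y "\<lambda>y. y", symmetric]) simp
    finally show ?thesis .
  qed
  then show ?thesis using ev by simp
qed

section \<open>The degree in terms of the Hilbert function\<close>

lemma hilbert_polynomial_eventually:
  assumes "finite J"
  shows "\<forall>\<^sub>F m in sequentially.
    poly (hilbert_polynomial J Y) (of_nat m) = of_nat (hilbert_function J Y m)"
proof -
  obtain P where P: "\<forall>\<^sub>F m in sequentially. poly P (of_nat m) = (of_nat (hilbert_function J Y m) :: rat)"
    using hilbert_function_eventually_poly[OF assms] unfolding eventually_poly_def by blast
  show ?thesis
    unfolding hilbert_polynomial_def
  proof (rule theI)
    show "\<forall>\<^sub>F m in sequentially. poly P (of_nat m) = of_nat (hilbert_function J Y m)" by (rule P)
    fix Q :: "rat poly"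
    assume "\<forall>\<^sub>F m in sequentially. poly Q (of_nat m) = of_nat (hilbert_function J Y m)"
    with P have "\<forall>\<^sub>F m in sequentially. poly Q (of_nat m) = poly P (of_nat m)"
      by eventually_elim simp
    then show "Q = P" by (rule eventually_poly_unique)
  qed
qed

lemma projective_degree_eq:
  assumes "finite J"
  shows "of_nat (projective_degree J Y) =
    fact (degree (hilbert_polynomial J Y)) * lead_coeff (hilbert_polynomial J Y)"
proof -
  obtain e :: nat where e: "of_nat e =
      fact (degree (hilbert_polynomial J Y)) * lead_coeff (hilbert_polynomial J Y)"
    using fact_lead_coeff_nat[OF hilbert_polynomial_eventually[OF assms]] by blast
  then show ?thesis
    unfolding projective_degree_def by (rule theI) (use e of_nat_eq_iff in metis)
qed

text \<open>The numerical criterion for degrees: Hilbert functions that agree up to the factor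
  \<open>p\<close> and a bounded shift. Positivity excludes the zero polynomial, to which the
  comparison of leading coefficients does not apply.\<close>

lemma projective_degree_sandwich:
  assumes "finite J" "finite K" "0 < p"
    and upper: "\<And>m. hilbert_function J Y m \<le> p * hilbert_function K Z m"
    and lower: "\<And>m. p * hilbert_function K Z m \<le> hilbert_function J Y (m + D)"
    and pos: "\<And>m. 0 < hilbert_function K Z m"
  shows "projective_degree J Y = p * projective_degree K Z"
proof -
  let ?P = "hilbert_polynomial K Z" and ?Q = "hilbert_polynomial J Y"
  note P = hilbert_polynomial_eventually[OF assms(2), of Z]
    and Q = hilbert_polynomial_eventually[OF assms(1), of Y]
  have "?P \<noteq> 0"
  proof
    assume "?P = 0"
    with P have "\<forall>\<^sub>F m::nat in sequentially. False"
      by (auto elim!: eventually_mono simp: pos[THEN less_imp_neq, symmetric])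
    then show False by simp
  qed
  moreover have "\<forall>\<^sub>F m in sequentially. poly ?Q (of_nat m) \<le> of_nat p * poly ?P (of_nat m)"
    using P Q
  proof eventually_elim
    case (elim m)
    show ?case unfolding elim of_nat_mult[symmetric] of_nat_le_iff by (rule upper)
  qed
  moreover have "\<forall>\<^sub>F m in sequentially. of_nat p * poly ?P (of_nat m) \<le> poly ?Q (of_nat (m + D))"
    using P sequentially_offset[OF Q, of D]
  proof eventually_elim
    case (elim m)
    show ?case unfolding elim of_nat_mult[symmetric] of_nat_le_iff by (rule lower)
  qed
  ultimately have "degree ?Q = degree ?P" "lead_coeff ?Q = of_nat p * lead_coeff ?P"
    using lead_coeff_sandwich[of ?P p ?Q D] assms(3) by blast+
  then have "(of_nat (projective_degree J Y) :: rat) = of_nat p * of_nat (projective_degree K Z)"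
    unfolding projective_degree_eq[OF assms(1)] projective_degree_eq[OF assms(2)] by simp
  then show ?thesis by (metis of_nat_eq_iff of_nat_mult)
qed

section \<open>Degrees of unions of linear copies\<close>

lemma finite_add_index: "finite I \<Longrightarrow> finite (add_index I)"
  by (simp add: add_index_def)

text \<open>Homogenisation with the variable \<open>None\<close>, which is set to 1; the rule
  \<open>raise\<close> corresponds to multiplying by a power of this variable.\<close>

lemma poly_fun_deg_iff_form:
  "poly_fun_deg I m P \<longleftrightarrow> (\<exists>F\<in>forms (add_index I) m. \<forall>x. P x = cpoly_eval (add_coord 1 x) F)"
proof
  assume "poly_fun_deg I m P"
  then show "\<exists>F\<in>forms (add_index I) m. \<forall>x. P x = cpoly_eval (add_coord 1 x) F"
  proof induction
    case (const c)
    have "Poly_Mapping.single 0 c \<in> forms (add_index I) 0"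
      by (rule forms_single) (simp add: monomials_degree_zero)
    then show ?case
      by (intro bexI[of _ "Poly_Mapping.single 0 c"]) (simp_all add: cpoly_eval_single mon_eval_def)
  next
    case (var i)
    then have "Poly_Mapping.single (Some i) 1 \<in> monomials (add_index I) 1"
      by (simp add: monomials_def add_index_def)
    then show ?case
      by (intro bexI[OF _ forms_single]) (auto simp: cpoly_eval_single mon_eval_def add_coord_def)
  next
    case (add m P Q)
    then obtain F G where "F \<in> forms (add_index I) m" "\<forall>x. P x = cpoly_eval (add_coord 1 x) F"
      "G \<in> forms (add_index I) m" "\<forall>x. Q x = cpoly_eval (add_coord 1 x) G" by (elim bexE)
    then show ?case by (intro bexI[of _ "F + G"]) (simp_all add: cpoly_eval_add forms_add)
  next
    case (mult m P n Q)
    then obtain F G where "F \<in> forms (add_index I) m" "\<forall>x. P x = cpoly_eval (add_coord 1 x) F"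
      "G \<in> forms (add_index I) n" "\<forall>x. Q x = cpoly_eval (add_coord 1 x) G" by (elim bexE)
    then show ?case by (intro bexI[of _ "F * G"]) (simp_all add: cpoly_eval_mult forms_mult)
  next
    case (raise m P n)
    then obtain F where F: "F \<in> forms (add_index I) m" "\<forall>x. P x = cpoly_eval (add_coord 1 x) F"
      by (elim bexE)
    let ?s = "Poly_Mapping.single (Poly_Mapping.single None (n - m)) 1 :: 'a option cpoly"
    have "Poly_Mapping.single None (n - m) \<in> monomials (add_index I) (n - m)"
      by (simp add: monomials_def add_index_def)
    then have "F * ?s \<in> forms (add_index I) (m + (n - m))" by (intro forms_mult F forms_single)
    then show ?case using F(2) raise.hyps(2)
      by (intro bexI[of _ "F * ?s"])
        (simp_all add: cpoly_eval_mult cpoly_eval_single mon_eval_def add_coord_def)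
  qed
next
  assume "\<exists>F\<in>forms (add_index I) m. \<forall>x. P x = cpoly_eval (add_coord 1 x) F"
  then obtain F where F: "F \<in> forms (add_index I) m" "P = (\<lambda>x. cpoly_eval (add_coord 1 x) F)"
    by blast
  have factor: "poly_fun_deg I (n * 1) (\<lambda>x. add_coord 1 x i ^ n)" if "i \<in> add_index I" for i n
  proof (rule poly_fun_deg_power)
    show "poly_fun_deg I 1 (\<lambda>x. add_coord 1 x i)"
      using that by (auto simp: add_index_def add_coord_def poly_fun_deg_var)
  qed
  have "poly_fun_deg I m (\<lambda>x. mon_eval (add_coord 1 x) a)" if "a \<in> Poly_Mapping.keys F" for a
  proof -
    have a: "a \<in> monomials (add_index I) m" using F(1) that by (auto simp: forms_def)
    then have "poly_fun_deg I (\<Sum>i\<in>Poly_Mapping.keys a. Poly_Mapping.lookup a i * 1)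
        (\<lambda>x. mon_eval (add_coord 1 x) a)"
      unfolding mon_eval_def by (intro poly_fun_deg_prod factor) (auto simp: monomials_def)
    then show ?thesis using a by (simp add: monomials_def)
  qed
  then show "poly_fun_deg I m P"
    unfolding F(2) cpoly_eval_def by (intro poly_fun_deg_sum poly_fun_deg_cmult)
qed

definition restricted_polys ::
  "'i set \<Rightarrow> ('i \<Rightarrow> complex) set \<Rightarrow> nat \<Rightarrow> (('i \<Rightarrow> complex) \<Rightarrow> complex) set" where
  "restricted_polys I X m = (\<lambda>P x. if x \<in> X then P x else 0) ` {P. poly_fun_deg I m P}"

lemma restricted_polys_eq_forms:
  "restricted_polys I X m =
    (\<lambda>F x. if x \<in> X then cpoly_eval (add_coord 1 x) F else 0) ` forms (add_index I) m"
proof (intro equalityI subsetI)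
  fix f assume "f \<in> restricted_polys I X m"
  then obtain P where P: "poly_fun_deg I m P" "f = (\<lambda>x. if x \<in> X then P x else 0)"
    unfolding restricted_polys_def by blast
  then obtain F where "F \<in> forms (add_index I) m" "\<forall>x. P x = cpoly_eval (add_coord 1 x) F"
    unfolding poly_fun_deg_iff_form by blast
  then show "f \<in> (\<lambda>F x. if x \<in> X then cpoly_eval (add_coord 1 x) F else 0) ` forms (add_index I) m"
    using P(2) by (intro image_eqI[of _ _ F]) auto
next
  fix f assume "f \<in> (\<lambda>F x. if x \<in> X then cpoly_eval (add_coord 1 x) F else 0) ` forms (add_index I) m"
  then obtain F where F: "F \<in> forms (add_index I) m"
    "f = (\<lambda>x. if x \<in> X then cpoly_eval (add_coord 1 x) F else 0)" by blast
  have "poly_fun_deg I m (\<lambda>x. cpoly_eval (add_coord 1 x) F)"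
    unfolding poly_fun_deg_iff_form using F(1) by (intro bexI[of _ F]) simp_all
  then show "f \<in> restricted_polys I X m"
    unfolding restricted_polys_def F(2) by (intro image_eqI[OF refl]) simp
qed

text \<open>The closure is cut out by exactly the forms that vanish on the lifted points, so closing
  changes no vanishing condition; lifted points are nonzero because their coordinate
  \<open>None\<close> is 1.\<close>

lemma hilbert_function_projective_closure:
  assumes "finite I" "X \<subseteq> affine_space I"
  shows "hilbert_function (add_index I) (projective_closure I X) m = cfun.dim (restricted_polys I X m)"
  unfolding restricted_polys_eq_forms
proof (rule hilbert_function_eq_dim[OF finite_add_index[OF assms(1)]])
  fix F assume F: "F \<in> forms (add_index I) m"
  have "add_coord 1 x \<in> projective_closure I X" if "x \<in> X" for x
    using that assms(2)
    by (auto simp: projective_closure_def affine_space_def add_index_def add_coord_def fun_eq_iff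
        split: option.splits)
  then show "(\<forall>y\<in>projective_closure I X. cpoly_eval y F = 0) \<longleftrightarrow>
      (\<forall>x\<in>X. cpoly_eval (add_coord 1 x) F = 0)"
    using F by (auto simp: projective_closure_def)
qed

lemma restricted_polys_span:
  assumes "finite I"
  shows "\<exists>S. finite S \<and> restricted_polys I X m = cfun.span S"
proof -
  let ?E = "\<lambda>F x. if x \<in> X then cpoly_eval (add_coord 1 x) F else 0"
  have "restricted_polys I X m = cfun.span (?E ` (\<lambda>a. Poly_Mapping.single a 1) ` monomials (add_index I) m)"
    unfolding restricted_polys_eq_forms forms_eq_span
    by (simp only: cpoly_cfun.linear_span_image[OF linear_restricted_eval])
  moreover have "finite (?E ` (\<lambda>a. Poly_Mapping.single a 1) ` monomials (add_index I) m)"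
    by (intro finite_imageI finite_monomials finite_add_index assms)
  ultimately show ?thesis by (intro exI conjI)
qed

lemma linear_cfun_restrict:
  "Vector_Spaces.linear (\<lambda>(c::complex) f x. c * f x) (\<lambda>(c::complex) f x. c * f x)
    (\<lambda>f x. if x \<in> X then f (g x) else (0::complex))"
  by (simp add: Vector_Spaces.linear_iff cfun.vector_space_axioms fun_eq_iff)

text \<open>Pulling back along \<open>M\<close> maps onto a space containing all restricted
  polynomials on \<open>X\<close>, because \<open>L\<close> undoes \<open>M\<close>; affine
  linearity of \<open>L\<close> preserves the degree bound.\<close>

lemma dim_restricted_polys_le:
  assumes "finite K" and M: "\<And>j. j \<in> K \<Longrightarrow> poly_fun_deg I 1 (\<lambda>x. M x j)"
    "\<And>x. x \<in> X \<Longrightarrow> M x \<in> Y" and L: "\<And>i. i \<in> I \<Longrightarrow> poly_fun_deg K 1 (\<lambda>y. L y i)"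
    "\<And>x. x \<in> X \<Longrightarrow> L (M x) = x"
  shows "cfun.dim (restricted_polys I X m) \<le> cfun.dim (restricted_polys K Y m)"
proof -
  let ?T = "\<lambda>f x. if x \<in> X then f (M x) else 0"
  obtain S where S: "finite S" "restricted_polys K Y m = cfun.span S"
    using restricted_polys_span[OF assms(1)] by blast
  have "restricted_polys I X m \<subseteq> ?T ` restricted_polys K Y m"
  proof
    fix f assume "f \<in> restricted_polys I X m"
    then obtain P where P: "poly_fun_deg I m P" "f = (\<lambda>x. if x \<in> X then P x else 0)"
      unfolding restricted_polys_def by blast
    have "poly_fun_deg K m (\<lambda>y. P (L y))" by (rule poly_fun_deg_compose_linear[OF P(1) L(1)])
    then have "(\<lambda>y. if y \<in> Y then P (L y) else 0) \<in> restricted_polys K Y m"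
      unfolding restricted_polys_def by (intro image_eqI[OF refl]) simp
    moreover have "f = ?T (\<lambda>y. if y \<in> Y then P (L y) else 0)"
      unfolding P(2) by (rule ext) (simp add: M(2) L(2))
    ultimately show "f \<in> ?T ` restricted_polys K Y m"
      by (intro image_eqI[where x = "\<lambda>y. if y \<in> Y then P (L y) else 0"])
  qed
  moreover have "?T ` restricted_polys K Y m = cfun.span (?T ` S)"
    unfolding S(2) by (rule cfun_pair.linear_span_image[OF linear_cfun_restrict, symmetric])
  ultimately have "cfun.dim (restricted_polys I X m) \<le> cfun.dim (?T ` restricted_polys K Y m)"
    by (intro cfun.dim_mono_finite[of _ _ "?T ` S"]) (use S in auto)
  also have "\<dots> \<le> cfun.dim (restricted_polys K Y m)"
    unfolding S(2)
    by (rule cfun_dim_linear_image_le[OF linear_cfun_restrict cfun.subspace_span order.refl S(1)])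
  finally show ?thesis .
qed

text \<open>A filtration by functions vanishing on the first \<open>c\<close> pieces, with rank and
  nullity applied to each successive restriction.\<close>

lemma dim_eq_sum_restrictions:
  fixes X :: "nat \<Rightarrow> 'a set"
  assumes "finite S"
  shows "cfun.dim (cfun.span S) =
    (\<Sum>c<p. cfun.dim ((\<lambda>f x. if x \<in> X c then f x else 0) ` {f \<in> cfun.span S. \<forall>b<c. \<forall>x\<in>X b. f x = 0}))
      + cfun.dim {f \<in> cfun.span S. \<forall>b<p. \<forall>x\<in>X b. f x = 0}"
proof (induction p)
  case (Suc p)
  let ?W = "\<lambda>c. {f \<in> cfun.span S. \<forall>b<c. \<forall>x\<in>X b. f x = 0}"
  let ?T = "\<lambda>f x. if x \<in> X p then f x else 0"
  have "cfun.subspace (?W p)"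
    using cfun.subspace_span[of S] by (auto simp: cfun.subspace_def)
  then have "cfun.dim (?W p) = cfun.dim {f \<in> ?W p. ?T f = 0} + cfun.dim (?T ` ?W p)"
    by (intro cfun_pair.dim_kernel_image[OF linear_cfun_restrict[of _ "\<lambda>x. x"] _ _ assms]) auto
  moreover have "{f \<in> ?W p. ?T f = 0} = ?W (Suc p)"
    by (auto simp: less_Suc_eq fun_eq_iff)
  ultimately show ?case using Suc.IH by simp
qed simp

text \<open>In the filtration by vanishing on earlier copies, each graded piece consists of
  polynomial functions of degree at most \<open>m\<close> on one copy. Conversely, multiplying by
  \<open>e c\<close> extends any such function by zero to the other copies and raises the degree by
  at most \<open>D\<close>.\<close>

lemma affine_degree_linear_copies:
  assumes "finite I" "finite K" "O' \<subseteq> affine_space K" "O' \<noteq> {}" "0 < p"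
    and X: "X \<subseteq> affine_space I" "X = (\<Union>c<p. X' c)"
    and e: "\<And>c. c < p \<Longrightarrow> poly_fun I (e c)"
      "\<And>c b x. c < p \<Longrightarrow> b < p \<Longrightarrow> x \<in> X' b \<Longrightarrow> e c x = (if b = c then 1 else 0)"
    and L: "\<And>c i. c < p \<Longrightarrow> i \<in> I \<Longrightarrow> poly_fun_deg K 1 (\<lambda>y. L c y i)"
      "\<And>c y. c < p \<Longrightarrow> y \<in> O' \<Longrightarrow> L c y \<in> X' c"
    and M: "\<And>c j. c < p \<Longrightarrow> j \<in> K \<Longrightarrow> poly_fun_deg I 1 (\<lambda>x. M c x j)"
      "\<And>c x. c < p \<Longrightarrow> x \<in> X' c \<Longrightarrow> M c x \<in> O'"
    and LM: "\<And>c x. c < p \<Longrightarrow> x \<in> X' c \<Longrightarrow> L c (M c x) = x"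
      "\<And>c y. c < p \<Longrightarrow> y \<in> O' \<Longrightarrow> M c (L c y) = y"
  shows "affine_degree I X = p * affine_degree K O'"
proof -
  have "\<forall>c\<in>{..<p}. \<exists>d. poly_fun_deg I d (e c)" using e(1) by (simp add: poly_fun_def)
  then obtain d where d: "\<forall>c\<in>{..<p}. poly_fun_deg I (d c) (e c)" by (rule bchoice[THEN exE])
  define D where "D = Max (d ` {..<p})"
  have eD: "poly_fun_deg I D (e c)" if "c < p" for c
    by (rule poly_fun_deg.raise[of _ "d c"]) (use d that in \<open>simp_all add: D_def\<close>)
  define h where "h m = cfun.dim (restricted_polys K O' m)" for m
  have hX: "cfun.dim (restricted_polys I (X' c) m) = h m" if "c < p" for c m
  proof (rule antisym)
    show "cfun.dim (restricted_polys I (X' c) m) \<le> h m"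
      unfolding h_def
      by (rule dim_restricted_polys_le[OF assms(2), where M = "M c" and L = "L c"])
        (use that L M LM in auto)
    show "h m \<le> cfun.dim (restricted_polys I (X' c) m)"
      unfolding h_def
      by (rule dim_restricted_polys_le[OF assms(1), where M = "L c" and L = "M c"])
        (use that L M LM in auto)
  qed
  have H: "hilbert_function (add_index I) (projective_closure I X) m = cfun.dim (restricted_polys I X m)" for m
    by (rule hilbert_function_projective_closure[OF assms(1) X(1)])
  have h: "hilbert_function (add_index K) (projective_closure K O') m = h m" for m
    unfolding h_def by (rule hilbert_function_projective_closure[OF assms(2,3)])
  let ?T = "\<lambda>c f x. if x \<in> X' c then f x else 0"
  have split: "cfun.dim (restricted_polys I X m) =
    (\<Sum>c<p. cfun.dim (?T c ` {f \<in> restricted_polys I X m. \<forall>b<c. \<forall>x\<in>X' b. f x = 0}))" for m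
  proof -
    obtain S where S: "finite S" "restricted_polys I X m = cfun.span S"
      using restricted_polys_span[OF assms(1)] by blast
    have "f x = 0" if "f \<in> restricted_polys I X m" "\<forall>b<p. \<forall>x\<in>X' b. f x = 0" for f x
    proof (cases "x \<in> X")
      case True
      then show ?thesis using that(2) X(2) by blast
    next
      case False
      then show ?thesis using that(1) by (auto simp: restricted_polys_def)
    qed
    then have "{f \<in> restricted_polys I X m. \<forall>b<p. \<forall>x\<in>X' b. f x = 0} \<subseteq> {0}"
      by (auto simp: fun_eq_iff)
    then have "cfun.dim {f \<in> restricted_polys I X m. \<forall>b<p. \<forall>x\<in>X' b. f x = 0} \<le> card ({} :: (('a \<Rightarrow> complex) \<Rightarrow> complex) set)"
      by (intro cfun.dim_le_card) auto
    then show ?thesis using dim_eq_sum_restrictions[OF S(1), of X' p] unfolding S(2) by simp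
  qed
  have sub: "?T c ` {f \<in> restricted_polys I X m. \<forall>b<c. \<forall>x\<in>X' b. f x = 0} \<subseteq> restricted_polys I (X' c) m"
    if "c < p" for c m
  proof clarify
    fix f assume "f \<in> restricted_polys I X m"
    then obtain P where P: "poly_fun_deg I m P" "f = (\<lambda>x. if x \<in> X then P x else 0)"
      unfolding restricted_polys_def by blast
    then have "?T c f = (\<lambda>x. if x \<in> X' c then P x else 0)"
      using that X(2) by (auto simp: fun_eq_iff)
    then show "?T c f \<in> restricted_polys I (X' c) m"
      unfolding restricted_polys_def using P(1) by (intro image_eqI) simp_all
  qed
  have upper: "cfun.dim (restricted_polys I X m) \<le> p * h m" for m
  proof -
    have "cfun.dim (?T c ` {f \<in> restricted_polys I X m. \<forall>b<c. \<forall>x\<in>X' b. f x = 0}) \<le> h m"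
      if c: "c < p" for c
    proof -
      obtain S where "finite S" "restricted_polys I (X' c) m = cfun.span S"
        using restricted_polys_span[OF assms(1)] by blast
      then show ?thesis
        unfolding hX[OF c, symmetric] by (intro cfun.dim_mono_finite[OF sub[OF c, of m], of S]) auto
    qed
    then have "cfun.dim (restricted_polys I X m) \<le> (\<Sum>c<p. h m)" unfolding split by (intro sum_mono) simp
    then show ?thesis by simp
  qed
  have lower: "p * h m \<le> cfun.dim (restricted_polys I X (m + D))" for m
  proof -
    have "h m \<le> cfun.dim (?T c ` {f \<in> restricted_polys I X (m + D). \<forall>b<c. \<forall>x\<in>X' b. f x = 0})"
      if c: "c < p" for c
    proof -
      have "restricted_polys I (X' c) m \<subseteq>
          ?T c ` {f \<in> restricted_polys I X (m + D). \<forall>b<c. \<forall>x\<in>X' b. f x = 0}"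
      proof
        fix g assume "g \<in> restricted_polys I (X' c) m"
        then obtain P where P: "poly_fun_deg I m P" "g = (\<lambda>x. if x \<in> X' c then P x else 0)"
          unfolding restricted_polys_def by blast
        let ?f = "\<lambda>x. if x \<in> X then P x * e c x else 0"
        have "?f \<in> restricted_polys I X (m + D)"
          unfolding restricted_polys_def
          by (intro image_eqI[OF refl]) (simp add: poly_fun_deg.mult[OF P(1) eD[OF c]])
        moreover have "?f x = 0" if "b < c" "x \<in> X' b" for b x
          using e(2)[OF c, of b x] c that by simp
        moreover have "g = ?T c ?f" unfolding P(2) using c e(2)[OF c c] X(2) by (auto simp: fun_eq_iff)
        ultimately show "g \<in> ?T c ` {f \<in> restricted_polys I X (m + D). \<forall>b<c. \<forall>x\<in>X' b. f x = 0}"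
          by (intro image_eqI[where x = ?f]) simp_all
      qed
      moreover obtain S where "finite S" "restricted_polys I (X' c) (m + D) = cfun.span S"
        using restricted_polys_span[OF assms(1)] by blast
      ultimately show ?thesis
        unfolding hX[OF c, symmetric]
        using sub[OF c, of "m + D"] by (intro cfun.dim_mono_finite[of _ _ S]) auto
    qed
    then have "(\<Sum>c<p. h m) \<le> cfun.dim (restricted_polys I X (m + D))" unfolding split by (intro sum_mono) simp
    then show ?thesis by simp
  qed
  have pos: "0 < h m" for m
  proof -
    obtain S where S: "finite S" "restricted_polys K O' m = cfun.span S"
      using restricted_polys_span[OF assms(2)] by blast
    let ?f = "\<lambda>x. if x \<in> O' then 1 else 0 :: complex"
    have "?f \<in> restricted_polys K O' m"
      unfolding restricted_polys_def by (intro image_eqI[OF refl]) simp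
    moreover have "?f \<noteq> 0" using assms(4) by (auto simp: fun_eq_iff)
    moreover from this have "cfun.dim {?f} = 1"
      using cfun.dim_eq_card_independent[of "{?f}"] cfun.independent_insertI[of ?f "{}"] by simp
    ultimately have "1 \<le> h m"
      unfolding h_def using cfun.dim_mono_finite[of "{?f}" "restricted_polys K O' m" S] S by simp
    then show ?thesis by simp
  qed
  show ?thesis
    unfolding affine_degree_def
    by (rule projective_degree_sandwich[where D = D])
      (simp_all add: finite_add_index assms(1,2,5) H h upper lower pos)
qed

section \<open>Gram coordinates and reflections\<close>

definition gram :: "nat \<Rightarrow> (nat \<times> 'b \<Rightarrow> complex) \<Rightarrow> 'b \<Rightarrow> 'b \<Rightarrow> complex" where
  "gram k y a b = (\<Sum>i<k. y (i, a) * y (i, b))"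

text \<open>The coefficient of \<open>c\<close> in the sum of squares, factored through the Gram
  coordinates so that its invariance is that of \<open>gram\<close>.\<close>

definition sq_coeff :: "nat \<Rightarrow> nat \<Rightarrow> nat \<Rightarrow> (nat \<times> (nat \<Rightarrow>\<^sub>0 nat) \<Rightarrow> complex) \<Rightarrow> (nat \<Rightarrow>\<^sub>0 nat) \<Rightarrow> complex" where
  "sq_coeff n d k y c =
     (\<Sum>a\<in>monomials {..n} d. \<Sum>b\<in>monomials {..n} d. if a + b = c then gram k y a b else 0)"

text \<open>The reflection along \<open>v\<close> for the standard bilinear form, applied to every
  column. For isotropic \<open>v\<close> the quotient is 0 by convention and the map is the
  identity.\<close>

definition reflect :: "nat \<Rightarrow> (nat \<Rightarrow> complex) \<Rightarrow> (nat \<times> 'b \<Rightarrow> complex) \<Rightarrow> nat \<times> 'b \<Rightarrow> complex" where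
  "reflect k v y = (\<lambda>(i, a). y (i, a) - v i * (2 / (\<Sum>l<k. v l ^ 2)) * (\<Sum>l<k. v l * y (l, a)))"

lemma gram_reflect:
  assumes "(\<Sum>l<k. v l ^ 2) \<noteq> 0"
  shows "gram k (reflect k v y) a b = gram k y a b"
proof -
  define N where "N = (\<Sum>l<k. v l ^ 2)"
  define r where "r = 2 / N"
  define \<alpha> \<beta> where "\<alpha> = (\<Sum>l<k. v l * y (l, a))" and "\<beta> = (\<Sum>l<k. v l * y (l, b))"
  have "gram k (reflect k v y) a b = (\<Sum>i<k. (y (i, a) - v i * r * \<alpha>) * (y (i, b) - v i * r * \<beta>))"
    by (simp add: gram_def reflect_def N_def r_def \<alpha>_def \<beta>_def)
  also have "\<dots> = (\<Sum>i<k. y (i, a) * y (i, b) - (r * \<beta>) * (v i * y (i, a)) - (r * \<alpha>) * (v i * y (i, b))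
      + (r * r * \<alpha> * \<beta>) * (v i ^ 2))"
    by (rule sum.cong) (simp_all add: algebra_simps power2_eq_square)
  also have "\<dots> = gram k y a b - (r * \<beta>) * \<alpha> - (r * \<alpha>) * \<beta> + (r * r * \<alpha> * \<beta>) * N"
    unfolding gram_def N_def \<alpha>_def \<beta>_def by (simp only: sum.distrib sum_subtractf sum_distrib_left)
  also have "r * r * \<alpha> * \<beta> * N = 2 * (r * \<alpha> * \<beta>)"
    using assms by (simp add: r_def N_def)
  finally show ?thesis by (simp add: algebra_simps)
qed

lemma sq_coeff_reflect:
  assumes "(\<Sum>l<k. v l ^ 2) \<noteq> 0"
  shows "sq_coeff n d k (reflect k v y) = sq_coeff n d k y"
  by (rule ext) (simp only: sq_coeff_def gram_reflect[OF assms])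

section \<open>Tuples of forms as points of affine space\<close>

lemma finite_tuple_index: "finite (tuple_index n d k)"
  by (simp add: tuple_index_def finite_monomials)

lemma poly_fun_gram:
  assumes "a \<in> monomials {..n} d" "b \<in> monomials {..n} d"
  shows "poly_fun (tuple_index n d k) (\<lambda>y. gram k y a b)"
  unfolding gram_def using assms
  by (intro poly_fun_sum poly_fun_mult poly_fun_var) (simp_all add: tuple_index_def)

lemma poly_fun_sq_coeff: "poly_fun (tuple_index n d k) (\<lambda>y. sq_coeff n d k y c)"
  unfolding sq_coeff_def
proof (intro poly_fun_sum)
  fix a b assume "a \<in> monomials {..n} d" "b \<in> monomials {..n} d"
  then show "poly_fun (tuple_index n d k) (\<lambda>y. if a + b = c then gram k y a b else 0)"
    by (cases "a + b = c") (simp_all add: poly_fun_gram)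
qed

lemma sq_coeff_support:
  assumes "c \<notin> monomials {..n} (2 * d)" shows "sq_coeff n d k y c = 0"
  unfolding sq_coeff_def
proof (intro sum.neutral ballI)
  fix a b assume "a \<in> monomials {..n} d" "b \<in> monomials {..n} d"
  then have "a + b \<in> monomials {..n} (2 * d)" using monomials_add[of a _ d b d] by (simp add: mult_2)
  then show "(if a + b = c then gram k y a b else 0) = 0" using assms by auto
qed

lemma lookup_square:
  assumes "F \<in> Sym n d"
  shows "Poly_Mapping.lookup (F ^ 2) c = (\<Sum>a\<in>monomials {..n} d. \<Sum>b\<in>monomials {..n} d.
    if a + b = c then Poly_Mapping.lookup F a * Poly_Mapping.lookup F b else 0)"
proof -
  let ?M = "monomials {..n} d"
  let ?s = "\<lambda>a. Poly_Mapping.single a (Poly_Mapping.lookup F a)"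
  have "F = (\<Sum>a\<in>?M. ?s a)"
  proof (rule poly_mapping_eqI)
    fix a
    have "Poly_Mapping.lookup F a = (if a \<in> ?M then Poly_Mapping.lookup F a else 0)"
      using assms by (auto simp: Sym_def forms_iff_lookup)
    then show "Poly_Mapping.lookup F a = Poly_Mapping.lookup (\<Sum>a\<in>?M. ?s a) a"
      by (simp add: lookup_sum lookup_single when_def finite_monomials)
  qed
  then have "F ^ 2 = (\<Sum>a\<in>?M. \<Sum>b\<in>?M. ?s a * ?s b)"
    by (simp add: power2_eq_square flip: sum_product)
  then show ?thesis by (simp add: lookup_sum mult_single lookup_single when_def)
qed

lemma lookup_sum_squares:
  assumes "\<And>i. i < k \<Longrightarrow> F i \<in> Sym n d"
  shows "Poly_Mapping.lookup (\<Sum>i<k. F i ^ 2) = sq_coeff n d k (tuple_coords k F)"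
proof
  fix c
  let ?M = "monomials {..n} d"
  have "Poly_Mapping.lookup (\<Sum>i<k. F i ^ 2) c = (\<Sum>i<k. \<Sum>a\<in>?M. \<Sum>b\<in>?M.
      if a + b = c then Poly_Mapping.lookup (F i) a * Poly_Mapping.lookup (F i) b else 0)"
    unfolding lookup_sum by (intro sum.cong refl lookup_square assms) simp
  also have "\<dots> = (\<Sum>a\<in>?M. \<Sum>b\<in>?M. \<Sum>i<k.
      if a + b = c then Poly_Mapping.lookup (F i) a * Poly_Mapping.lookup (F i) b else 0)"
    by (subst sum.swap) (intro sum.cong refl sum.swap)
  also have "\<dots> = sq_coeff n d k (tuple_coords k F) c"
    unfolding sq_coeff_def gram_def
    by (intro sum.cong refl) (auto simp: tuple_coords_def)
  finally show "Poly_Mapping.lookup (\<Sum>i<k. F i ^ 2) c = sq_coeff n d k (tuple_coords k F) c" .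
qed

lemma exists_tuple:
  fixes y :: "nat \<times> (nat \<Rightarrow>\<^sub>0 nat) \<Rightarrow> complex"
  assumes "y \<in> affine_space (tuple_index n d k)"
  shows "\<exists>F\<in>{..<k} \<rightarrow>\<^sub>E Sym n d. tuple_coords k F = y"
proof -
  define F where
    "F = (\<lambda>i\<in>{..<k}. \<Sum>a\<in>monomials {..n} d. Poly_Mapping.single a (y (i, a)))"
  have F: "Poly_Mapping.lookup (F i) a = (if a \<in> monomials {..n} d then y (i, a) else 0)"
    if "i < k" for i a
    using that by (simp add: F_def lookup_sum lookup_single when_def finite_monomials)
  have "F \<in> {..<k} \<rightarrow>\<^sub>E Sym n d"
  proof (rule PiE_I)
    fix i assume "i \<in> {..<k}"
    then show "F i \<in> Sym n d" by (simp add: Sym_def forms_iff_lookup F)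
  qed (simp add: F_def)
  moreover have "tuple_coords k F = y"
    using assms by (auto simp: tuple_coords_def F fun_eq_iff affine_space_def tuple_index_def)
  ultimately show ?thesis by blast
qed

lemma tuple_coords_affine:
  assumes "\<And>i. i < k \<Longrightarrow> F i \<in> Sym n d"
  shows "tuple_coords k F \<in> affine_space (tuple_index n d k)"
  using assms by (auto simp: affine_space_def tuple_coords_def tuple_index_def Sym_def forms_iff_lookup)

lemma SOS_fiber_eq:
  "SOS_fiber n d k f = {y \<in> affine_space (tuple_index n d k). sq_coeff n d k y = Poly_Mapping.lookup f}"
proof (intro equalityI subsetI)
  fix y assume "y \<in> SOS_fiber n d k f"
  then obtain F where F: "F \<in> {..<k} \<rightarrow>\<^sub>E Sym n d" "(\<Sum>i<k. F i ^ 2) = f" "y = tuple_coords k F"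
    by (auto simp: SOS_fiber_def SOS_tuples_def)
  then have "\<And>i. i < k \<Longrightarrow> F i \<in> Sym n d" by auto
  then show "y \<in> {y \<in> affine_space (tuple_index n d k). sq_coeff n d k y = Poly_Mapping.lookup f}"
    using F lookup_sum_squares[of k F n d] tuple_coords_affine[of k F n d] by simp
next
  fix y assume y: "y \<in> {y \<in> affine_space (tuple_index n d k). sq_coeff n d k y = Poly_Mapping.lookup f}"
  then obtain F where F: "F \<in> {..<k} \<rightarrow>\<^sub>E Sym n d" "tuple_coords k F = y"
    using exists_tuple[of y n d k] by blast
  then have "\<And>i. i < k \<Longrightarrow> F i \<in> Sym n d" by auto
  then have "Poly_Mapping.lookup (\<Sum>i<k. F i ^ 2) = Poly_Mapping.lookup f"
    using F(2) y lookup_sum_squares[of k F n d] by simp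
  then have "(\<Sum>i<k. F i ^ 2) = f" by (simp only: lookup_inject)
  then show "y \<in> SOS_fiber n d k f"
    using F unfolding SOS_fiber_def SOS_tuples_def by blast
qed

section \<open>The Zariski topology on sums of squares\<close>

lemma openin_Sym_zariski:
  "openin (Sym_zariski n m) U \<longleftrightarrow>
    (\<exists>P\<subseteq>cpolys (monomials {..n} m). U = {f \<in> Sym n m. \<exists>g\<in>P. cpoly_eval (Poly_Mapping.lookup f) g \<noteq> 0})"
proof -
  have "Poly_Mapping.lookup f \<in> affine_space (monomials {..n} m)" if "f \<in> Sym n m" for f :: "nat cpoly"
    using that by (simp add: Sym_def forms_iff_lookup affine_space_def)
  then have eq: "Poly_Mapping.lookup -` (affine_space (monomials {..n} m) - zero_locus (monomials {..n} m) P) \<inter> Sym n m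
      = {f \<in> Sym n m. \<exists>g\<in>P. cpoly_eval (Poly_Mapping.lookup f) g \<noteq> 0}" for P
    by (auto simp: zero_locus_def)
  show ?thesis
    unfolding Sym_zariski_def openin_pullback_topology openin_zariski eq[symmetric] by blast
qed

lemma topspace_Sym_zariski: "topspace (Sym_zariski n m) = Sym n m"
  unfolding Sym_zariski_def topspace_pullback_topology
  by (auto simp: Sym_def forms_iff_lookup affine_space_def)

lemma openin_nonzero_set:
  assumes "poly_fun (monomials {..n} m) P"
  shows "openin (Sym_zariski n m) {f \<in> Sym n m. P (Poly_Mapping.lookup f) \<noteq> 0}"
proof -
  obtain g where "g \<in> cpolys (monomials {..n} m)" "\<forall>x. P x = cpoly_eval x g"
    using assms unfolding poly_fun_iff_cpoly by blast
  then show ?thesis unfolding openin_Sym_zariski by (intro exI[of _ "{g}"]) simp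
qed

definition sums_of_squares :: "nat \<Rightarrow> nat \<Rightarrow> nat \<Rightarrow> nat cpoly set" where
  "sums_of_squares n d k = {\<Sum>i<k. f i ^ 2 | f. \<forall>i<k. f i \<in> Sym n d}"

lemma sums_of_squares_subset: "sums_of_squares n d k \<subseteq> Sym n (2 * d)"
proof
  fix f assume "f \<in> sums_of_squares n d k"
  then obtain F where "f = (\<Sum>i<k. F i ^ 2)" "\<forall>i<k. F i \<in> Sym n d"
    unfolding sums_of_squares_def by blast
  then show "f \<in> Sym n (2 * d)"
    using lookup_sum_squares[of k F n d] by (simp add: Sym_def forms_iff_lookup sq_coeff_support)
qed

lemma sums_of_squares_lookup:
  assumes "f \<in> sums_of_squares n d k"
  shows "\<exists>y. Poly_Mapping.lookup f = sq_coeff n d k y"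
proof -
  obtain F where "f = (\<Sum>i<k. F i ^ 2)" "\<forall>i<k. F i \<in> Sym n d"
    using assms unfolding sums_of_squares_def by blast
  then show ?thesis using lookup_sum_squares[of k F n d] by blast
qed

lemma exists_sum_of_squares: "\<exists>f\<in>sums_of_squares n d k. Poly_Mapping.lookup f = sq_coeff n d k y"
proof -
  define z where "z \<tau> = (if \<tau> \<in> tuple_index n d k then y \<tau> else 0)" for \<tau>
  obtain F where F: "F \<in> {..<k} \<rightarrow>\<^sub>E Sym n d" "tuple_coords k F = z"
    using exists_tuple[of z n d k] by (auto simp: affine_space_def z_def)
  then have S: "\<And>i. i < k \<Longrightarrow> F i \<in> Sym n d" by auto
  have "Poly_Mapping.lookup (\<Sum>i<k. F i ^ 2) = sq_coeff n d k z"
    using lookup_sum_squares[of k F n d] S F(2) by simp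
  also have "\<dots> = sq_coeff n d k y"
  proof
    show "sq_coeff n d k z c = sq_coeff n d k y c" for c
      by (rule poly_fun_cong[OF poly_fun_sq_coeff]) (simp add: z_def)
  qed
  finally have "Poly_Mapping.lookup (\<Sum>i<k. F i ^ 2) = sq_coeff n d k y" .
  moreover have "(\<Sum>i<k. F i ^ 2) \<in> sums_of_squares n d k"
    unfolding sums_of_squares_def using S by blast
  ultimately show ?thesis by blast
qed

lemma SOS_eq: "SOS n d k = Abstract_Topology.closure_of (Sym_zariski n (2 * d)) (sums_of_squares n d k)"
  by (simp add: SOS_def sums_of_squares_def)

text \<open>A polynomial that does not vanish at \<open>f\<close> defines a neighbourhood of
  \<open>f\<close>, and this must meet the sums of squares.\<close>

lemma SOS_zero:
  assumes "f \<in> SOS n d k" "poly_fun (monomials {..n} (2 * d)) P" "\<And>y. P (sq_coeff n d k y) = 0"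
  shows "P (Poly_Mapping.lookup f) = 0"
proof (rule ccontr)
  assume "P (Poly_Mapping.lookup f) \<noteq> 0"
  then have "f \<in> {f \<in> Sym n (2 * d). P (Poly_Mapping.lookup f) \<noteq> 0}"
    using assms(1) by (simp add: SOS_eq in_closure_of topspace_Sym_zariski)
  from assms(1)[unfolded SOS_eq in_closure_of, THEN conjunct2, THEN spec, THEN mp,
      OF conjI[OF this openin_nonzero_set[OF assms(2)]]]
  obtain g where g: "g \<in> sums_of_squares n d k" "P (Poly_Mapping.lookup g) \<noteq> 0" by auto
  obtain y where "Poly_Mapping.lookup g = sq_coeff n d k y"
    using sums_of_squares_lookup[OF g(1)] by (elim exE) (rule that)
  with g(2) have "P (sq_coeff n d k y) \<noteq> 0" by simp
  then show False using assms(3)[of y] by simp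
qed

text \<open>Density of a nonempty principal open set. A neighbourhood of a point of
  \<open>SOS\<close> comes with a polynomial \<open>g\<close> that is nonzero at some sum of
  squares; \<open>b\<close> and \<open>g\<close> pull back to polynomials on the irreducible space
  of tuples, so both are nonzero at a common sum of squares.\<close>

lemma for_general_SOS:
  assumes b: "poly_fun (monomials {..n} (2 * d)) b" "b (sq_coeff n d k y0) \<noteq> 0"
    and Q: "\<And>f. f \<in> SOS n d k \<Longrightarrow> b (Poly_Mapping.lookup f) \<noteq> 0 \<Longrightarrow> Q f"
  shows "for_general (SOS_topology n d k) Q"
proof -
  let ?X = "Sym_zariski n (2 * d)"
  define U where "U = {f \<in> SOS n d k. b (Poly_Mapping.lookup f) \<noteq> 0}"
  have SOS: "SOS n d k \<subseteq> Sym n (2 * d)"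
    unfolding SOS_eq using closure_of_subset_topspace[of ?X] by (simp add: topspace_Sym_zariski)
  have dense: "sums_of_squares n d k \<subseteq> SOS n d k"
    unfolding SOS_eq by (rule closure_of_subset) (simp add: topspace_Sym_zariski sums_of_squares_subset)
  have top: "topspace (SOS_topology n d k) = SOS n d k"
    using SOS by (auto simp: SOS_topology_def topspace_Sym_zariski)
  have "U = SOS n d k \<inter> {f \<in> Sym n (2 * d). b (Poly_Mapping.lookup f) \<noteq> 0}"
    using SOS by (auto simp: U_def)
  then have "openin (SOS_topology n d k) U"
    unfolding SOS_topology_def by (simp only: openin_subtopology_Int2 openin_nonzero_set[OF b(1)])
  moreover have "Abstract_Topology.closure_of (SOS_topology n d k) U = topspace (SOS_topology n d k)"
  proof (intro equalityI closure_of_subset_topspace subsetI)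
    fix f assume f: "f \<in> topspace (SOS_topology n d k)"
    show "f \<in> Abstract_Topology.closure_of (SOS_topology n d k) U"
      unfolding in_closure_of
    proof (intro conjI allI impI f, elim conjE)
      fix V assume "f \<in> V" "openin (SOS_topology n d k) V"
      then obtain W where W: "openin ?X W" "V = W \<inter> SOS n d k"
        unfolding SOS_topology_def openin_subtopology by blast
      then obtain P where P: "P \<subseteq> cpolys (monomials {..n} (2 * d))"
        "W = {f \<in> Sym n (2 * d). \<exists>g\<in>P. cpoly_eval (Poly_Mapping.lookup f) g \<noteq> 0}"
        unfolding openin_Sym_zariski by blast
      then obtain g where g: "g \<in> P" "cpoly_eval (Poly_Mapping.lookup f) g \<noteq> 0"
        using \<open>f \<in> V\<close> W(2) by blast
      have pg: "poly_fun (monomials {..n} (2 * d)) (\<lambda>x. cpoly_eval x g)"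
        using P(1) g(1) by (intro poly_fun_eval) blast
      have "f \<in> SOS n d k" using f top by simp
      then obtain y1 where y1: "cpoly_eval (sq_coeff n d k y1) g \<noteq> 0"
        using SOS_zero[OF _ pg] g(2) by auto
      obtain y where y: "b (sq_coeff n d k y) \<noteq> 0" "cpoly_eval (sq_coeff n d k y) g \<noteq> 0"
        using poly_fun_no_zero_divisors[of _ "\<lambda>y. b (sq_coeff n d k y)"
            "\<lambda>y. cpoly_eval (sq_coeff n d k y) g", OF poly_fun_compose[OF b(1) poly_fun_sq_coeff]
            poly_fun_compose[OF pg poly_fun_sq_coeff] b(2) y1]
        by (elim exE conjE) (rule that)
      obtain h where "h \<in> sums_of_squares n d k" "Poly_Mapping.lookup h = sq_coeff n d k y"
        using exists_sum_of_squares by blast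
      then have "h \<in> V \<inter> U"
        using y g(1) dense SOS unfolding W(2) P(2) U_def by auto
      then show "\<exists>y. y \<in> U \<and> y \<in> V" by blast
    qed
  qed
  ultimately show ?thesis unfolding for_general_def using Q U_def by blast
qed

section \<open>A slice for the orthogonal group\<close>

locale sos =
  fixes n d k :: nat
  assumes d: "1 \<le> d" and k: "1 \<le> k" "k \<le> n"
begin

abbreviation "Mon \<equiv> monomials {..n} d"
abbreviation "Mon2 \<equiv> monomials {..n} (2 * d)"
abbreviation "T \<equiv> tuple_index n d k"
abbreviation "sq \<equiv> sq_coeff n d k"

definition xd :: "nat \<Rightarrow> nat \<Rightarrow>\<^sub>0 nat" where
  "xd j = Poly_Mapping.single j d"

text \<open>Upper triangular shape of the block of columns \<open>xd 0, ..., xd (k - 1)\<close>: the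
  entries \<open>(i, xd j)\<close> with \<open>j < i\<close> are removed, as many as the dimension
  of O(k).\<close>

definition slice :: "(nat \<times> (nat \<Rightarrow>\<^sub>0 nat)) set" where
  "slice = {(i, a) \<in> T. \<forall>j<i. a \<noteq> xd j}"

definition onto_slice :: "(nat \<times> (nat \<Rightarrow>\<^sub>0 nat) \<Rightarrow> complex) \<Rightarrow> nat \<times> (nat \<Rightarrow>\<^sub>0 nat) \<Rightarrow> complex" where
  "onto_slice y \<tau> = (if \<tau> \<in> slice then y \<tau> else 0)"

text \<open>Reflections generate O(k), and the reduction to the slice uses only them, so invariance
  is stated for reflections alone.\<close>

definition invariant :: "((nat \<times> (nat \<Rightarrow>\<^sub>0 nat) \<Rightarrow> complex) \<Rightarrow> complex) \<Rightarrow> bool" where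
  "invariant w \<longleftrightarrow> (\<forall>v y. (\<Sum>l<k. v l ^ 2) \<noteq> 0 \<longrightarrow> w (reflect k v y) = w y)"

lemma slice_subset: "slice \<subseteq> T" by (auto simp: slice_def)

lemma finite_slice: "finite slice"
  by (rule finite_subset[OF slice_subset finite_tuple_index])

lemma xd_inj: "xd i = xd j \<Longrightarrow> i = j"
  using d unfolding xd_def
  by (metis lookup_single_eq lookup_single_not_eq not_one_le_zero)

lemma xd_Mon: "j < k \<Longrightarrow> xd j \<in> Mon"
  using k d by (simp add: xd_def monomials_def)

lemma Mon_eq_xd:
  assumes "a \<in> Mon" "d \<le> Poly_Mapping.lookup a i"
  shows "a = xd i"
proof (rule poly_mapping_eqI)
  fix j
  have i: "i \<in> Poly_Mapping.keys a" using assms(2) d by (simp add: in_keys_iff)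
  have "(\<Sum>j\<in>Poly_Mapping.keys a. Poly_Mapping.lookup a j) = d" using assms(1) by (simp add: monomials_def)
  then have *: "Poly_Mapping.lookup a i + (\<Sum>j\<in>Poly_Mapping.keys a - {i}. Poly_Mapping.lookup a j) = d"
    using sum.remove[OF finite_keys i, of "Poly_Mapping.lookup a"] by simp
  then have "(\<Sum>j\<in>Poly_Mapping.keys a - {i}. Poly_Mapping.lookup a j) = 0" using assms(2) by linarith
  then have z: "\<forall>j\<in>Poly_Mapping.keys a - {i}. Poly_Mapping.lookup a j = 0"
    by (simp only: sum_eq_0_iff finite_Diff finite_keys)
  have "Poly_Mapping.lookup a j = 0" if "j \<noteq> i" for j
  proof (cases "j \<in> Poly_Mapping.keys a")
    case True
    then show ?thesis using z that by blast
  qed (simp add: in_keys_iff)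
  then show "Poly_Mapping.lookup a j = Poly_Mapping.lookup (xd i) j"
    using * assms(2) by (auto simp: xd_def lookup_single when_def)
qed

text \<open>A coincidence with \<open>i \<noteq> j\<close> forces \<open>a = xd j\<close> and
  \<open>b = xd i\<close>; then one of the two entries lies strictly below the diagonal and is not
  in the slice.\<close>

lemma slice_leading_inj:
  assumes "(i, a) \<in> slice" "(j, b) \<in> slice" "xd i + a = xd j + b"
  shows "(i, a) = (j, b)"
proof (cases "i = j")
  case False
  have l: "Poly_Mapping.lookup (xd i) m + Poly_Mapping.lookup a m =
      Poly_Mapping.lookup (xd j) m + Poly_Mapping.lookup b m" for m
    using assms(3) by (metis lookup_add)
  have "d \<le> Poly_Mapping.lookup b i" "d \<le> Poly_Mapping.lookup a j"
    using l[of i] l[of j] False by (simp_all add: xd_def lookup_single when_def)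
  moreover have "a \<in> Mon" "b \<in> Mon" using assms by (auto simp: slice_def tuple_index_def)
  ultimately have "b = xd i" "a = xd j" using Mon_eq_xd by simp_all
  then have "\<not> j < i" "\<not> i < j" using assms(1,2) by (auto simp: slice_def)
  then show ?thesis using False by simp
qed (use assms in simp)

lemma poly_fun_onto_slice: "poly_fun slice (\<lambda>y. onto_slice y \<tau>)"
  by (cases "\<tau> \<in> slice") (simp_all add: onto_slice_def poly_fun_var)

lemma poly_fun_sq_slice: "poly_fun slice (\<lambda>y. sq (onto_slice y) c)"
  by (rule poly_fun_compose[OF poly_fun_sq_coeff poly_fun_onto_slice])

lemma invariant_gram: "invariant (\<lambda>y. gram k y a b)"
  by (simp add: invariant_def gram_reflect)

text \<open>A reflection brings one more column into triangular form, unless the lower part of that column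
  is isotropic; the latter is a proper closed condition.\<close>

lemma invariant_vanishes_step:
  assumes w: "poly_fun T w" "invariant w" and r: "r < k"
    and zero: "\<And>y. (\<And>i j. j < Suc r \<Longrightarrow> j < i \<Longrightarrow> i < k \<Longrightarrow> y (i, xd j) = 0) \<Longrightarrow> w y = 0"
    and y: "\<And>i j. j < r \<Longrightarrow> j < i \<Longrightarrow> i < k \<Longrightarrow> y (i, xd j) = 0"
  shows "w y = 0"
proof -
  define \<pi> where "\<pi> y \<tau> = (if \<exists>j<r. j < fst \<tau> \<and> snd \<tau> = xd j then 0 else y \<tau>)"
    for y :: "nat \<times> (nat \<Rightarrow>\<^sub>0 nat) \<Rightarrow> complex" and \<tau>
  define s2 where "s2 y = (\<Sum>i\<in>{r..<k}. y (i, xd r) ^ 2)" for y :: "nat \<times> (nat \<Rightarrow>\<^sub>0 nat) \<Rightarrow> complex"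
  have key: "w (\<pi> y) = 0" if "s2 y \<noteq> 0" for y
  proof -
    define Y where "Y = \<pi> y"
    have Y0: "Y (i, xd j) = 0" if "j < r" "j < i" for i j
      using that by (auto simp: Y_def \<pi>_def)
    have Yr: "Y (i, xd r) = y (i, xd r)" for i
      using xd_inj by (auto simp: Y_def \<pi>_def)
    define s0 where "s0 = csqrt (s2 y)"
    have s0: "s0 ^ 2 = s2 y" "s0 \<noteq> 0" using that by (auto simp: s0_def)
    \<comment> \<open>A square root of \<open>s2 y\<close>, with the sign chosen so that the
      Householder vector \<open>v\<close> is not isotropic: its square norm is
      \<open>2 * (s * (s - Y (r, xd r)))\<close>.\<close>
    define s where "s = (if s0 = Y (r, xd r) then - s0 else s0)"
    have s: "s ^ 2 = s2 y" "s \<noteq> Y (r, xd r)" "s \<noteq> 0" using s0 by (auto simp: s_def)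
    define v where "v i = (if i < r then 0 else Y (i, xd r) - (if i = r then s else 0))" for i
    have sub: "(\<Sum>l<k. v l * g l) = (\<Sum>l\<in>{r..<k}. v l * g l)" for g
      by (rule sum.mono_neutral_right) (auto simp: v_def)
    have vg: "(\<Sum>l<k. v l * g l) = (\<Sum>l\<in>{r..<k}. Y (l, xd r) * g l) - s * g r" for g
    proof -
      have "(\<Sum>l<k. v l * g l) = (\<Sum>l\<in>{r..<k}. Y (l, xd r) * g l - (if l = r then s * g l else 0))"
        unfolding sub by (rule sum.cong) (auto simp: v_def algebra_simps)
      then show ?thesis using r by (simp add: sum_subtractf)
    qed
    have s2Y: "(\<Sum>l\<in>{r..<k}. Y (l, xd r) * Y (l, xd r)) = s ^ 2"
      unfolding s(1) s2_def Yr by (simp add: power2_eq_square)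
    have vY: "(\<Sum>l<k. v l * Y (l, xd r)) = s * (s - Y (r, xd r))"
      unfolding vg s2Y by (simp add: algebra_simps power2_eq_square)
    have vv: "(\<Sum>l<k. v l ^ 2) = 2 * (s * (s - Y (r, xd r)))"
    proof -
      have "(\<Sum>l<k. v l ^ 2) = (\<Sum>l\<in>{r..<k}. Y (l, xd r) * v l) - s * v r"
        using vg[of v] by (simp add: power2_eq_square)
      also have "(\<Sum>l\<in>{r..<k}. Y (l, xd r) * v l) = (\<Sum>l<k. v l * Y (l, xd r))"
        unfolding sub by (simp add: mult.commute)
      finally show ?thesis unfolding vY by (simp add: v_def algebra_simps)
    qed
    have vv0: "(\<Sum>l<k. v l ^ 2) \<noteq> 0" unfolding vv using s by simp
    have "w (reflect k v Y) = 0"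
    proof (rule zero)
      fix i j assume ij: "j < Suc r" "j < i" "i < k"
      show "reflect k v Y (i, xd j) = 0"
      proof (cases "j = r")
        case True
        have "2 / (2 * (s * (s - Y (r, xd r)))) * (s * (s - Y (r, xd r))) = 1"
          using s by simp
        then have "v i * (2 / (2 * (s * (s - Y (r, xd r))))) * (s * (s - Y (r, xd r))) = v i"
          by (metis mult.assoc mult.right_neutral)
        then have "reflect k v Y (i, xd r) = Y (i, xd r) - v i"
          unfolding reflect_def prod.case vv vY by simp
        then show ?thesis using True ij by (simp add: v_def)
      next
        case False
        then have "j < r" using ij by simp
        have "(\<Sum>l<k. v l * Y (l, xd j)) = 0"
          unfolding sub by (rule sum.neutral) (use Y0 \<open>j < r\<close> in auto)
        then show ?thesis using Y0[OF \<open>j < r\<close> ij(2)] by (simp add: reflect_def)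
      qed
    qed
    then show ?thesis using w(2) vv0 unfolding invariant_def Y_def by simp
  qed
  have "poly_fun T s2"
    unfolding s2_def
    by (intro poly_fun_sum poly_fun_power poly_fun_var) (use r xd_Mon in \<open>auto simp: tuple_index_def\<close>)
  moreover have "poly_fun T (\<lambda>y. w (\<pi> y))"
  proof (rule poly_fun_compose[OF w(1)])
    fix \<tau> assume "\<tau> \<in> T"
    then show "poly_fun T (\<lambda>y. \<pi> y \<tau>)"
      by (cases "\<exists>j<r. j < fst \<tau> \<and> snd \<tau> = xd j") (simp_all only: \<pi>_def if_True if_False poly_fun_const poly_fun_var)
  qed
  moreover have "s2 (\<lambda>\<tau>. if \<tau> = (r, xd r) then 1 else 0) \<noteq> 0"
  proof -
    have "s2 (\<lambda>\<tau>. if \<tau> = (r, xd r) then 1 else 0) = (\<Sum>i\<in>{r..<k}. if i = r then 1 else 0)"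
      unfolding s2_def by (rule sum.cong) auto
    then show ?thesis using r by simp
  qed
  ultimately have "w (\<pi> y) = 0"
    using poly_fun_no_zero_divisors[of T s2 "\<lambda>y. w (\<pi> y)" _ y] key by blast
  moreover have "w (\<pi> y) = w y"
    by (rule poly_fun_cong[OF w(1)]) (use y in \<open>auto simp: \<pi>_def tuple_index_def\<close>)
  ultimately show ?thesis by simp
qed

text \<open>The condition of being triangular in the first \<open>r\<close> columns is relaxed from
  \<open>r = k\<close>, where the tuple agrees on \<open>T\<close> with its projection to the slice,
  down to \<open>r = 0\<close>, where it is empty.\<close>

lemma invariant_vanishes:
  assumes w: "poly_fun T w" "invariant w" and slice: "\<And>y. w (onto_slice y) = 0"
  shows "w y = 0"
proof -
  have "w y = 0" if "r \<le> k" "\<And>i j. j < r \<Longrightarrow> j < i \<Longrightarrow> i < k \<Longrightarrow> y (i, xd j) = 0" for r y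
    using that
  proof (induction r arbitrary: y rule: inc_induct)
    case base
    have "w y = w (onto_slice y)"
    proof (rule poly_fun_cong[OF w(1)])
      fix \<tau> assume "\<tau> \<in> T"
      then obtain i a where \<tau>: "\<tau> = (i, a)" "i < k" "a \<in> Mon" by (auto simp: tuple_index_def)
      show "y \<tau> = onto_slice y \<tau>"
      proof (cases "\<tau> \<in> slice")
        case False
        then obtain j where "j < i" "a = xd j" using \<tau> by (auto simp: slice_def tuple_index_def)
        then have "y \<tau> = 0" using base \<tau> by simp
        then show ?thesis using False by (simp add: onto_slice_def)
      qed (simp add: onto_slice_def)
    qed
    then show ?case using slice by simp
  next
    case (step r)
    show ?case
      by (rule invariant_vanishes_step[OF w, of r]) (use step in auto)
  qed
  from this[of 0] show ?thesis by simp
qed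

section \<open>Algebraic independence on the slice\<close>

lemma sq_scale: "sq (\<lambda>\<tau>. t * y \<tau>) c = t\<^sup>2 * sq y c"
proof -
  have "gram k (\<lambda>\<tau>. t * y \<tau>) a b = t\<^sup>2 * gram k y a b" for a b
    by (simp add: gram_def sum_distrib_left power2_eq_square mult_ac)
  then show ?thesis unfolding sq_coeff_def sum_distrib_left by (intro sum.cong refl) simp
qed

definition base_point :: "nat \<times> (nat \<Rightarrow>\<^sub>0 nat) \<Rightarrow> complex" where
  "base_point = (\<lambda>(i, a). if i < k \<and> a = xd i then 1 else 0)"

lemma base_point_slice: "onto_slice base_point = base_point"
proof
  fix \<tau> show "onto_slice base_point \<tau> = base_point \<tau>"
    using xd_Mon xd_inj
    by (cases \<tau>) (auto simp: onto_slice_def base_point_def slice_def tuple_index_def)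
qed

text \<open>The linear part is twice a coefficient of the sum of the products of
  \<open>x_i^d\<close> with the forms given by \<open>v\<close>. As the monomials
  \<open>xd i + a\<close> are distinct on the slice, only the entry \<open>v \<tau>\<close>
  contributes to it.\<close>

lemma sq_base_point_add:
  assumes "\<tau> \<in> slice"
  shows "sq (\<lambda>\<sigma>. base_point \<sigma> + onto_slice v \<sigma>) (xd (fst \<tau>) + snd \<tau>) =
    sq base_point (xd (fst \<tau>) + snd \<tau>) + (2 * v \<tau> + sq (onto_slice v) (xd (fst \<tau>) + snd \<tau>))"
proof -
  define c where "c = xd (fst \<tau>) + snd \<tau>"
  let ?v = "onto_slice v"
  \<comment> \<open>\<open>B\<close> and \<open>B'\<close> are the two halves of the cross term,
    exchanged by swapping \<open>a\<close> and \<open>b\<close>; this is the source of the factor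
    2.\<close>
  define B where "B = (\<Sum>a\<in>Mon. \<Sum>b\<in>Mon. if a + b = c then (\<Sum>i<k. base_point (i, a) * ?v (i, b)) else 0)"
  define B' where "B' = (\<Sum>a\<in>Mon. \<Sum>b\<in>Mon. if a + b = c then (\<Sum>i<k. base_point (i, b) * ?v (i, a)) else 0)"
  have "B' = (\<Sum>b\<in>Mon. \<Sum>a\<in>Mon. if a + b = c then (\<Sum>i<k. base_point (i, b) * ?v (i, a)) else 0)"
    unfolding B'_def by (rule sum.swap)
  then have BB: "B' = B" unfolding B_def by (simp add: add.commute)
  have "gram k (\<lambda>\<sigma>. base_point \<sigma> + ?v \<sigma>) a b = gram k base_point a b +
      (\<Sum>i<k. base_point (i, a) * ?v (i, b)) + (\<Sum>i<k. base_point (i, b) * ?v (i, a)) + gram k ?v a b" for a b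
    by (simp add: gram_def sum.distrib[symmetric] algebra_simps)
  then have "sq (\<lambda>\<sigma>. base_point \<sigma> + ?v \<sigma>) c = (\<Sum>a\<in>Mon. \<Sum>b\<in>Mon.
      (if a + b = c then gram k base_point a b else 0) +
      (if a + b = c then (\<Sum>i<k. base_point (i, a) * ?v (i, b)) else 0) +
      (if a + b = c then (\<Sum>i<k. base_point (i, b) * ?v (i, a)) else 0) +
      (if a + b = c then gram k ?v a b else 0))"
    unfolding sq_coeff_def by (intro sum.cong refl) simp
  also have "\<dots> = sq base_point c + B + B' + sq ?v c"
    by (simp only: sum.distrib sq_coeff_def B_def B'_def)
  also have "B = v \<tau>"
  proof -
    have "B = (\<Sum>a\<in>Mon. \<Sum>b\<in>Mon. \<Sum>i<k. if a = xd i then (if xd i + b = c then ?v (i, b) else 0) else 0)"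
      unfolding B_def
    proof (intro sum.cong refl)
      fix a b
      show "(if a + b = c then (\<Sum>i<k. base_point (i, a) * ?v (i, b)) else 0) =
          (\<Sum>i<k. if a = xd i then (if xd i + b = c then ?v (i, b) else 0) else 0)"
      proof (cases "a + b = c")
        case True
        then show ?thesis by (simp, intro sum.cong) (auto simp: base_point_def)
      next
        case False
        then have "(\<Sum>i<k. if a = xd i then (if xd i + b = c then ?v (i, b) else 0) else 0) = 0"
          by (intro sum.neutral) auto
        then show ?thesis using False by simp
      qed
    qed
    also have "\<dots> = (\<Sum>b\<in>Mon. \<Sum>i<k. \<Sum>a\<in>Mon. if a = xd i then (if xd i + b = c then ?v (i, b) else 0) else 0)"
      by (subst sum.swap) (intro sum.cong refl sum.swap)
    also have "\<dots> = (\<Sum>b\<in>Mon. \<Sum>i<k. if xd i + b = c then ?v (i, b) else 0)"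
      using xd_Mon by (intro sum.cong refl) (simp add: finite_monomials)
    also have "\<dots> = (\<Sum>i<k. \<Sum>b\<in>Mon. if xd i + b = c then ?v (i, b) else 0)" by (rule sum.swap)
    also have "\<dots> = (\<Sum>(i, b)\<in>T. if xd i + b = c then ?v (i, b) else 0)"
      unfolding tuple_index_def by (rule sum.cartesian_product)
    also have "\<dots> = (\<Sum>\<sigma>\<in>T. if \<sigma> = \<tau> then v \<tau> else 0)"
    proof (rule sum.cong[OF refl], clarify)
      fix i b assume "(i, b) \<in> T"
      show "(if xd i + b = c then ?v (i, b) else 0) = (if (i, b) = \<tau> then v \<tau> else 0)"
        using slice_leading_inj[of i b "fst \<tau>" "snd \<tau>"] assms
        by (auto simp: c_def onto_slice_def)
    qed
    also have "\<dots> = v \<tau>" using assms slice_subset by (auto simp: finite_tuple_index)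
    finally show ?thesis .
  qed
  finally show ?thesis unfolding BB c_def[symmetric] \<open>B = v \<tau>\<close> by simp
qed

text \<open>After translation by \<open>C\<close>, the values at the base point, the chosen
  coefficients are \<open>2 * v \<tau>\<close> plus a quadratic form, which is the situation of
  \<open>quadratic_perturbation_independent\<close>.\<close>

lemma leading_coeffs_independent:
  assumes P: "poly_fun slice P"
    and zero: "\<And>y. P (\<lambda>\<tau>. sq (onto_slice y) (xd (fst \<tau>) + snd \<tau>)) = 0"
  shows "P x = 0"
proof -
  define C where "C \<tau> = sq base_point (xd (fst \<tau>) + snd \<tau>)" for \<tau>
  have "poly_fun slice (\<lambda>w. P (\<lambda>\<tau>. C \<tau> + w \<tau>))"
    by (rule poly_fun_compose[OF P]) (simp add: poly_fun_add poly_fun_var)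
  then have "P (\<lambda>\<tau>. C \<tau> + w \<tau>) = 0" for w
  proof (rule quadratic_perturbation_independent[where s = 2 and
        q = "\<lambda>\<tau> v. sq (onto_slice v) (xd (fst \<tau>) + snd \<tau>)"])
    fix \<tau> :: "nat \<times> (nat \<Rightarrow>\<^sub>0 nat)" and t v
    have "onto_slice (\<lambda>j. t * v j) = (\<lambda>j. t * onto_slice v j)" by (auto simp: onto_slice_def)
    then show "sq (onto_slice (\<lambda>j. t * v j)) (xd (fst \<tau>) + snd \<tau>) =
        t\<^sup>2 * sq (onto_slice v) (xd (fst \<tau>) + snd \<tau>)" by (simp add: sq_scale)
  next
    fix v
    have "onto_slice (\<lambda>\<sigma>. base_point \<sigma> + v \<sigma>) \<sigma> = base_point \<sigma> + onto_slice v \<sigma>" for \<sigma>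
      using fun_cong[OF base_point_slice, of \<sigma>] by (auto simp: onto_slice_def)
    then have e: "onto_slice (\<lambda>\<sigma>. base_point \<sigma> + v \<sigma>) = (\<lambda>\<sigma>. base_point \<sigma> + onto_slice v \<sigma>)" by (rule ext)
    have "P (\<lambda>\<tau>. C \<tau> + (2 * v \<tau> + sq (onto_slice v) (xd (fst \<tau>) + snd \<tau>))) =
        P (\<lambda>\<tau>. sq (onto_slice (\<lambda>\<sigma>. base_point \<sigma> + v \<sigma>)) (xd (fst \<tau>) + snd \<tau>))"
      unfolding e by (rule poly_fun_cong[OF P]) (simp add: sq_base_point_add C_def)
    then show "P (\<lambda>\<tau>. C \<tau> + (2 * v \<tau> + sq (onto_slice v) (xd (fst \<tau>) + snd \<tau>))) = 0"
      using zero by simp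
  qed simp
  from this[of "\<lambda>\<tau>. x \<tau> - C \<tau>"] show ?thesis by simp
qed

text \<open>The equation uses only the coefficients selected by the slice, but it is recorded over
  all of \<open>Mon2\<close>, the coordinates of \<open>f\<close>.\<close>

lemma algebraic_on_slice:
  assumes c: "poly_fun slice c" "c x0 \<noteq> 0"
  shows "\<exists>D b. (\<forall>l. poly_fun Mon2 (b l)) \<and> (\<forall>x. (\<Sum>l\<le>D. b l (sq (onto_slice x)) * c x ^ l) = 0) \<and>
    (\<exists>x. b (0::nat) (sq (onto_slice x)) \<noteq> 0)"
proof -
  define h where "h \<tau> y = sq (onto_slice y) (xd (fst \<tau>) + snd \<tau>)" for \<tau> y
  have "\<exists>D b. (\<forall>l. poly_fun slice (b l)) \<and> (\<forall>x. (\<Sum>l\<le>D. b l (\<lambda>j. h j x) * c x ^ l) = 0) \<and>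
    (\<exists>x. b (0::nat) (\<lambda>j. h j x) \<noteq> 0)"
  proof (rule algebraic_over_independent[OF finite_slice _ c])
    show "poly_fun slice (h \<tau>)" for \<tau> unfolding h_def by (rule poly_fun_sq_slice)
    show "\<forall>x. P x = 0" if "poly_fun slice P" "\<forall>x. P (\<lambda>j. h j x) = 0" for P
      using leading_coeffs_independent[OF that(1)] that(2) unfolding h_def by simp
  qed
  then obtain D b where b: "\<forall>l. poly_fun slice (b l)"
    "\<forall>x. (\<Sum>l\<le>D. b l (\<lambda>j. h j x) * c x ^ l) = 0" "\<exists>x. b (0::nat) (\<lambda>j. h j x) \<noteq> 0"
    by (elim exE conjE) (rule that; (assumption | erule exI))
  define b' where "b' l z = b l (\<lambda>\<tau>. z (xd (fst \<tau>) + snd \<tau>))" for l z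
  have "poly_fun Mon2 (b' l)" for l
    unfolding b'_def
  proof (rule poly_fun_compose[OF b(1)[rule_format]], rule poly_fun_var)
    fix \<tau> assume "\<tau> \<in> slice"
    then have "fst \<tau> < k" "snd \<tau> \<in> Mon" by (auto simp: slice_def tuple_index_def)
    then show "xd (fst \<tau>) + snd \<tau> \<in> Mon2"
      using monomials_add[OF xd_Mon, of "fst \<tau>" "snd \<tau>" d] by (simp add: mult_2)
  qed
  moreover have "b' l (sq (onto_slice x)) = b l (\<lambda>j. h j x)" for l x
    by (simp add: b'_def h_def)
  ultimately show ?thesis using b(2,3) by (intro exI[of _ D] exI[of _ b']) simp
qed

text \<open>The relation found on the slice is itself an invariant polynomial, because its
  coefficients are functions of \<open>sq\<close>; hence it vanishes on all tuples.\<close>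

lemma invariant_algebraic:
  assumes w: "poly_fun T w" "invariant w" "w y0 \<noteq> 0"
  shows "\<exists>D b. (\<forall>l. poly_fun Mon2 (b l)) \<and> (\<forall>y. (\<Sum>l\<le>D. b l (sq y) * w y ^ l) = 0) \<and>
    (\<exists>y. b (0::nat) (sq y) \<noteq> 0)"
proof -
  obtain x0 where x0: "w (onto_slice x0) \<noteq> 0" using invariant_vanishes[OF w(1,2)] w(3) by blast
  have "poly_fun slice (\<lambda>y. w (onto_slice y))"
    by (rule poly_fun_compose[OF w(1) poly_fun_onto_slice])
  from algebraic_on_slice[of "\<lambda>y. w (onto_slice y)" x0, OF this x0] obtain D b where b: "\<forall>l. poly_fun Mon2 (b l)"
    "\<forall>x. (\<Sum>l\<le>D. b l (sq (onto_slice x)) * w (onto_slice x) ^ l) = 0"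
    "\<exists>x. b (0::nat) (sq (onto_slice x)) \<noteq> 0"
    by (elim exE conjE) (rule that; (assumption | erule exI))
  have p: "poly_fun T (\<lambda>y. \<Sum>l\<le>D. b l (sq y) * w y ^ l)"
    by (intro poly_fun_sum poly_fun_mult poly_fun_power w(1)
        poly_fun_compose[OF b(1)[rule_format] poly_fun_sq_coeff])
  have inv: "invariant (\<lambda>y. \<Sum>l\<le>D. b l (sq y) * w y ^ l)"
    using w(2) by (simp add: invariant_def sq_coeff_reflect)
  have "(\<Sum>l\<le>D. b l (sq y) * w y ^ l) = 0" for y
    by (rule invariant_vanishes[of "\<lambda>y. \<Sum>l\<le>D. b l (sq y) * w y ^ l", OF p inv])
      (rule b(2)[rule_format])
  moreover have "\<exists>y. b 0 (sq y) \<noteq> 0" using b(3) by (elim exE) (rule exI)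
  ultimately show ?thesis using b(1) by (intro exI[of _ D] exI[of _ b]) simp
qed

lemma relation_at:
  assumes "\<forall>l. poly_fun Mon2 (b l)" "\<forall>y. (\<Sum>l\<le>D. b l (sq y) * w y ^ l) = 0"
    "sq y = Poly_Mapping.lookup f"
  shows "(\<Sum>l\<le>D. b l (Poly_Mapping.lookup f) * w y ^ l) = 0"
  using assms(2)[rule_format, of y] assms(3) by simp

section \<open>General sums of squares\<close>

text \<open>The graph of the squaring map on the slice, with \<open>Inl\<close> for the values and
  \<open>Inr\<close> for the argument. Recovering the \<open>Inr\<close> coordinates over a closure
  point amounts to finding a preimage.\<close>

definition slice_embedding ::
  "(nat \<times> (nat \<Rightarrow>\<^sub>0 nat) \<Rightarrow> complex) \<Rightarrow> (nat \<Rightarrow>\<^sub>0 nat) + nat \<times> (nat \<Rightarrow>\<^sub>0 nat) \<Rightarrow> complex" where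
  "slice_embedding y = case_sum (sq (onto_slice y)) (onto_slice y)"

lemma algebraic_image_slice: "algebraic_image slice slice_embedding (Inl ` Mon2)"
proof
  fix s show "poly_fun slice (\<lambda>y. slice_embedding y s)"
    by (cases s) (simp_all add: slice_embedding_def poly_fun_sq_slice poly_fun_onto_slice)
next
  fix c x0 assume "poly_fun slice c" "c x0 \<noteq> (0::complex)"
  from algebraic_on_slice[OF this] obtain D b where b: "\<forall>l. poly_fun Mon2 (b l)"
    "\<forall>x. (\<Sum>l\<le>D. b l (sq (onto_slice x)) * c x ^ l) = 0" "\<exists>x. b (0::nat) (sq (onto_slice x)) \<noteq> 0"
    by (elim exE conjE) (rule that; (assumption | erule exI))
  define b' :: "nat \<Rightarrow> ((nat \<Rightarrow>\<^sub>0 nat) + nat \<times> (nat \<Rightarrow>\<^sub>0 nat) \<Rightarrow> complex) \<Rightarrow> complex"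
    where "b' l z = b l (\<lambda>c. z (Inl c))" for l z
  have "poly_fun (Inl ` Mon2) (b' l)" for l
    unfolding b'_def by (rule poly_fun_compose[OF b(1)[rule_format]], rule poly_fun_var) simp
  moreover have "b' l (slice_embedding x) = b l (sq (onto_slice x))" for l x
    by (simp add: b'_def slice_embedding_def)
  ultimately show "\<exists>D b. (\<forall>l. poly_fun (Inl ` Mon2) (b l)) \<and>
      (\<forall>x. (\<Sum>l\<le>D. b l (slice_embedding x) * c x ^ l) = 0) \<and> (\<exists>x. b (0::nat) (slice_embedding x) \<noteq> 0)"
    using b(2,3) by (intro exI[of _ D] exI[of _ b']) simp
qed

lemma general_fiber_nonempty:
  "\<exists>b. poly_fun Mon2 b \<and> (\<exists>y. b (sq y) \<noteq> 0) \<and>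
    (\<forall>f\<in>SOS n d k. b (Poly_Mapping.lookup f) \<noteq> 0 \<longrightarrow> (\<exists>y. sq y = Poly_Mapping.lookup f))"
proof -
  interpret algebraic_image slice slice_embedding "Inl ` Mon2" by (rule algebraic_image_slice)
  obtain b where b: "poly_fun (Inl ` Mon2) b" "\<exists>x. b (slice_embedding x) \<noteq> 0"
    "\<forall>z\<in>image_closure (Inl ` Mon2). b z \<noteq> 0 \<longrightarrow>
      (\<exists>z'\<in>image_closure (Inr ` slice \<union> Inl ` Mon2). \<forall>i\<in>Inl ` Mon2. z' i = z i)"
    using extend_coordinates[OF finite_imageI[OF finite_slice], of Inr]
    by (elim exE conjE) (rule that; (assumption | erule exI))
  define emb :: "((nat \<Rightarrow>\<^sub>0 nat) \<Rightarrow> complex) \<Rightarrow> (nat \<Rightarrow>\<^sub>0 nat) + nat \<times> (nat \<Rightarrow>\<^sub>0 nat) \<Rightarrow> complex"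
    where "emb z = case_sum z (\<lambda>_. 0)" for z
  have emb: "poly_fun Mon2 (\<lambda>z. P (emb z))" if "poly_fun (Inl ` Mon2) P" for P
    by (rule poly_fun_compose[OF that]) (auto simp: emb_def poly_fun_var)
  have emb_sq: "P (slice_embedding y) = P (emb (sq (onto_slice y)))" if "poly_fun (Inl ` Mon2) P" for P y
    by (rule poly_fun_cong[OF that]) (auto simp: emb_def slice_embedding_def)
  have "\<exists>y. sq y = Poly_Mapping.lookup f"
    if f: "f \<in> SOS n d k" "b (emb (Poly_Mapping.lookup f)) \<noteq> 0" for f
  proof -
    \<comment> \<open>The slice already has dense image in \<open>SOS\<close>: an equation for sums
      of squares from the slice is an invariant equation and holds for all sums of squares.\<close>
    have "emb (Poly_Mapping.lookup f) \<in> image_closure (Inl ` Mon2)"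
      unfolding image_closure_def
    proof (intro CollectI allI impI)
      fix P assume P: "poly_fun (Inl ` Mon2) P" "\<forall>x. P (slice_embedding x) = 0"
      have "P (emb (sq y)) = 0" for y
      proof (rule invariant_vanishes[of "\<lambda>y. P (emb (sq y))"])
        show "poly_fun T (\<lambda>y. P (emb (sq y)))"
          by (rule poly_fun_compose[OF emb[OF P(1)] poly_fun_sq_coeff])
        show "invariant (\<lambda>y. P (emb (sq y)))" by (simp add: invariant_def sq_coeff_reflect)
      qed (use P(2) emb_sq[OF P(1)] in simp)
      then show "P (emb (Poly_Mapping.lookup f)) = 0" by (rule SOS_zero[OF f(1) emb[OF P(1)]])
    qed
    then obtain z where z: "z \<in> image_closure (Inr ` slice \<union> Inl ` Mon2)"
      "\<forall>i\<in>Inl ` Mon2. z i = emb (Poly_Mapping.lookup f) i" using b(3) f(2) by blast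
    define y where "y \<tau> = z (Inr \<tau>)" for \<tau>
    have "sq (onto_slice y) c = Poly_Mapping.lookup f c" for c
    proof (cases "c \<in> Mon2")
      case True
      \<comment> \<open>The equation of the graph holds on the whole closure, so the
        \<open>Inr\<close> part of the extended point is a genuine preimage and not just a
        limit.\<close>
      define P where "P z = z (Inl c) - sq (onto_slice (\<lambda>\<tau>. z (Inr \<tau>))) c"
        for z :: "(nat \<Rightarrow>\<^sub>0 nat) + nat \<times> (nat \<Rightarrow>\<^sub>0 nat) \<Rightarrow> complex"
      have "poly_fun (Inr ` slice \<union> Inl ` Mon2) P"
        unfolding P_def
        by (intro poly_fun_diff poly_fun_compose[OF poly_fun_sq_slice] poly_fun_var) (use True in auto)
      moreover have "P (slice_embedding x) = 0" for x
      proof -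
        have "onto_slice (\<lambda>\<tau>. slice_embedding x (Inr \<tau>)) = onto_slice x"
          by (auto simp: slice_embedding_def onto_slice_def)
        then show ?thesis by (simp add: P_def slice_embedding_def)
      qed
      ultimately have "P z = 0" by (rule image_closureD[OF z(1)])
      moreover have "z (Inl c) = Poly_Mapping.lookup f c" using z(2) True by (simp add: emb_def)
      moreover have "(\<lambda>\<tau>. z (Inr \<tau>)) = y" by (rule ext) (simp add: y_def)
      ultimately show ?thesis by (simp add: P_def)
    next
      case False
      have "f \<in> Sym n (2 * d)"
        using f(1) by (simp add: SOS_eq in_closure_of topspace_Sym_zariski)
      then show ?thesis using False by (simp add: sq_coeff_support Sym_def forms_iff_lookup)
    qed
    then have "sq (onto_slice y) = Poly_Mapping.lookup f" by (rule ext)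
    then show ?thesis by (rule exI[of _ "onto_slice y"])
  qed
  moreover have "\<exists>y. b (emb (sq y)) \<noteq> 0" using b(2) by (auto simp: emb_sq[OF b(1)])
  ultimately show ?thesis using emb[OF b(1)] by (intro exI[of _ "\<lambda>z. b (emb z)"]) blast
qed

text \<open>Where the constant term \<open>b 0\<close> does not vanish, the relation specialises to
  a nonzero univariate polynomial with all values \<open>w y\<close> over \<open>f\<close> among its
  roots. An identically zero \<open>w\<close> is treated apart, as
  \<open>invariant_algebraic\<close> does not cover it.\<close>

lemma general_invariant_finite:
  assumes w: "poly_fun T w" "invariant w"
  shows "\<exists>b. poly_fun Mon2 b \<and> (\<exists>y. b (sq y) \<noteq> 0) \<and>
    (\<forall>f. b (Poly_Mapping.lookup f) \<noteq> 0 \<longrightarrow> finite {w y | y. sq y = Poly_Mapping.lookup f})"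
proof (cases "\<exists>y. w y \<noteq> 0")
  case True
  then obtain y0 where "w y0 \<noteq> 0" by blast
  from invariant_algebraic[OF w this] obtain D b where b: "\<forall>l. poly_fun Mon2 (b l)"
    "\<forall>y. (\<Sum>l\<le>D. b l (sq y) * w y ^ l) = 0" "\<exists>y. b (0::nat) (sq y) \<noteq> 0"
    by (elim exE conjE) (rule that; (assumption | erule exI))
  have "finite {w y | y. sq y = Poly_Mapping.lookup f}" if f: "b 0 (Poly_Mapping.lookup f) \<noteq> 0" for f
  proof -
    define r where "r = (\<Sum>l\<le>D. monom (b l (Poly_Mapping.lookup f)) l)"
    have "coeff r 0 = b 0 (Poly_Mapping.lookup f)" by (simp add: r_def coeff_sum)
    then have "r \<noteq> 0" using f by auto
    moreover have "{w y | y. sq y = Poly_Mapping.lookup f} \<subseteq> {t. poly r t = 0}"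
    proof clarify
      fix y assume "sq y = Poly_Mapping.lookup f"
      from relation_at[OF b(1,2) this] show "poly r (w y) = 0"
        by (simp add: r_def poly_sum poly_monom)
    qed
    ultimately show ?thesis by (intro finite_subset[OF _ poly_roots_finite])
  qed
  then show ?thesis using b(1,3) by (intro exI[of _ "b 0"]) simp
next
  case False
  then have "w y = 0" for y by simp
  then have "{w y | y. sq y = Poly_Mapping.lookup f} \<subseteq> {0}" for f
    by (intro subsetI) (elim CollectE exE conjE, simp)
  then have "finite {w y | y. sq y = Poly_Mapping.lookup f}" for f
    by (rule finite_subset) simp
  then show ?thesis by (intro exI[of _ "\<lambda>_. 1"]) simp
qed

text \<open>At a zero of \<open>w\<close> the algebraic relation collapses to its constant term, so
  the locus where \<open>b 0\<close> is nonzero excludes such zeros.\<close>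

lemma general_invariant_nonzero:
  assumes w: "poly_fun T w" "invariant w" "w y0 \<noteq> 0"
  shows "\<exists>b. poly_fun Mon2 b \<and> (\<exists>y. b (sq y) \<noteq> 0) \<and>
    (\<forall>f. b (Poly_Mapping.lookup f) \<noteq> 0 \<longrightarrow> (\<forall>y. sq y = Poly_Mapping.lookup f \<longrightarrow> w y \<noteq> 0))"
proof -
  from invariant_algebraic[OF w] obtain D b where b: "\<forall>l. poly_fun Mon2 (b l)"
    "\<forall>y. (\<Sum>l\<le>D. b l (sq y) * w y ^ l) = 0" "\<exists>y. b (0::nat) (sq y) \<noteq> 0"
    by (elim exE conjE) (rule that; (assumption | erule exI))
  have "w y \<noteq> 0" if f: "b 0 (Poly_Mapping.lookup f) \<noteq> 0" and y: "sq y = Poly_Mapping.lookup f" for f y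
  proof
    assume "w y = 0"
    then have "(\<Sum>l\<le>D. b l (Poly_Mapping.lookup f) * w y ^ l) =
        (\<Sum>l\<le>D. if l = 0 then b l (Poly_Mapping.lookup f) else 0)"
      by (intro sum.cong) (auto simp: power_0_left)
    then show False using relation_at[OF b(1,2) y] f by simp
  qed
  then show ?thesis using b(1,3) by (intro exI[of _ "b 0"]) simp
qed

text \<open>The determinant of this block is the square of the determinant of the columns
  \<open>y (i, xd j)\<close>. The latter would also detect independence, but it changes sign under
  reflections and is not invariant.\<close>

definition gram_mat :: "(nat \<times> (nat \<Rightarrow>\<^sub>0 nat) \<Rightarrow> complex) \<Rightarrow> complex mat" where
  "gram_mat y = mat k k (\<lambda>(i, j). gram k y (xd i) (xd j))"

lemma poly_fun_det_gram: "poly_fun T (\<lambda>y. det (gram_mat y))"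
proof -
  have "det (gram_mat y) = (\<Sum>p\<in>{p. p permutes {0..<k}}. signof p * (\<Prod>i=0..<k. gram k y (xd i) (xd (p i))))" for y
  proof -
    have "gram_mat y $$ (i, p i) = gram k y (xd i) (xd (p i))"
      if "p permutes {0..<k}" "i \<in> {0..<k}" for p i
      using that permutes_in_image[OF that(1), of i] by (simp add: gram_mat_def)
    then show ?thesis
      by (subst det_def'[of _ k]) (auto simp: gram_mat_def intro!: sum.cong prod.cong)
  qed
  moreover have "poly_fun T (\<lambda>y. \<Sum>p\<in>{p. p permutes {0..<k}}. signof p * (\<Prod>i=0..<k. gram k y (xd i) (xd (p i))))"
  proof (intro poly_fun_sum poly_fun_mult poly_fun_const poly_fun_prod poly_fun_gram)
    fix p i assume "p \<in> {p. p permutes {0..<k}}" "i \<in> {0..<k}"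
    then have "i < k" "p i < k" using permutes_in_image[of p "{0..<k}" i] by auto
    then show "xd i \<in> Mon" "xd (p i) \<in> Mon" by (simp_all add: xd_Mon)
  qed
  ultimately show ?thesis by (simp only:)
qed

lemma invariant_det_gram: "invariant (\<lambda>y. det (gram_mat y))"
  by (simp add: invariant_def gram_mat_def gram_reflect)

lemma det_gram_base_point: "det (gram_mat base_point) = 1"
proof -
  have "gram k base_point (xd i) (xd j) = (if i = j then 1 else 0)" if "i < k" "j < k" for i j
  proof -
    have "gram k base_point (xd i) (xd j) = (\<Sum>l<k. if l = i then (if i = j then 1 else 0) else 0)"
      unfolding gram_def by (rule sum.cong) (auto simp: base_point_def dest: xd_inj)
    then show ?thesis using that by simp
  qed
  then have "gram_mat base_point = 1\<^sub>m k" by (auto simp: gram_mat_def)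
  then show ?thesis by simp
qed

lemma general_fiber:
  "\<exists>b. poly_fun Mon2 b \<and> (\<exists>y. b (sq y) \<noteq> 0) \<and>
    (\<forall>f\<in>SOS n d k. b (Poly_Mapping.lookup f) \<noteq> 0 \<longrightarrow>
      (\<exists>y. sq y = Poly_Mapping.lookup f) \<and>
      (\<forall>y. sq y = Poly_Mapping.lookup f \<longrightarrow> det (gram_mat y) \<noteq> 0) \<and>
      (\<forall>a\<in>Mon. \<forall>b\<in>Mon. finite {gram k y a b | y. sq y = Poly_Mapping.lookup f}))"
proof -
  obtain b1 where b1: "poly_fun Mon2 b1" "\<exists>y. b1 (sq y) \<noteq> 0"
    "\<forall>f\<in>SOS n d k. b1 (Poly_Mapping.lookup f) \<noteq> 0 \<longrightarrow> (\<exists>y. sq y = Poly_Mapping.lookup f)"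
    using general_fiber_nonempty by (elim exE conjE) (rule that; (assumption | erule exI))
  have "det (gram_mat base_point) \<noteq> 0" by (simp add: det_gram_base_point)
  from general_invariant_nonzero[OF poly_fun_det_gram invariant_det_gram this]
  obtain b2 where b2: "poly_fun Mon2 b2" "\<exists>y. b2 (sq y) \<noteq> 0"
    "\<forall>f. b2 (Poly_Mapping.lookup f) \<noteq> 0 \<longrightarrow> (\<forall>y. sq y = Poly_Mapping.lookup f \<longrightarrow> det (gram_mat y) \<noteq> 0)"
    by (elim exE conjE) (rule that; (assumption | erule exI))
  have "\<forall>ab\<in>Mon \<times> Mon. \<exists>b. poly_fun Mon2 b \<and> (\<exists>y. b (sq y) \<noteq> 0) \<and>
      (\<forall>f. b (Poly_Mapping.lookup f) \<noteq> 0 \<longrightarrow> finite {gram k y (fst ab) (snd ab) | y. sq y = Poly_Mapping.lookup f})"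
    using general_invariant_finite[OF poly_fun_gram invariant_gram] by (intro ballI) (simp add: mem_Times_iff)
  then obtain b3 where b3: "\<forall>ab\<in>Mon \<times> Mon. poly_fun Mon2 (b3 ab) \<and> (\<exists>y. b3 ab (sq y) \<noteq> 0) \<and>
      (\<forall>f. b3 ab (Poly_Mapping.lookup f) \<noteq> 0 \<longrightarrow> finite {gram k y (fst ab) (snd ab) | y. sq y = Poly_Mapping.lookup f})"
    by (rule bchoice[THEN exE])
  note b3p = b3[THEN bspec, THEN conjunct1]
    and b3n = b3[THEN bspec, THEN conjunct2, THEN conjunct1]
  \<comment> \<open>One factor for a nonempty fibre, one for independence, and one for each of the
    finitely many Gram coordinates.\<close>
  define b where "b z = b1 z * (b2 z * (\<Prod>ab\<in>Mon \<times> Mon. b3 ab z))" for z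
  have fin: "finite (Mon \<times> Mon)" by (simp add: finite_monomials)
  have "poly_fun Mon2 b"
    unfolding b_def by (intro poly_fun_mult poly_fun_prod b1(1) b2(1) b3p)
  moreover have "\<exists>y. b (sq y) \<noteq> 0"
  proof -
    have comp: "poly_fun T (\<lambda>y. P (sq y))" if "poly_fun Mon2 P" for P
      by (rule poly_fun_compose[OF that poly_fun_sq_coeff])
    have "\<exists>y. (\<Prod>ab\<in>Mon \<times> Mon. b3 ab (sq y)) \<noteq> 0"
      by (rule poly_fun_prod_nonzero[OF fin comp[OF b3p] b3n])
    then obtain y3 where y3: "(\<Prod>ab\<in>Mon \<times> Mon. b3 ab (sq y3)) \<noteq> 0" by (elim exE) (rule that)
    obtain y2 where y2: "b2 (sq y2) \<noteq> 0" using b2(2) by (elim exE) (rule that)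
    obtain y1 where y1: "b1 (sq y1) \<noteq> 0" using b1(2) by (elim exE) (rule that)
    have p3: "poly_fun T (\<lambda>y. \<Prod>ab\<in>Mon \<times> Mon. b3 ab (sq y))"
      by (rule poly_fun_prod[OF comp[OF b3p]])
    obtain y23 where "b2 (sq y23) \<noteq> 0" "(\<Prod>ab\<in>Mon \<times> Mon. b3 ab (sq y23)) \<noteq> 0"
      using poly_fun_no_zero_divisors[of _ "\<lambda>y. b2 (sq y)"
          "\<lambda>y. \<Prod>ab\<in>Mon \<times> Mon. b3 ab (sq y)", OF comp[OF b2(1)] p3 y2 y3] by (elim exE conjE) (rule that)
    then have y23: "b2 (sq y23) * (\<Prod>ab\<in>Mon \<times> Mon. b3 ab (sq y23)) \<noteq> 0" by simp
    obtain y where "b1 (sq y) \<noteq> 0" "b2 (sq y) * (\<Prod>ab\<in>Mon \<times> Mon. b3 ab (sq y)) \<noteq> 0"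
      using poly_fun_no_zero_divisors[of _ "\<lambda>y. b1 (sq y)"
          "\<lambda>y. b2 (sq y) * (\<Prod>ab\<in>Mon \<times> Mon. b3 ab (sq y))",
          OF comp[OF b1(1)] poly_fun_mult[OF comp[OF b2(1)] p3] y1 y23]
      by (elim exE conjE) (rule that)
    then show ?thesis by (intro exI[of _ y]) (simp add: b_def)
  qed
  moreover have "finite {gram k y a a' | y. sq y = Poly_Mapping.lookup f}"
    if "b (Poly_Mapping.lookup f) \<noteq> 0" "a \<in> Mon" "a' \<in> Mon" for f a a'
  proof -
    have "(\<Prod>ab\<in>Mon \<times> Mon. b3 ab (Poly_Mapping.lookup f)) \<noteq> 0" using that(1) by (simp add: b_def)
    then have "b3 (a, a') (Poly_Mapping.lookup f) \<noteq> 0"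
      using that(2,3) fin by (auto simp: prod_zero_iff)
    then show ?thesis using b3[rule_format, of "(a, a')"] that(2,3) by simp
  qed
  moreover have "\<exists>y. sq y = Poly_Mapping.lookup f"
    if "f \<in> SOS n d k" "b (Poly_Mapping.lookup f) \<noteq> 0" for f
    using that b1(3) by (simp add: b_def)
  moreover have "det (gram_mat y) \<noteq> 0"
    if "b (Poly_Mapping.lookup f) \<noteq> 0" "sq y = Poly_Mapping.lookup f" for f y
  proof -
    have "b2 (Poly_Mapping.lookup f) \<noteq> 0" using that(1) by (simp add: b_def)
    from b2(3)[rule_format, OF this that(2)] show ?thesis .
  qed
  ultimately show ?thesis by (intro exI[of _ b]) auto
qed

end

section \<open>Disjoint unions of linear copies\<close>

lemma closedin_zariskiI:
  assumes "\<And>a. a \<in> A \<Longrightarrow> poly_fun I (Q a)" "Z = {x \<in> affine_space I. \<forall>a\<in>A. Q a x = 0}"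
  shows "closedin (zariski I) Z"
proof -
  have "\<forall>a\<in>A. \<exists>g. g \<in> cpolys I \<and> (\<forall>x. Q a x = cpoly_eval x g)"
    using assms(1) unfolding poly_fun_iff_cpoly by blast
  then obtain g where g: "\<forall>a\<in>A. g a \<in> cpolys I \<and> (\<forall>x. Q a x = cpoly_eval x (g a))"
    by (rule bchoice[THEN exE])
  then have "Z = zero_locus I (g ` A)" unfolding assms(2) zero_locus_def by auto
  moreover have "g ` A \<subseteq> cpolys I" using g by blast
  ultimately show ?thesis unfolding closedin_zariski by blast
qed

lemma regular_mapI:
  assumes "\<And>x. x \<in> X \<Longrightarrow> \<phi> x \<in> Y" "\<And>j. j \<in> J \<Longrightarrow> poly_fun I (\<lambda>x. \<phi> x j)"
  shows "regular_map I X J Y \<phi>"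
  unfolding regular_map_def
proof (intro conjI ballI)
  fix j assume "j \<in> J"
  then obtain g where "g \<in> cpolys I" "\<forall>x. \<phi> x j = cpoly_eval x g"
    using assms(2)[of j] unfolding poly_fun_iff_cpoly by blast
  then show "\<exists>g\<in>cpolys I. \<forall>x\<in>X. \<phi> x j = cpoly_eval x g" by (intro bexI[of _ g]) simp_all
qed (use assms(1) in blast)

text \<open>The Lagrange polynomials for the nodes \<open>0, ..., p - 1\<close>; evaluated at the
  coordinate \<open>None\<close> they act as indicators of the copies.\<close>

definition lagrange_basis :: "nat \<Rightarrow> nat \<Rightarrow> complex \<Rightarrow> complex" where
  "lagrange_basis p c t = (\<Prod>b\<in>{..<p} - {c}. (t - of_nat b) / (of_nat c - of_nat b))"

lemma lagrange_basis_nat: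
  assumes "b < p" shows "lagrange_basis p c (of_nat b) = (if b = c then 1 else 0)"
proof (cases "b = c")
  case True
  then show ?thesis unfolding lagrange_basis_def by (auto intro: prod.neutral)
next
  case False
  then have "(\<Prod>i\<in>{..<p} - {c}. (of_nat b - of_nat i) / (of_nat c - of_nat i) :: complex) = 0"
    using assms by (intro prod_zero) auto
  then show ?thesis using False by (simp add: lagrange_basis_def)
qed

lemma sum_delta_mult:
  fixes g :: "nat \<Rightarrow> complex"
  assumes "b < p" "\<And>c. c < p \<Longrightarrow> \<delta> c = (if b = c then 1 else 0)"
  shows "(\<Sum>c<p. \<delta> c * g c) = g b"
proof -
  have "(\<Sum>c<p. \<delta> c * g c) = (\<Sum>c<p. if c = b then g c else 0)"
    by (rule sum.cong) (auto simp: assms(2))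
  then show ?thesis using assms(1) by simp
qed

lemma closedin_disjoint_copies:
  assumes "\<And>a. a \<in> A \<Longrightarrow> poly_fun K (Q a)" "Z = {x \<in> affine_space K. \<forall>a\<in>A. Q a x = 0}"
  shows "closedin (zariski (add_index K)) (disjoint_copies p Z)"
proof (rule closedin_zariskiI)
  let ?Q = "\<lambda>a z. case a of None \<Rightarrow> \<Prod>c<p. z None - of_nat c | Some a \<Rightarrow> Q a (\<lambda>j. z (Some j))"
  show "poly_fun (add_index K) (?Q a)" if "a \<in> insert None (Some ` A)" for a
  proof (cases a)
    case None
    then show ?thesis
      by (simp, intro poly_fun_prod poly_fun_diff poly_fun_var poly_fun_const) (simp add: add_index_def)
  next
    case (Some a')
    then have "poly_fun K (Q a')" using that assms(1) by auto
    then have "poly_fun (add_index K) (\<lambda>z. Q a' (\<lambda>j. z (Some j)))"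
      by (rule poly_fun_compose) (simp add: poly_fun_var add_index_def)
    then show ?thesis using Some by simp
  qed
  show "disjoint_copies p Z = {z \<in> affine_space (add_index K). \<forall>a\<in>insert None (Some ` A). ?Q a z = 0}"
  proof (intro equalityI subsetI)
    fix z assume "z \<in> disjoint_copies p Z"
    then obtain c x where z: "z = add_coord (of_nat c) x" "c < p" "x \<in> Z"
      unfolding disjoint_copies_def by blast
    have "z \<in> affine_space (add_index K)"
      using z assms(2) by (auto simp: affine_space_def add_index_def add_coord_def split: option.splits)
    moreover have "(\<Prod>b<p. z None - of_nat b) = 0"
      by (rule prod_zero) (use z in \<open>auto simp: add_coord_def\<close>)
    moreover have "(\<lambda>j. z (Some j)) = x" by (simp add: z add_coord_def)
    ultimately show "z \<in> {z \<in> affine_space (add_index K). \<forall>a\<in>insert None (Some ` A). ?Q a z = 0}"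
      using z(3) assms(2) by simp
  next
    fix z assume z: "z \<in> {z \<in> affine_space (add_index K). \<forall>a\<in>insert None (Some ` A). ?Q a z = 0}"
    then have "(\<Prod>b<p. z None - of_nat b) = 0" by simp
    then obtain c where c: "c < p" "z None = of_nat c" by (auto simp: prod_zero_iff)
    have "(\<lambda>j. z (Some j)) \<in> Z"
      using z unfolding assms(2) by (auto simp: affine_space_def add_index_def image_iff)
    moreover have "z = add_coord (of_nat c) (\<lambda>j. z (Some j))"
      by (rule ext) (simp add: add_coord_def c(2) split: option.split)
    ultimately show "z \<in> disjoint_copies p Z" unfolding disjoint_copies_def using c(1) by blast
  qed
qed

text \<open>The maps \<open>M c\<close> and \<open>L c\<close> of single copies are glued by
  indicator polynomials: the \<open>e c\<close> on \<open>X\<close>, and the Lagrange polynomials of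
  the label on the disjoint union.\<close>

lemma isomorphic_copies:
  assumes Z: "\<And>a. a \<in> A \<Longrightarrow> poly_fun K (Q a)" "Z = {x \<in> affine_space K. \<forall>a\<in>A. Q a x = 0}"
    and closed: "closedin (zariski I) X" and X: "X = (\<Union>c<p. X' c)"
    and e: "\<And>c. c < p \<Longrightarrow> poly_fun I (e c)"
      "\<And>c b x. c < p \<Longrightarrow> b < p \<Longrightarrow> x \<in> X' b \<Longrightarrow> e c x = (if b = c then 1 else 0)"
    and L: "\<And>c i. c < p \<Longrightarrow> i \<in> I \<Longrightarrow> poly_fun K (\<lambda>y. L c y i)"
      "\<And>c y. c < p \<Longrightarrow> y \<in> Z \<Longrightarrow> L c y \<in> X' c"
    and M: "\<And>c j. c < p \<Longrightarrow> j \<in> K \<Longrightarrow> poly_fun I (\<lambda>x. M c x j)"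
      "\<And>c x. c < p \<Longrightarrow> x \<in> X' c \<Longrightarrow> M c x \<in> Z"
    and LM: "\<And>c x. c < p \<Longrightarrow> x \<in> X' c \<Longrightarrow> L c (M c x) = x"
      "\<And>c y. c < p \<Longrightarrow> y \<in> Z \<Longrightarrow> M c (L c y) = y"
  shows "isomorphic_varieties I X (add_index K) (disjoint_copies p Z)"
proof -
  have ZK: "y j = 0" if "y \<in> Z" "j \<notin> K" for y j using that Z(2) by (simp add: affine_space_def)
  have "X \<subseteq> affine_space I" using closedin_subset[OF closed] by simp
  then have XI: "x i = 0" if "x \<in> X" "i \<notin> I" for x i using that by (auto simp: affine_space_def)
  define \<phi> where "\<phi> x = add_coord (\<Sum>c<p. e c x * of_nat c) (\<lambda>j. if j \<in> K then \<Sum>c<p. e c x * M c x j else 0)" for x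
  define \<psi> where "\<psi> z i = (if i \<in> I then \<Sum>c<p. lagrange_basis p c (z None) * L c (\<lambda>j. z (Some j)) i else 0)" for z i
  have \<phi>: "\<phi> x = add_coord (of_nat b) (M b x)" if "b < p" "x \<in> X' b" for b x
  proof -
    have "(\<Sum>c<p. e c x * g c) = g b" for g
      by (rule sum_delta_mult) (use that e(2) in auto)
    moreover have "M b x j = 0" if "j \<notin> K" for j using ZK M(2)[OF \<open>b < p\<close> \<open>x \<in> X' b\<close>] that by blast
    ultimately have "(\<Sum>c<p. e c x * of_nat c) = of_nat b"
      "(\<lambda>j. if j \<in> K then \<Sum>c<p. e c x * M c x j else 0) = M b x" by (auto simp: fun_eq_iff)
    then show ?thesis unfolding \<phi>_def by simp
  qed
  have \<psi>: "\<psi> (add_coord (of_nat b) y) = L b y" if "b < p" "y \<in> Z" for b y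
  proof
    fix i
    have "(\<Sum>c<p. lagrange_basis p c (of_nat b) * g c) = g b" for g
      by (rule sum_delta_mult) (use that lagrange_basis_nat in auto)
    moreover have "L b y i = 0" if "i \<notin> I" using XI[OF _ that] X L(2) \<open>b < p\<close> \<open>y \<in> Z\<close> by blast
    ultimately show "\<psi> (add_coord (of_nat b) y) i = L b y i" by (simp add: \<psi>_def add_coord_def)
  qed
  have "regular_map I X (add_index K) (disjoint_copies p Z) \<phi>"
  proof (rule regular_mapI)
    fix x assume "x \<in> X"
    then obtain b where "b < p" "x \<in> X' b" using X by blast
    then show "\<phi> x \<in> disjoint_copies p Z" using \<phi> M(2) unfolding disjoint_copies_def by blast
  next
    fix j assume "j \<in> add_index K"
    then consider "j = None" | j' where "j = Some j'" "j' \<in> K" by (auto simp: add_index_def)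
    then show "poly_fun I (\<lambda>x. \<phi> x j)"
    proof cases
      case 1
      then show ?thesis
        by (simp add: \<phi>_def add_coord_def) (intro poly_fun_sum poly_fun_mult e(1) poly_fun_const, simp)
    next
      case 2
      then show ?thesis
        by (simp add: \<phi>_def add_coord_def) (intro poly_fun_sum poly_fun_mult e(1) M(1), simp_all)
    qed
  qed
  moreover have "regular_map (add_index K) (disjoint_copies p Z) I X \<psi>"
  proof (rule regular_mapI)
    fix z assume "z \<in> disjoint_copies p Z"
    then obtain b y where "z = add_coord (of_nat b) y" "b < p" "y \<in> Z"
      unfolding disjoint_copies_def by blast
    then have "\<psi> z = L b y" "L b y \<in> X' b" using \<psi> L(2) by simp_all
    then show "\<psi> z \<in> X" using X \<open>b < p\<close> by auto
  next
    fix i assume i: "i \<in> I"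
    have lag: "poly_fun (add_index K) (\<lambda>z. lagrange_basis p c (z None))" for c
    proof -
      have "poly_fun (add_index K) (\<lambda>z. (z None - of_nat b) / (of_nat c - of_nat b))" for b
        unfolding divide_inverse
        by (intro poly_fun_mult poly_fun_diff poly_fun_const poly_fun_var) (simp add: add_index_def)
      then show ?thesis unfolding lagrange_basis_def by (intro poly_fun_prod)
    qed
    have comp: "poly_fun (add_index K) (\<lambda>z. L c (\<lambda>j. z (Some j)) i)" if "c < p" for c
      by (rule poly_fun_compose[OF L(1)[OF that i]]) (simp add: poly_fun_var add_index_def)
    show "poly_fun (add_index K) (\<lambda>z. \<psi> z i)"
      using i by (simp add: \<psi>_def) (intro poly_fun_sum poly_fun_mult lag comp, simp)
  qed
  moreover have "\<psi> (\<phi> x) = x" if x: "x \<in> X" for x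
  proof -
    obtain b where "b < p" "x \<in> X' b" using X x by blast
    then show ?thesis using \<phi> \<psi> M(2) LM(1) by simp
  qed
  moreover have "\<phi> (\<psi> z) = z" if z: "z \<in> disjoint_copies p Z" for z
  proof -
    obtain b y where "z = add_coord (of_nat b) y" "b < p" "y \<in> Z"
      using z unfolding disjoint_copies_def by blast
    then show ?thesis using \<phi> \<psi> L(2) LM(2) by simp
  qed
  ultimately show ?thesis
    unfolding isomorphic_varieties_def
    using closed closedin_disjoint_copies[OF Z] by blast
qed

section \<open>The orthogonal group\<close>

lemma O_group_eq:
  "O_group k = {x \<in> affine_space (matrix_index k).
    \<forall>(j, l)\<in>{..<k} \<times> {..<k}. (\<Sum>i<k. x (i, j) * x (i, l)) - (if j = l then 1 else 0) = 0}"
proof -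
  have orth: "A \<in> orthogonal_matrices k \<longleftrightarrow>
      (\<forall>j<k. \<forall>l<k. (\<Sum>i<k. A $$ (i, j) * A $$ (i, l)) = (if j = l then 1 else 0))"
    if "A \<in> carrier_mat k k" for A :: "complex mat"
  proof -
    have "(transpose_mat A * A) $$ (j, l) = (\<Sum>i<k. A $$ (i, j) * A $$ (i, l))" if "j < k" "l < k" for j l
      using \<open>A \<in> carrier_mat k k\<close> that by (simp add: scalar_prod_def atLeast0LessThan)
    moreover have "transpose_mat A * A = 1\<^sub>m k \<longleftrightarrow>
        (\<forall>j<k. \<forall>l<k. (transpose_mat A * A) $$ (j, l) = 1\<^sub>m k $$ (j, l))"
    proof
      show "transpose_mat A * A = 1\<^sub>m k"
        if "\<forall>j<k. \<forall>l<k. (transpose_mat A * A) $$ (j, l) = 1\<^sub>m k $$ (j, l)"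
        using that \<open>A \<in> carrier_mat k k\<close> by (intro eq_matI) auto
    qed simp
    ultimately show ?thesis using that by (simp add: orthogonal_matrices_def)
  qed
  show ?thesis
  proof (intro equalityI subsetI)
    fix x assume "x \<in> O_group k"
    then obtain A where A: "A \<in> orthogonal_matrices k" "x = matrix_coords k A"
      unfolding O_group_def by blast
    then have "A \<in> carrier_mat k k" by (simp add: orthogonal_matrices_def)
    then have "\<forall>j<k. \<forall>l<k. (\<Sum>i<k. A $$ (i, j) * A $$ (i, l)) = (if j = l then 1 else 0)"
      using orth A(1) by blast
    then show "x \<in> {x \<in> affine_space (matrix_index k).
        \<forall>(j, l)\<in>{..<k} \<times> {..<k}. (\<Sum>i<k. x (i, j) * x (i, l)) - (if j = l then 1 else 0) = 0}"
      unfolding A(2) by (auto simp: matrix_coords_def affine_space_def matrix_index_def)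
  next
    fix x assume x: "x \<in> {x \<in> affine_space (matrix_index k).
        \<forall>(j, l)\<in>{..<k} \<times> {..<k}. (\<Sum>i<k. x (i, j) * x (i, l)) - (if j = l then 1 else 0) = 0}"
    define A where "A = mat k k x"
    have "A \<in> orthogonal_matrices k" by (subst orth) (use x in \<open>auto simp: A_def\<close>)
    moreover have "x = matrix_coords k A"
      using x by (auto simp: A_def matrix_coords_def affine_space_def matrix_index_def fun_eq_iff)
    ultimately show "x \<in> O_group k" unfolding O_group_def by blast
  qed
qed

lemma O_groupD:
  assumes "x \<in> O_group k" "j < k" "l < k"
  shows "(\<Sum>i<k. x (i, j) * x (i, l)) = (if j = l then 1 else 0)"
  using assms unfolding O_group_eq by fastforce

lemma O_groupI:
  assumes "\<And>i j. \<not> (i < k \<and> j < k) \<Longrightarrow> x (i, j) = 0"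
    "\<And>j l. j < k \<Longrightarrow> l < k \<Longrightarrow> (\<Sum>i<k. x (i, j) * x (i, l)) = (if j = l then 1 else 0)"
  shows "x \<in> O_group k"
  unfolding O_group_eq using assms by (auto simp: affine_space_def matrix_index_def)

lemma O_group_nonempty: "O_group k \<noteq> {}"
proof -
  have "1\<^sub>m k \<in> orthogonal_matrices k" by (simp add: orthogonal_matrices_def)
  then show ?thesis unfolding O_group_def by blast
qed

text \<open>The hypothesis concerns the product of the transpose of \<open>C\<close> with
  \<open>C\<close>, whose determinant is the square of that of \<open>C\<close>; the inverse is the
  adjugate divided by \<open>det A\<close>.\<close>

lemma matrix_left_right_inverse:
  fixes C :: "nat \<Rightarrow> nat \<Rightarrow> complex"
  assumes "det (mat k k (\<lambda>(i, j). \<Sum>l<k. C l i * C l j)) \<noteq> 0"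
  shows "\<exists>N. (\<forall>i<k. \<forall>l<k. (\<Sum>j<k. C i j * N j l) = (if i = l then 1 else 0)) \<and>
    (\<forall>i<k. \<forall>l<k. (\<Sum>j<k. N i j * C j l) = (if i = l then 1 else 0))"
proof -
  define A where "A = mat k k (\<lambda>(i, j). C i j)"
  have A: "A \<in> carrier_mat k k" by (simp add: A_def)
  have "mat k k (\<lambda>(i, j). \<Sum>l<k. C l i * C l j) = transpose_mat A * A"
    by (rule eq_matI) (simp_all add: A_def scalar_prod_def atLeast0LessThan)
  then have "det A \<noteq> 0" using assms A by (simp add: det_mult[of _ k] det_transpose[of _ k])
  define N where "N i j = adj_mat A $$ (i, j) / det A" for i j
  have adj: "adj_mat A \<in> carrier_mat k k" "A * adj_mat A = det A \<cdot>\<^sub>m 1\<^sub>m k"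
    "adj_mat A * A = det A \<cdot>\<^sub>m 1\<^sub>m k" using adj_mat[OF A] by simp_all
  have "(\<Sum>j<k. C i j * N j l) = (if i = l then 1 else 0)" if "i < k" "l < k" for i l
  proof -
    have "(\<Sum>j<k. C i j * N j l) = (A * adj_mat A) $$ (i, l) / det A"
      using that adj(1) by (simp add: A_def N_def scalar_prod_def atLeast0LessThan sum_divide_distrib)
    then show ?thesis using that \<open>det A \<noteq> 0\<close> unfolding adj(2) by simp
  qed
  moreover have "(\<Sum>j<k. N i j * C j l) = (if i = l then 1 else 0)" if "i < k" "l < k" for i l
  proof -
    have "(\<Sum>j<k. N i j * C j l) = (adj_mat A * A) $$ (i, l) / det A"
      using that adj(1) by (simp add: A_def N_def scalar_prod_def atLeast0LessThan sum_divide_distrib)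
    then show ?thesis using that \<open>det A \<noteq> 0\<close> unfolding adj(3) by simp
  qed
  ultimately show ?thesis by blast
qed

section \<open>The fibre as a union of orbits\<close>

context sos
begin

lemma gram_affine_zero:
  assumes "y \<in> affine_space T" "a \<notin> Mon \<or> b \<notin> Mon"
  shows "gram k y a b = 0"
  unfolding gram_def
proof (rule sum.neutral, rule ballI)
  fix i
  have "y (i, a) = 0 \<or> y (i, b) = 0" using assms by (auto simp: affine_space_def tuple_index_def)
  then show "y (i, a) * y (i, b) = 0" by auto
qed

lemma sq_cong_gram: "gram k x = gram k y \<Longrightarrow> sq x = sq y"
  by (rule ext) (simp add: sq_coeff_def cong: if_cong)

lemma gram_inverse:
  assumes "det (gram_mat y) \<noteq> 0"
  shows "\<exists>N. (\<forall>i<k. \<forall>l<k. (\<Sum>j<k. y (i, xd j) * N j l) = (if i = l then 1 else 0)) \<and>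
    (\<forall>i<k. \<forall>l<k. (\<Sum>j<k. N i j * y (j, xd l)) = (if i = l then 1 else 0))"
  by (rule matrix_left_right_inverse[of k "\<lambda>i j. y (i, xd j)"])
    (use assms in \<open>simp add: gram_mat_def gram_def\<close>)

definition act :: "(nat \<times> (nat \<Rightarrow>\<^sub>0 nat) \<Rightarrow> complex) \<Rightarrow> (nat \<times> nat \<Rightarrow> complex) \<Rightarrow> nat \<times> (nat \<Rightarrow>\<^sub>0 nat) \<Rightarrow> complex" where
  "act y A = (\<lambda>(i, a). if (i, a) \<in> T then \<Sum>j<k. A (i, j) * y (j, a) else 0)"

text \<open>If \<open>y\<close> has an invertible block with inverse \<open>N\<close>, a matrix
  carrying \<open>y\<close> to \<open>x\<close> must be the block of \<open>x\<close> times
  \<open>N\<close>. It is linear in \<open>x\<close>, which gives the inverse of the orbit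
  map.\<close>

definition transporter ::
  "(nat \<Rightarrow> nat \<Rightarrow> complex) \<Rightarrow> (nat \<times> (nat \<Rightarrow>\<^sub>0 nat) \<Rightarrow> complex) \<Rightarrow> nat \<times> nat \<Rightarrow> complex" where
  "transporter N x = (\<lambda>(i, j). if i < k \<and> j < k then \<Sum>l<k. x (i, xd l) * N l j else 0)"

lemma gram_act:
  assumes "y \<in> affine_space T" "A \<in> O_group k"
  shows "gram k (act y A) = gram k y"
proof (intro ext)
  fix a b
  show "gram k (act y A) a b = gram k y a b"
  proof (cases "a \<in> Mon \<and> b \<in> Mon")
    case True
    then have "gram k (act y A) a b = (\<Sum>i<k. (\<Sum>j<k. A (i, j) * y (j, a)) * (\<Sum>l<k. A (i, l) * y (l, b)))"
      by (simp add: gram_def act_def tuple_index_def)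
    also have "\<dots> = (\<Sum>i<k. \<Sum>j<k. \<Sum>l<k. y (j, a) * y (l, b) * (A (i, j) * A (i, l)))"
      by (simp add: sum_product mult_ac)
    also have "\<dots> = (\<Sum>j<k. \<Sum>l<k. \<Sum>i<k. y (j, a) * y (l, b) * (A (i, j) * A (i, l)))"
      by (subst sum.swap) (intro sum.cong refl sum.swap)
    also have "\<dots> = (\<Sum>j<k. \<Sum>l<k. if l = j then y (j, a) * y (l, b) else 0)"
      by (intro sum.cong refl) (simp add: O_groupD[OF assms(2)] flip: sum_distrib_left)
    also have "\<dots> = gram k y a b" by (simp add: gram_def)
    finally show ?thesis .
  next
    case False
    moreover have "act y A \<in> affine_space T" by (auto simp: affine_space_def act_def)
    ultimately show ?thesis using assms(1) gram_affine_zero by (metis (no_types))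
  qed
qed

text \<open>The products of columns of the transporter depend on \<open>x\<close> only through its
  Gram matrix, so they may be computed for \<open>y\<close>, where the transporter is the
  identity.\<close>

lemma transporter_O_group:
  assumes N: "\<forall>i<k. \<forall>l<k. (\<Sum>j<k. y (i, xd j) * N j l) = (if i = l then 1 else 0)"
    and "gram k x = gram k y"
  shows "transporter N x \<in> O_group k"
proof (rule O_groupI)
  fix j m assume jm: "j < k" "m < k"
  have expand: "(\<Sum>i<k. transporter N z (i, j) * transporter N z (i, m)) =
      (\<Sum>l<k. \<Sum>l'<k. gram k z (xd l) (xd l') * (N l j * N l' m))" for z
  proof -
    have "(\<Sum>i<k. transporter N z (i, j) * transporter N z (i, m)) =
        (\<Sum>i<k. \<Sum>l<k. \<Sum>l'<k. z (i, xd l) * z (i, xd l') * (N l j * N l' m))"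
      using jm by (simp add: transporter_def sum_product mult_ac)
    also have "\<dots> = (\<Sum>l<k. \<Sum>l'<k. \<Sum>i<k. z (i, xd l) * z (i, xd l') * (N l j * N l' m))"
      by (subst sum.swap) (intro sum.cong refl sum.swap)
    finally show ?thesis by (simp add: gram_def sum_distrib_right)
  qed
  have "transporter N y (i, l) = (if i = l then 1 else 0)" if "i < k" "l < k" for i l
    using N that by (simp add: transporter_def)
  then have "(\<Sum>i<k. transporter N y (i, j) * transporter N y (i, m)) =
      (\<Sum>i<k. if i = j then (if j = m then 1 else 0) else 0)"
    using jm by (intro sum.cong) auto
  then show "(\<Sum>i<k. transporter N x (i, j) * transporter N x (i, m)) = (if j = m then 1 else 0)"
    using jm unfolding expand assms(2) by simp
qed (auto simp: transporter_def)

lemma transporter_act: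
  assumes N: "\<forall>i<k. \<forall>l<k. (\<Sum>j<k. y (i, xd j) * N j l) = (if i = l then 1 else 0)"
    and A: "A \<in> O_group k"
  shows "transporter N (act y A) = A"
proof (rule ext, clarify)
  fix i m
  show "transporter N (act y A) (i, m) = A (i, m)"
  proof (cases "i < k \<and> m < k")
    case True
    then have "transporter N (act y A) (i, m) = (\<Sum>l<k. (\<Sum>j<k. A (i, j) * y (j, xd l)) * N l m)"
      by (simp add: transporter_def act_def tuple_index_def xd_Mon)
    also have "\<dots> = (\<Sum>l<k. \<Sum>j<k. A (i, j) * (y (j, xd l) * N l m))"
      by (simp add: sum_distrib_right mult.assoc)
    also have "\<dots> = (\<Sum>j<k. \<Sum>l<k. A (i, j) * (y (j, xd l) * N l m))" by (rule sum.swap)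
    also have "\<dots> = (\<Sum>j<k. if j = m then A (i, j) else 0)"
      using True N by (intro sum.cong refl) (simp flip: sum_distrib_left)
    finally show ?thesis using True by simp
  next
    case False
    then have "A (i, m) = 0" using A by (auto simp: O_group_eq affine_space_def matrix_index_def)
    then show ?thesis using False by (auto simp: transporter_def)
  qed
qed

text \<open>The two sides agree on the columns of \<open>x\<^sub>0\<^sup>d, \<dots>, x\<^sub>k\<^sub>-\<^sub>1\<^sup>d\<close>, and an invertible set of columns
  together with the Gram matrix determines the remaining ones.\<close>

lemma act_transporter:
  assumes N: "\<forall>i<k. \<forall>l<k. (\<Sum>j<k. y (i, xd j) * N j l) = (if i = l then 1 else 0)"
    "\<forall>i<k. \<forall>l<k. (\<Sum>j<k. N i j * y (j, xd l)) = (if i = l then 1 else 0)"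
    and y: "y \<in> affine_space T" and x: "x \<in> affine_space T" "gram k x = gram k y" "det (gram_mat x) \<noteq> 0"
  shows "act y (transporter N x) = x"
proof (rule ext, clarify)
  fix m a
  define z where "z = act y (transporter N x)"
  have gz: "gram k z = gram k x"
    unfolding z_def using gram_act[OF y transporter_O_group[OF N(1) x(2)]] x(2) by simp
  have zx: "z (i, xd l) = x (i, xd l)" if "i < k" "l < k" for i l
  proof -
    have "z (i, xd l) = (\<Sum>j<k. (\<Sum>l'<k. x (i, xd l') * N l' j) * y (j, xd l))"
      using that by (simp add: z_def act_def transporter_def tuple_index_def xd_Mon)
    also have "\<dots> = (\<Sum>j<k. \<Sum>l'<k. x (i, xd l') * (N l' j * y (j, xd l)))"
      by (simp add: sum_distrib_right mult.assoc)
    also have "\<dots> = (\<Sum>l'<k. \<Sum>j<k. x (i, xd l') * (N l' j * y (j, xd l)))" by (rule sum.swap)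
    also have "\<dots> = (\<Sum>l'<k. if l' = l then x (i, xd l') else 0)"
      using that N(2) by (intro sum.cong refl) (simp flip: sum_distrib_left)
    finally show ?thesis using that by simp
  qed
  obtain Nx where Nx: "\<forall>i<k. \<forall>l<k. (\<Sum>j<k. x (i, xd j) * Nx j l) = (if i = l then 1 else 0)"
    using gram_inverse[OF x(3)] by blast
  show "z (m, a) = x (m, a)"
  proof (cases "m < k")
    case True
    \<comment> \<open>Equal Gram coordinates make column \<open>a\<close> of \<open>z - x\<close>
      orthogonal to the columns \<open>xd l\<close> of \<open>x\<close>, and these span the whole
      space since \<open>x\<close> has a nonzero Gram determinant.\<close>
    have "(\<Sum>i<k. x (i, xd l) * (z (i, a) - x (i, a))) = 0" if "l < k" for l
    proof -
      have "(\<Sum>i<k. x (i, xd l) * z (i, a)) = gram k z (xd l) a"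
        unfolding gram_def using zx that by (intro sum.cong) auto
      also have "\<dots> = (\<Sum>i<k. x (i, xd l) * x (i, a))" unfolding gz gram_def ..
      finally show ?thesis by (simp add: right_diff_distrib sum_subtractf)
    qed
    then have "0 = (\<Sum>l<k. Nx l m * (\<Sum>i<k. x (i, xd l) * (z (i, a) - x (i, a))))" by simp
    also have "\<dots> = (\<Sum>l<k. \<Sum>i<k. (z (i, a) - x (i, a)) * (x (i, xd l) * Nx l m))"
      by (simp add: sum_distrib_left mult_ac)
    also have "\<dots> = (\<Sum>i<k. \<Sum>l<k. (z (i, a) - x (i, a)) * (x (i, xd l) * Nx l m))" by (rule sum.swap)
    also have "\<dots> = (\<Sum>i<k. if i = m then z (i, a) - x (i, a) else 0)"
      using True Nx by (intro sum.cong refl) (simp flip: sum_distrib_left)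
    finally show ?thesis using True by simp
  next
    case False
    then show ?thesis using x(1) by (simp add: z_def act_def affine_space_def tuple_index_def)
  qed
qed

lemma poly_fun_deg_act:
  assumes "\<tau> \<in> T" shows "poly_fun_deg (matrix_index k) 1 (\<lambda>A. act y A \<tau>)"
proof -
  obtain i a where \<tau>: "\<tau> = (i, a)" "i < k" using assms by (auto simp: tuple_index_def)
  have "poly_fun_deg (matrix_index k) 1 (\<lambda>A. \<Sum>j<k. y (j, a) * A (i, j))"
    by (intro poly_fun_deg_sum poly_fun_deg_cmult poly_fun_deg_var) (use \<tau> in \<open>auto simp: matrix_index_def\<close>)
  then show ?thesis using assms \<tau> by (simp add: act_def mult.commute)
qed

lemma poly_fun_deg_transporter:
  "poly_fun_deg T 1 (\<lambda>x. transporter N x ij)"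
proof -
  obtain i j where ij: "ij = (i, j)" by (cases ij)
  show ?thesis
  proof (cases "i < k \<and> j < k")
    case True
    have "poly_fun_deg T 1 (\<lambda>x. \<Sum>l<k. N l j * x (i, xd l))"
      by (intro poly_fun_deg_sum poly_fun_deg_cmult poly_fun_deg_var)
        (use True xd_Mon in \<open>auto simp: tuple_index_def\<close>)
    then show ?thesis using True ij by (simp add: transporter_def mult.commute)
  next
    case False
    then show ?thesis unfolding ij transporter_def prod.case if_not_P[OF False] by simp
  qed
qed

lemma fiber_closed: "closedin (zariski T) (SOS_fiber n d k f)"
  by (rule closedin_zariskiI[where A = UNIV and Q = "\<lambda>c y. sq y c - Poly_Mapping.lookup f c"])
    (auto simp: SOS_fiber_eq fun_eq_iff poly_fun_diff poly_fun_sq_coeff)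

text \<open>A Gram tensor on the fibre is determined by its entries over \<open>Mon\<close>, each of
  which takes finitely many values.\<close>

lemma finite_grams:
  assumes "\<forall>a\<in>Mon. \<forall>b\<in>Mon. finite {gram k y a b | y. sq y = Poly_Mapping.lookup f}"
  shows "finite (gram k ` SOS_fiber n d k f)"
proof (rule finite_imageD)
  let ?r = "\<lambda>g. \<lambda>(a, b)\<in>Mon \<times> Mon. g a b"
  let ?V = "\<lambda>(a, b). {gram k y a b | y. sq y = Poly_Mapping.lookup f}"
  have "finite (PiE (Mon \<times> Mon) ?V)"
    by (rule finite_PiE) (use assms in \<open>auto simp: finite_monomials\<close>)
  moreover have "?r ` gram k ` SOS_fiber n d k f \<subseteq> PiE (Mon \<times> Mon) ?V"
  proof clarify
    fix y assume "y \<in> SOS_fiber n d k f"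
    then have "sq y = Poly_Mapping.lookup f" by (simp add: SOS_fiber_eq)
    then show "?r (gram k y) \<in> PiE (Mon \<times> Mon) ?V" by auto
  qed
  ultimately show "finite (?r ` gram k ` SOS_fiber n d k f)" by (rule rev_finite_subset)
  show "inj_on ?r (gram k ` SOS_fiber n d k f)"
  proof (rule inj_onI, clarify, intro ext)
    fix x y a b
    assume xy: "x \<in> SOS_fiber n d k f" "y \<in> SOS_fiber n d k f" "?r (gram k x) = ?r (gram k y)"
    show "gram k x a b = gram k y a b"
    proof (cases "a \<in> Mon \<and> b \<in> Mon")
      case True
      then show ?thesis using fun_cong[OF xy(3), of "(a, b)"] by simp
    next
      case False
      then show ?thesis using xy gram_affine_zero[of x a b] gram_affine_zero[of y a b] by (simp add: SOS_fiber_eq)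
    qed
  qed
qed

text \<open>\<open>p\<close> is the number of Gram tensors on the fibre, and the copies are the sets
  \<open>X' c\<close> with a given tensor. A chosen point \<open>Y c\<close> identifies
  \<open>O_group k\<close> with such a set through \<open>act\<close> and
  \<open>transporter\<close>.\<close>

lemma fiber_copies:
  assumes ne: "\<exists>y. sq y = Poly_Mapping.lookup f"
    and det: "\<forall>y. sq y = Poly_Mapping.lookup f \<longrightarrow> det (gram_mat y) \<noteq> 0"
    and fin: "\<forall>a\<in>Mon. \<forall>b\<in>Mon. finite {gram k y a b | y. sq y = Poly_Mapping.lookup f}"
  shows "\<exists>p>0. isomorphic_varieties T (SOS_fiber n d k f)
      (add_index (matrix_index k)) (disjoint_copies p (O_group k)) \<and>
    affine_degree T (SOS_fiber n d k f) = p * affine_degree (matrix_index k) (O_group k)"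
proof -
  let ?X = "SOS_fiber n d k f"
  let ?G = "gram k ` ?X"
  have aff: "y \<in> affine_space T" and sqX: "sq y = Poly_Mapping.lookup f" if "y \<in> ?X" for y
    using that by (simp_all add: SOS_fiber_eq)
  have "?X \<noteq> {}"
  proof -
    obtain y where y: "sq y = Poly_Mapping.lookup f" using ne by blast
    obtain F where F: "F \<in> sums_of_squares n d k" "Poly_Mapping.lookup F = sq y"
      using exists_sum_of_squares by blast
    \<comment> \<open>The given solution may have arbitrary coordinates outside \<open>T\<close>,
      which do not influence \<open>sq\<close>.\<close>
    define z where "z \<tau> = (if \<tau> \<in> T then y \<tau> else 0)" for \<tau>
    have "sq z = sq y"
    proof
      show "sq z c = sq y c" for c
        by (rule poly_fun_cong[OF poly_fun_sq_coeff]) (simp add: z_def)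
    qed
    then have "z \<in> ?X" using y by (simp add: SOS_fiber_eq affine_space_def z_def)
    then show ?thesis by blast
  qed
  define p where "p = card ?G"
  have finG: "finite ?G" by (rule finite_grams[OF fin])
  have "0 < p" using finG \<open>?X \<noteq> {}\<close> by (simp add: p_def card_gt_0_iff)
  obtain g where g: "bij_betw g {..<p} ?G"
    using ex_bij_betw_nat_finite[OF finG] unfolding p_def atLeast0LessThan by blast
  have "\<forall>c\<in>{..<p}. \<exists>y. y \<in> ?X \<and> gram k y = g c"
  proof
    fix c assume "c \<in> {..<p}"
    then have "g c \<in> ?G" using g by (auto simp: bij_betw_def)
    then show "\<exists>y. y \<in> ?X \<and> gram k y = g c" by auto
  qed
  then obtain Y where Y: "\<forall>c\<in>{..<p}. Y c \<in> ?X \<and> gram k (Y c) = g c" by (rule bchoice[THEN exE])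
  then have YX: "Y c \<in> ?X" and Yg: "gram k (Y c) = g c" if "c < p" for c using that by simp_all
  have "\<forall>c\<in>{..<p}. \<exists>N. (\<forall>i<k. \<forall>l<k. (\<Sum>j<k. Y c (i, xd j) * N j l) = (if i = l then 1 else 0)) \<and>
      (\<forall>i<k. \<forall>l<k. (\<Sum>j<k. N i j * Y c (j, xd l)) = (if i = l then 1 else 0))"
  proof (rule ballI, rule gram_inverse)
    fix c assume "c \<in> {..<p}"
    then have "sq (Y c) = Poly_Mapping.lookup f" using sqX YX by simp
    then show "det (gram_mat (Y c)) \<noteq> 0" using det by blast
  qed
  then obtain N where "\<forall>c\<in>{..<p}. (\<forall>i<k. \<forall>l<k. (\<Sum>j<k. Y c (i, xd j) * N c j l) = (if i = l then 1 else 0)) \<and>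
      (\<forall>i<k. \<forall>l<k. (\<Sum>j<k. N c i j * Y c (j, xd l)) = (if i = l then 1 else 0))"
    by (rule bchoice[THEN exE])
  then have N: "\<forall>i<k. \<forall>l<k. (\<Sum>j<k. Y c (i, xd j) * N c j l) = (if i = l then 1 else 0)"
    "\<forall>i<k. \<forall>l<k. (\<Sum>j<k. N c i j * Y c (j, xd l)) = (if i = l then 1 else 0)" if "c < p" for c
    using that by simp_all
  define X' where "X' c = {y \<in> ?X. gram k y = g c}" for c
  have X: "?X = (\<Union>c<p. X' c)" using g by (auto simp: X'_def bij_betw_def)
  have dist: "\<exists>ab\<in>Mon \<times> Mon. g b (fst ab) (snd ab) \<noteq> g c (fst ab) (snd ab)" if "b < p" "c < p" "b \<noteq> c" for b c
  proof (rule ccontr)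
    assume eq: "\<not> ?thesis"
    have "gram k (Y b) a a' = gram k (Y c) a a'" for a a'
    proof (cases "a \<in> Mon \<and> a' \<in> Mon")
      case True
      then show ?thesis using eq Yg that by auto
    next
      case False
      then show ?thesis
        using gram_affine_zero[OF aff[OF YX[OF that(1)]], of a a']
          gram_affine_zero[OF aff[OF YX[OF that(2)]], of a a'] by simp
    qed
    then have "g b = g c" unfolding Yg[OF that(1), symmetric] Yg[OF that(2), symmetric] by (intro ext)
    then show False using g that by (auto simp: bij_betw_def inj_on_def)
  qed
  have "\<forall>bc\<in>{(b, c). b < p \<and> c < p \<and> b \<noteq> c}. \<exists>ab. ab \<in> Mon \<times> Mon \<and>
      g (fst bc) (fst ab) (snd ab) \<noteq> g (snd bc) (fst ab) (snd ab)"
  proof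
    fix bc :: "nat \<times> nat" assume "bc \<in> {(b, c). b < p \<and> c < p \<and> b \<noteq> c}"
    then have "fst bc < p" "snd bc < p" "fst bc \<noteq> snd bc" by auto
    from dist[OF this] show "\<exists>ab. ab \<in> Mon \<times> Mon \<and>
      g (fst bc) (fst ab) (snd ab) \<noteq> g (snd bc) (fst ab) (snd ab)" unfolding Bex_def .
  qed
  then obtain s where s: "\<forall>bc\<in>{(b, c). b < p \<and> c < p \<and> b \<noteq> c}. s bc \<in> Mon \<times> Mon \<and>
      g (fst bc) (fst (s bc)) (snd (s bc)) \<noteq> g (snd bc) (fst (s bc)) (snd (s bc))"
    by (rule bchoice[THEN exE])
  define val where "val h b c = h (fst (s (b, c))) (snd (s (b, c)))" for h :: "_ \<Rightarrow> _ \<Rightarrow> complex" and b c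
  have sM: "s (b, c) \<in> Mon \<times> Mon" and sep: "val (g b) b c \<noteq> val (g c) b c" if "b < p" "c < p" "b \<noteq> c" for b c
    using s[THEN bspec, of "(b, c)"] that by (simp_all add: val_def)
  \<comment> \<open>Lagrange interpolation with several coordinates: for every pair of distinct
    tensors \<open>s\<close> names one Gram coordinate that separates them, and each factor uses the
    coordinate of its pair.\<close>
  define e where "e c x = (\<Prod>b\<in>{..<p} - {c}. (val (gram k x) b c - val (g b) b c) / (val (g c) b c - val (g b) b c))" for c x
  have e_poly: "poly_fun T (e c)" if "c < p" for c
    unfolding e_def divide_inverse
  proof (intro poly_fun_prod poly_fun_mult poly_fun_diff poly_fun_const)
    fix b assume "b \<in> {..<p} - {c}"
    then have "s (b, c) \<in> Mon \<times> Mon" using sM that by simp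
    then show "poly_fun T (\<lambda>x. val (gram k x) b c)"
      unfolding val_def by (intro poly_fun_gram) (simp_all add: mem_Times_iff)
  qed
  have e_val: "e c x = (if b = c then 1 else 0)" if "c < p" "b < p" "x \<in> X' b" for b c x
  proof -
    have gx: "gram k x = g b" using that(3) by (simp add: X'_def)
    show ?thesis
    proof (cases "b = c")
      case True
      have "(val (g c) b' c - val (g b') b' c) / (val (g c) b' c - val (g b') b' c) = 1"
        if "b' \<in> {..<p} - {c}" for b'
        using sep[of b' c] that \<open>c < p\<close> by simp
      then show ?thesis using True unfolding e_def gx by (simp add: prod.neutral)
    next
      case False
      have "e c x = 0" unfolding e_def gx by (rule prod_zero) (use False that in auto)
      then show ?thesis using False by simp
    qed
  qed
  have L: "act (Y c) A \<in> X' c" if "c < p" "A \<in> O_group k" for c A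
  proof -
    have gA: "gram k (act (Y c) A) = gram k (Y c)" by (rule gram_act[OF aff[OF YX[OF that(1)]] that(2)])
    then have "sq (act (Y c) A) = Poly_Mapping.lookup f"
      using sq_cong_gram[OF gA] sqX[OF YX[OF that(1)]] by simp
    moreover have "act (Y c) A \<in> affine_space T" by (auto simp: affine_space_def act_def)
    ultimately show ?thesis using gA Yg[OF that(1)] by (simp add: X'_def SOS_fiber_eq)
  qed
  have gX': "gram k x = gram k (Y c)" if "c < p" "x \<in> X' c" for c x
    using that Yg by (simp add: X'_def)
  have M: "transporter (N c) x \<in> O_group k" if "c < p" "x \<in> X' c" for c x
    by (rule transporter_O_group[OF N(1)[OF that(1)] gX'[OF that]])
  have LM: "act (Y c) (transporter (N c) x) = x" if "c < p" "x \<in> X' c" for c x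
  proof -
    have "x \<in> ?X" using that(2) by (simp add: X'_def)
    then have "det (gram_mat x) \<noteq> 0" using det sqX by blast
    then show ?thesis
      by (rule act_transporter[OF N[OF that(1)] aff[OF YX[OF that(1)]] aff[OF \<open>x \<in> ?X\<close>] gX'[OF that]])
  qed
  have ret: "transporter (N c) (act (Y c) A) = A" if "c < p" "A \<in> O_group k" for c A
    by (rule transporter_act[OF N(1)[OF that(1)] that(2)])
  let ?Q = "\<lambda>(j, l) x. (\<Sum>i<k. x (i, j) * x (i, l)) - (if j = l then 1 else 0) :: complex"
  have OQ: "O_group k = {x \<in> affine_space (matrix_index k). \<forall>jl\<in>{..<k} \<times> {..<k}. ?Q jl x = 0}"
    unfolding O_group_eq by (simp add: split_beta)
  have Qpoly: "poly_fun (matrix_index k) (?Q jl)" if jl: "jl \<in> {..<k} \<times> {..<k}" for jl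
  proof -
    obtain j l where jl': "jl = (j, l)" "j < k" "l < k" using jl by auto
    show ?thesis
      unfolding jl'(1) prod.case
      by (intro poly_fun_diff poly_fun_sum poly_fun_mult poly_fun_var poly_fun_const)
        (use jl' in \<open>simp_all add: matrix_index_def\<close>)
  qed
  have "isomorphic_varieties T ?X (add_index (matrix_index k)) (disjoint_copies p (O_group k))"
    by (rule isomorphic_copies[where A = "{..<k} \<times> {..<k}" and Q = ?Q and X' = X' and e = e
          and L = "\<lambda>c. act (Y c)" and M = "\<lambda>c. transporter (N c)"])
      (assumption | rule Qpoly OQ fiber_closed X e_poly e_val poly_funI[OF poly_fun_deg_act]
        poly_funI[OF poly_fun_deg_transporter] L M LM ret)+
  moreover have "affine_degree T ?X = p * affine_degree (matrix_index k) (O_group k)"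
  proof (rule affine_degree_linear_copies[where X' = X' and e = e
        and L = "\<lambda>c. act (Y c)" and M = "\<lambda>c. transporter (N c)"])
    show "finite (matrix_index k)" by (simp add: matrix_index_def)
    show "O_group k \<subseteq> affine_space (matrix_index k)" by (auto simp: O_group_eq)
    show "?X \<subseteq> affine_space T" using aff by blast
  qed (assumption | rule finite_tuple_index O_group_nonempty \<open>0 < p\<close> X e_poly e_val
      poly_fun_deg_act poly_fun_deg_transporter L M LM ret)+
  ultimately show ?thesis using \<open>0 < p\<close> by blast
qed

end

theorem corollary3p6:
  fixes n d k :: nat
  assumes "1 \<le> d" and "1 \<le> k" and "k \<le> n"
  shows "for_general (SOS_topology n d k) (\<lambda>f.
     (\<exists>p>0. isomorphic_varieties
        (tuple_index n d k) (SOS_fiber n d k f)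
        (add_index (matrix_index k)) (disjoint_copies p (O_group k))) \<and>
     affine_degree (tuple_index n d k) (SOS_fiber n d k f)
       \<ge> affine_degree (matrix_index k) (O_group k) \<and>
     [affine_degree (tuple_index n d k) (SOS_fiber n d k f) = 0]
       (mod affine_degree (matrix_index k) (O_group k)))"
proof -
  interpret sos n d k by standard (use assms in auto)
  obtain b where b: "poly_fun Mon2 b" "\<exists>y. b (sq y) \<noteq> 0"
    "\<forall>f\<in>SOS n d k. b (Poly_Mapping.lookup f) \<noteq> 0 \<longrightarrow>
      (\<exists>y. sq y = Poly_Mapping.lookup f) \<and>
      (\<forall>y. sq y = Poly_Mapping.lookup f \<longrightarrow> det (gram_mat y) \<noteq> 0) \<and>
      (\<forall>a\<in>Mon. \<forall>b\<in>Mon. finite {gram k y a b | y. sq y = Poly_Mapping.lookup f})"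
    using general_fiber by (elim exE conjE) (rule that; (assumption | erule exI))
  obtain y0 where y0: "b (sq y0) \<noteq> 0" using b(2) by (elim exE) (rule that)
  show ?thesis
  proof (rule for_general_SOS[OF b(1) y0])
    fix f assume f: "f \<in> SOS n d k" "b (Poly_Mapping.lookup f) \<noteq> 0"
    note conds = b(3)[THEN bspec, OF f(1), THEN mp, OF f(2)]
    from fiber_copies[OF conds[THEN conjunct1] conds[THEN conjunct2, THEN conjunct1]
        conds[THEN conjunct2, THEN conjunct2]]
    obtain p where p: "0 < p"
      "isomorphic_varieties T (SOS_fiber n d k f) (add_index (matrix_index k)) (disjoint_copies p (O_group k))"
      "affine_degree T (SOS_fiber n d k f) = p * affine_degree (matrix_index k) (O_group k)" by blast
    then show "(\<exists>p>0. isomorphic_varieties T (SOS_fiber n d k f)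
        (add_index (matrix_index k)) (disjoint_copies p (O_group k))) \<and>
     affine_degree T (SOS_fiber n d k f) \<ge> affine_degree (matrix_index k) (O_group k) \<and>
     [affine_degree T (SOS_fiber n d k f) = 0] (mod affine_degree (matrix_index k) (O_group k))"
      by (auto simp: cong_def)
  qed
qed

end
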